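(* Let $\mathsf{R}$ be the Riemann curvature tensor of the metric $g$ induced from a $G_2$-structure $\varphi$ on a $7$-manifold, regarded as a self-adjoint operator on $\Omega^2=\Omega^2_7\oplus\Omega^2_{14}$, and let $\mathsf{R}^a_b=\pi_b\mathsf{R}\pi_a:\Omega^2_a\to\Omega^2_b$ for $a,b\in\{7,14\}$. Then: (i) $\mathsf{R}^7_7=0$ if and only if $R=0$ and $4\,\mathrm{Rc}^0+5\varpi=0$; (ii) $\mathsf{R}^{14}_{14}=0$ if and only if $R=0$ and $64\,\mathrm{Rc}^0+5\varpi=0$ and $\mathsf{W}_{77}=0$; (iii) $\mathsf{R}^7_{14}+\mathsf{R}^{14}_7=0$ if and only if $56\,\mathrm{Rc}^0-5\varpi=0$ and $\mathsf{W}_{64}=0$. Consequently, $\mathsf{R}$ preserves the splitting $\Omega^2_7\oplus\Omega^2_{14}$ (acts diagonally) if and only if $\mathsf{W}_{64}=0$ and $\varpi=\tfrac{56}{5}\mathrm{Rc}^0$; and $\mathsf{R}$ reverses the splitting (acts anti-diagonally) if and only if $\mathrm{Rc}=0$, $\varpi=0$ and $\mathsf{W}_{77}=0$.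
   Context: A $G_2$-structure on a smooth $7$-manifold $M$ is a smooth $3$-form $\varphi$ which is nondegenerate: it determines a Riemannian metric $g$ and volume form $\mathrm{vol}$ by $(X\lrcorner\varphi)\wedge(Y\lrcorner\varphi)\wedge\varphi=-6\,g(X,Y)\,\mathrm{vol}$. Let $\nabla$ be the Levi-Civita connection of $g$ and $\psi=\star\varphi$. Indices refer to a local $g$-orthonormal frame, repeated indices are summed, and $\varphi_{ijk}\varphi_{abk}=g_{ia}g_{jb}-g_{ib}g_{ja}-\psi_{ijab}$. With $(\mathsf{P}\beta)_{ab}=\beta_{ij}\psi_{ijab}$ on $2$-forms, $\Omega^2=\Omega^2_7\oplus\Omega^2_{14}$ orthogonally, $\Omega^2_7=\{\mathsf{P}\beta=-4\beta\}$, $\Omega^2_{14}=\{\mathsf{P}\beta=2\beta\}=\{\beta:\beta_{ij}\varphi_{ijk}=0\}$, with orthogonal projections $\pi_7,\pi_{14}$. Curvature: $R_{ijkl}=g(\nabla_{e_i}\nabla_{e_j}e_k-\nabla_{e_j}\nabla_{e_i}e_k-\nabla_{[e_i,e_j]}e_k,e_l)$, $\mathrm{Rc}_{jk}=R_{ljkl}$, $R=\mathrm{Rc}_{jj}$, $\mathrm{Rc}^0=\mathrm{Rc}-\tfrac17Rg$. A tensor $U_{ijkl}=-U_{jikl}=-U_{ijlk}=U_{klij}$ acts on $\Omega^2$ by $(U\beta)_{ij}=U_{ijkl}\beta_{kl}$; $\mathsf{R}$ and $\mathsf{W}$ denote the operators given by $R_{ijkl}$ and by the Weyl tensor $W_{ijkl}$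 of $g$ (the totally trace-free part of $R_{ijkl}$). Set $\varpi_{pq}=W_{ijkl}\varphi_{ijp}\varphi_{klq}$, a traceless symmetric $2$-tensor. Under $G_2$, the space of algebraic Weyl tensors on a tangent space decomposes orthogonally into irreducible representations of dimensions $27$, $64$, $77$, and $\mathsf{W}=\mathsf{W}_{27}+\mathsf{W}_{64}+\mathsf{W}_{77}$ accordingly. Concretely, the $27$-dimensional summand is the orthogonal complement, in the space of Weyl tensors, of the kernel of $U\mapsto U_{ijkl}\varphi_{ijp}\varphi_{klq}$; the $77$-dimensional summand consists of those $U$ with $U_{ijkl}=-U_{jikl}=-U_{ijlk}=U_{klij}$, $U_{ijkl}\varphi_{klm}=0$, $U_{ljkl}=0$; the $64$-dimensional summand is the orthogonal complement of these two. *)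

theory Defs
  imports "HOL-Analysis.Analysis"
begin

type_synonym vec7 = "real^7"

section \<open>Smooth maps and smooth manifolds of dimension 7\<close>

primrec Ck_on :: "nat \<Rightarrow> 'a::real_normed_vector set \<Rightarrow> ('a \<Rightarrow> 'b::real_normed_vector) \<Rightarrow> bool" where
  "Ck_on 0 S f \<longleftrightarrow> continuous_on S f"
| "Ck_on (Suc k) S f \<longleftrightarrow>
     f differentiable_on S \<and> (\<forall>v. Ck_on k S (\<lambda>x. frechet_derivative f (at x) v))"

text \<open>Only used for open sets of a finite-dimensional space, where all iterated directional
  derivatives being continuous is the usual notion of smoothness.\<close>

definition smooth_on :: "'a::real_normed_vector set \<Rightarrow> ('a \<Rightarrow> 'b::real_normed_vector) \<Rightarrow> bool" where
  "smooth_on S f \<longleftrightarrow> (\<forall>k. Ck_on k S f)"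

type_synonym 'a chart = "'a set \<times> ('a \<Rightarrow> vec7)"

abbreviation chart_dom :: "'a chart \<Rightarrow> 'a set" where "chart_dom \<equiv> fst"
abbreviation chart_map :: "'a chart \<Rightarrow> 'a \<Rightarrow> vec7" where "chart_map \<equiv> snd"

definition chart_image :: "'a chart \<Rightarrow> vec7 set" where
  "chart_image c = chart_map c ` chart_dom c"

definition is_chart :: "'a topology \<Rightarrow> 'a chart \<Rightarrow> bool" where
  "is_chart X c \<longleftrightarrow> openin X (chart_dom c) \<and> open (chart_image c) \<and>
     homeomorphic_map (subtopology X (chart_dom c)) (top_of_set (chart_image c)) (chart_map c)"

definition transition :: "'a chart \<Rightarrow> 'a chart \<Rightarrow> vec7 \<Rightarrow> vec7" where
  "transition c d = chart_map d \<circ> inv_into (chart_dom c) (chart_map c)"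

definition smooth_manifold7 :: "'a topology \<Rightarrow> 'a chart set \<Rightarrow> bool" where
  "smooth_manifold7 X A \<longleftrightarrow> Hausdorff_space X \<and> second_countable X \<and>
     (\<forall>c\<in>A. is_chart X c) \<and> (\<Union>c\<in>A. chart_dom c) = topspace X \<and>
     (\<forall>c\<in>A. \<forall>d\<in>A. smooth_on (chart_map c ` (chart_dom c \<inter> chart_dom d)) (transition c d))"

text \<open>A tangent vector at \<open>p\<close> is represented in a chart around \<open>p\<close> by an element of
  \<^typ>\<open>vec7\<close>; \<open>tangent_change\<close> converts the representation from chart \<open>c\<close> to chart \<open>d\<close>.\<close>

definition tangent_change :: "'a chart \<Rightarrow> 'a chart \<Rightarrow> 'a \<Rightarrow> vec7 \<Rightarrow> vec7" where
  "tangent_change c d p = frechet_derivative (transition c d) (at (chart_map c p))"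

section \<open>Tensor fields\<close>

text \<open>A tensor field on the manifold assigns to each chart a tensor field on the image of the chart,
  compatibly with changes of chart.\<close>

type_synonym 'a threeform_field = "'a chart \<Rightarrow> vec7 \<Rightarrow> vec7 \<Rightarrow> vec7 \<Rightarrow> vec7 \<Rightarrow> real"
type_synonym 'a metric_field = "'a chart \<Rightarrow> vec7 \<Rightarrow> vec7 \<Rightarrow> vec7 \<Rightarrow> real"
type_synonym 'a volume_field = "'a chart \<Rightarrow> vec7 \<Rightarrow> real"

definition three_form :: "(vec7 \<Rightarrow> vec7 \<Rightarrow> vec7 \<Rightarrow> real) \<Rightarrow> bool" where
  "three_form f \<longleftrightarrow> (\<forall>v w. linear (\<lambda>u. f u v w)) \<and>
     (\<forall>u v w. f v u w = - f u v w) \<and> (\<forall>u v w. f u w v = - f u v w)"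

definition smooth_three_form :: "'a chart set \<Rightarrow> 'a threeform_field \<Rightarrow> bool" where
  "smooth_three_form A \<phi> \<longleftrightarrow>
     (\<forall>c\<in>A. (\<forall>x\<in>chart_image c. three_form (\<phi> c x)) \<and>
             (\<forall>u v w. smooth_on (chart_image c) (\<lambda>x. \<phi> c x u v w))) \<and>
     (\<forall>c\<in>A. \<forall>d\<in>A. \<forall>p\<in>chart_dom c \<inter> chart_dom d. \<forall>u v w.
        \<phi> c (chart_map c p) u v w =
        \<phi> d (chart_map d p) (tangent_change c d p u) (tangent_change c d p v) (tangent_change c d p w))"

definition riemannian_metric :: "'a chart set \<Rightarrow> 'a metric_field \<Rightarrow> bool" where
  "riemannian_metric A g \<longleftrightarrow>
     (\<forall>c\<in>A. (\<forall>x\<in>chart_image c. bilinear (g c x) \<and> (\<forall>u v. g c x u v = g c x v u) \<and>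
                               (\<forall>u. u \<noteq> 0 \<longrightarrow> g c x u u > 0)) \<and>
             (\<forall>u v. smooth_on (chart_image c) (\<lambda>x. g c x u v))) \<and>
     (\<forall>c\<in>A. \<forall>d\<in>A. \<forall>p\<in>chart_dom c \<inter> chart_dom d. \<forall>u v.
        g c (chart_map c p) u v =
        g d (chart_map d p) (tangent_change c d p u) (tangent_change c d p v))"

definition orthonormal_frame :: "(vec7 \<Rightarrow> vec7 \<Rightarrow> real) \<Rightarrow> (7 \<Rightarrow> vec7) \<Rightarrow> bool" where
  "orthonormal_frame G e \<longleftrightarrow> (\<forall>i j. G (e i) (e j) = (if i = j then 1 else 0))"

text \<open>A 7-form in a chart is \<open>\<nu> dx\<^sup>1 \<and> \<dots> \<and> dx\<^sup>7\<close> with a scalar function \<open>\<nu>\<close>; this is the value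
  of such a form on the vectors \<open>E 1, \<dots>, E 7\<close>.\<close>

definition top_form :: "real \<Rightarrow> (7 \<Rightarrow> vec7) \<Rightarrow> real" where
  "top_form \<nu> E = \<nu> * det (\<chi> i. E i)"

text \<open>The volume form of \<open>g\<close> for some orientation: a smooth 7-form taking values \<open>\<plusminus>1\<close> on
  orthonormal frames.\<close>

definition volume_form :: "'a chart set \<Rightarrow> 'a metric_field \<Rightarrow> 'a volume_field \<Rightarrow> bool" where
  "volume_form A g \<nu> \<longleftrightarrow>
     (\<forall>c\<in>A. smooth_on (chart_image c) (\<nu> c) \<and>
        (\<forall>x\<in>chart_image c. \<forall>e. orthonormal_frame (g c x) e \<longrightarrow> \<bar>top_form (\<nu> c x) e\<bar> = 1)) \<and>
     (\<forall>c\<in>A. \<forall>d\<in>A. \<forall>p\<in>chart_dom c \<inter> chart_dom d. \<forall>E.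
        top_form (\<nu> c (chart_map c p)) E =
        top_form (\<nu> d (chart_map d p)) (\<lambda>i. tangent_change c d p (E i)))"

text \<open>\<open>(\<alpha> \<and> \<beta> \<and> \<gamma>)(E 1, \<dots>, E 7)\<close> for forms of degree 2, 2, 3, in the normalisation in which
  \<open>dx\<^sup>1 \<and> \<dots> \<and> dx\<^sup>k\<close> takes the value 1 on the standard basis vectors.\<close>

definition wedge223 ::
  "(vec7 \<Rightarrow> vec7 \<Rightarrow> real) \<Rightarrow> (vec7 \<Rightarrow> vec7 \<Rightarrow> real) \<Rightarrow> (vec7 \<Rightarrow> vec7 \<Rightarrow> vec7 \<Rightarrow> real)
     \<Rightarrow> (7 \<Rightarrow> vec7) \<Rightarrow> real" where
  "wedge223 \<alpha> \<beta> \<gamma> E =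
     (\<Sum>\<sigma> | \<sigma> permutes (UNIV::7 set).
        of_int (sign \<sigma>) * \<alpha> (E (\<sigma> 1)) (E (\<sigma> 2)) * \<beta> (E (\<sigma> 3)) (E (\<sigma> 4))
          * \<gamma> (E (\<sigma> 5)) (E (\<sigma> 6)) (E (\<sigma> 7))) / (fact 2 * fact 2 * fact 3)"

text \<open>\<open>\<phi>\<close> is a \<open>G\<^sub>2\<close>-structure with induced metric \<open>g\<close> and volume form \<open>\<nu>\<close>, that is
  \<open>(X \<lrcorner> \<phi>) \<and> (Y \<lrcorner> \<phi>) \<and> \<phi> = -6 g(X,Y) \<nu>\<close>. Both \<open>g\<close> and \<open>\<nu>\<close> are uniquely determined by \<open>\<phi>\<close>.\<close>

definition G2_structure ::
  "'a topology \<Rightarrow> 'a chart set \<Rightarrow> 'a threeform_field \<Rightarrow> 'a metric_field \<Rightarrow> 'a volume_field \<Rightarrow> bool" where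
  "G2_structure X A \<phi> g \<nu> \<longleftrightarrow>
     smooth_manifold7 X A \<and> smooth_three_form A \<phi> \<and> riemannian_metric A g \<and> volume_form A g \<nu> \<and>
     (\<forall>c\<in>A. \<forall>x\<in>chart_image c. \<forall>u v E.
        wedge223 (\<phi> c x u) (\<phi> c x v) (\<phi> c x) E = - 6 * g c x u v * top_form (\<nu> c x) E)"

section \<open>Levi-Civita connection and curvature in a chart\<close>

text \<open>The Christoffel symbols of a metric \<open>G\<close> on an open subset of \<^typ>\<open>vec7\<close>:
  \<open>christoffel G x u v\<close> is the value at \<open>x\<close> of \<open>\<nabla>\<^sub>u v\<close> for constant vector fields \<open>u\<close>, \<open>v\<close>, where
  \<open>\<nabla>\<close> is the torsion-free connection (constant fields commute) that is compatible with \<open>G\<close>.\<close>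

definition christoffel :: "(vec7 \<Rightarrow> vec7 \<Rightarrow> vec7 \<Rightarrow> real) \<Rightarrow> vec7 \<Rightarrow> vec7 \<Rightarrow> vec7 \<Rightarrow> vec7" where
  "christoffel G x = (THE \<Gamma>. bilinear \<Gamma> \<and> (\<forall>u v. \<Gamma> u v = \<Gamma> v u) \<and>
     (\<forall>u v w. frechet_derivative (\<lambda>y. G y v w) (at x) u = G x (\<Gamma> u v) w + G x v (\<Gamma> u w)))"

definition nabla ::
  "(vec7 \<Rightarrow> vec7 \<Rightarrow> vec7 \<Rightarrow> real) \<Rightarrow> (vec7 \<Rightarrow> vec7) \<Rightarrow> (vec7 \<Rightarrow> vec7) \<Rightarrow> vec7 \<Rightarrow> vec7" where
  "nabla G V W x = frechet_derivative W (at x) (V x) + christoffel G x (V x) (W x)"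

definition lie_bracket :: "(vec7 \<Rightarrow> vec7) \<Rightarrow> (vec7 \<Rightarrow> vec7) \<Rightarrow> vec7 \<Rightarrow> vec7" where
  "lie_bracket V W x = frechet_derivative W (at x) (V x) - frechet_derivative V (at x) (W x)"

definition curvature_field ::
  "(vec7 \<Rightarrow> vec7 \<Rightarrow> vec7 \<Rightarrow> real) \<Rightarrow> (vec7 \<Rightarrow> vec7) \<Rightarrow> (vec7 \<Rightarrow> vec7) \<Rightarrow> (vec7 \<Rightarrow> vec7) \<Rightarrow> vec7 \<Rightarrow> vec7" where
  "curvature_field G V W Z x =
     nabla G V (nabla G W Z) x - nabla G W (nabla G V Z) x - nabla G (lie_bracket V W) Z x"

text \<open>By tensoriality the vectors may be extended to vector fields in any way; we use the extensions
  that are constant in the chart.\<close>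

definition riemann_tensor ::
  "(vec7 \<Rightarrow> vec7 \<Rightarrow> vec7 \<Rightarrow> real) \<Rightarrow> vec7 \<Rightarrow> vec7 \<Rightarrow> vec7 \<Rightarrow> vec7 \<Rightarrow> vec7 \<Rightarrow> real" where
  "riemann_tensor G x u v w z = G x (curvature_field G (\<lambda>_. u) (\<lambda>_. v) (\<lambda>_. w) x) z"

section \<open>Components in orthonormal frames\<close>

type_synonym tensor2 = "real^7^7"
type_synonym tensor3 = "real^7^7^7"
type_synonym tensor4 = "real^7^7^7^7"

text \<open>A frame consists of a chart, a point of its domain, and a basis of the tangent space
  at the point represented in the chart.\<close>

type_synonym 'a frame = "'a chart \<times> 'a \<times> (7 \<Rightarrow> vec7)"

definition frames :: "'a chart set \<Rightarrow> 'a metric_field \<Rightarrow> 'a set \<Rightarrow> 'a frame set" where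
  "frames A g S =
     {(c, p, e). c \<in> A \<and> p \<in> chart_dom c \<and> p \<in> S \<and> orthonormal_frame (g c (chart_map c p)) e}"

definition phi_comp :: "'a threeform_field \<Rightarrow> 'a frame \<Rightarrow> tensor3" where
  "phi_comp \<phi> F = (case F of (c, p, e) \<Rightarrow> \<chi> i j k. \<phi> c (chart_map c p) (e i) (e j) (e k))"

text \<open>\<open>\<psi> = \<star>\<phi>\<close>, that is \<open>\<psi>\<^sub>i\<^sub>j\<^sub>k\<^sub>l = (1/3!) \<phi>\<^sub>a\<^sub>b\<^sub>c \<nu>\<^sub>a\<^sub>b\<^sub>c\<^sub>i\<^sub>j\<^sub>k\<^sub>l\<close>.\<close>

definition psi_comp :: "'a threeform_field \<Rightarrow> 'a volume_field \<Rightarrow> 'a frame \<Rightarrow> tensor4" where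
  "psi_comp \<phi> \<nu> F = (case F of (c, p, e) \<Rightarrow> \<chi> i j k l.
     (\<Sum>a\<in>UNIV. \<Sum>b\<in>UNIV. \<Sum>d\<in>UNIV. phi_comp \<phi> F $ a $ b $ d *
        top_form (\<nu> c (chart_map c p)) (($) (vector [e a, e b, e d, e i, e j, e k, e l]))) / fact 3)"

definition riem_comp :: "'a metric_field \<Rightarrow> 'a frame \<Rightarrow> tensor4" where
  "riem_comp g F = (case F of (c, p, e) \<Rightarrow>
     \<chi> i j k l. riemann_tensor (g c) (chart_map c p) (e i) (e j) (e k) (e l))"

section \<open>Tensor algebra in an orthonormal frame\<close>

definition ric :: "tensor4 \<Rightarrow> tensor2" where
  "ric R = (\<chi> j k. \<Sum>l\<in>UNIV. R $ l $ j $ k $ l)"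

definition scal :: "tensor4 \<Rightarrow> real" where
  "scal R = (\<Sum>j\<in>UNIV. ric R $ j $ j)"

definition ric0 :: "tensor4 \<Rightarrow> tensor2" where
  "ric0 R = ric R - (scal R / 7) *\<^sub>R mat 1"

abbreviation kron :: "7 \<Rightarrow> 7 \<Rightarrow> real" where
  "kron i j \<equiv> (if i = j then 1 else 0)"

text \<open>With \<open>n = 7\<close>: the coefficients are \<open>1/(n-2)\<close> and \<open>1/(n(n-1))\<close>. The signs are those
  of the convention \<open>Rc\<^sub>j\<^sub>k = R\<^sub>l\<^sub>j\<^sub>k\<^sub>l\<close>.\<close>

definition weyl :: "tensor4 \<Rightarrow> tensor4" where
  "weyl R = (\<chi> i j k l. R $ i $ j $ k $ l
     - (1 / 5) * (kron i l * ric0 R $ j $ k + kron j k * ric0 R $ i $ l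
                  - kron i k * ric0 R $ j $ l - kron j l * ric0 R $ i $ k)
     - (scal R / 42) * (kron i l * kron j k - kron i k * kron j l))"

definition curv_sym :: "tensor4 set" where
  "curv_sym = {U. \<forall>i j k l. U $ i $ j $ k $ l = - U $ j $ i $ k $ l \<and>
                            U $ i $ j $ k $ l = - U $ i $ j $ l $ k \<and>
                            U $ i $ j $ k $ l = U $ k $ l $ i $ j}"

definition weyl_tensors :: "tensor4 set" where
  "weyl_tensors = {U \<in> curv_sym.
     (\<forall>i j k l. U $ i $ j $ k $ l + U $ j $ k $ i $ l + U $ k $ i $ j $ l = 0) \<and> ric U = 0}"

text \<open>The contraction \<open>U \<mapsto> U\<^sub>i\<^sub>j\<^sub>k\<^sub>l \<phi>\<^sub>i\<^sub>j\<^sub>p \<phi>\<^sub>k\<^sub>l\<^sub>q\<close>, whose value at the Weyl tensor is \<open>\<varpi>\<close>.\<close>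

definition varpi :: "tensor3 \<Rightarrow> tensor4 \<Rightarrow> tensor2" where
  "varpi f U = (\<chi> p q. \<Sum>i\<in>UNIV. \<Sum>j\<in>UNIV. \<Sum>k\<in>UNIV. \<Sum>l\<in>UNIV.
     U $ i $ j $ k $ l * f $ i $ j $ p * f $ k $ l $ q)"

definition orth_proj :: "'b::euclidean_space set \<Rightarrow> 'b \<Rightarrow> 'b" where
  "orth_proj V x = (THE y. y \<in> V \<and> x - y \<in> V\<^sup>\<bottom>)"

definition weyl27 :: "tensor3 \<Rightarrow> tensor4 set" where
  "weyl27 f = weyl_tensors \<inter> {U \<in> weyl_tensors. varpi f U = 0}\<^sup>\<bottom>"

definition weyl77 :: "tensor3 \<Rightarrow> tensor4 set" where
  "weyl77 f = {U \<in> curv_sym.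
     (\<forall>i j m. (\<Sum>k\<in>UNIV. \<Sum>l\<in>UNIV. U $ i $ j $ k $ l * f $ k $ l $ m) = 0) \<and>
     (\<forall>j k. (\<Sum>l\<in>UNIV. U $ l $ j $ k $ l) = 0)}"

definition weyl64 :: "tensor3 \<Rightarrow> tensor4 set" where
  "weyl64 f = weyl_tensors \<inter> (weyl27 f \<union> weyl77 f)\<^sup>\<bottom>"

definition two_forms :: "tensor2 set" where
  "two_forms = {\<beta>. \<forall>i j. \<beta> $ i $ j = - \<beta> $ j $ i}"

definition P_op :: "tensor4 \<Rightarrow> tensor2 \<Rightarrow> tensor2" where
  "P_op \<psi> \<beta> = (\<chi> a b. \<Sum>i\<in>UNIV. \<Sum>j\<in>UNIV. \<beta> $ i $ j * \<psi> $ i $ j $ a $ b)"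

definition Omega7 :: "tensor4 \<Rightarrow> tensor2 set" where
  "Omega7 \<psi> = {\<beta> \<in> two_forms. P_op \<psi> \<beta> = (- 4) *\<^sub>R \<beta>}"

definition Omega14 :: "tensor4 \<Rightarrow> tensor2 set" where
  "Omega14 \<psi> = {\<beta> \<in> two_forms. P_op \<psi> \<beta> = 2 *\<^sub>R \<beta>}"

definition curv_op :: "tensor4 \<Rightarrow> tensor2 \<Rightarrow> tensor2" where
  "curv_op U \<beta> = (\<chi> i j. \<Sum>k\<in>UNIV. \<Sum>l\<in>UNIV. U $ i $ j $ k $ l * \<beta> $ k $ l)"

text \<open>For subspaces \<open>V\<close>, \<open>V'\<close> of 2-forms: the block of the operator \<open>U\<close> that maps \<open>V\<close> to \<open>V'\<close>,
  extended by zero to the orthogonal complement of \<open>V\<close>.\<close>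

definition block :: "tensor2 set \<Rightarrow> tensor2 set \<Rightarrow> tensor4 \<Rightarrow> tensor2 \<Rightarrow> tensor2" where
  "block V V' U \<beta> = orth_proj V' (curv_op U (orth_proj V \<beta>))"

end

theory Submission
  imports Defs
begin

text \<open>
  Everything happens at one point, in one orthonormal frame. By maximality of \<open>\<phi>\<close> on unit triples
  and the defining relation of the metric, \<open>\<phi>\<close> takes the standard form in a suitable orthonormal
  basis, so \<open>|u \<times> v|\<^sup>2 = |u|\<^sup>2|v|\<^sup>2 - (u \<bullet> v)\<^sup>2\<close> for the cross product defined by \<open>\<phi>\<close>. By polarisation,
  \<open>g\<^sub>i\<^sub>a g\<^sub>j\<^sub>b - g\<^sub>i\<^sub>b g\<^sub>j\<^sub>a - \<phi>\<^sub>i\<^sub>j\<^sub>k \<phi>\<^sub>a\<^sub>b\<^sub>k\<close> is a 4-form, and it equals \<open>\<psi>\<close> because the inner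
  product of the two attains the Cauchy-Schwarz bound. Hence the projection to \<open>\<Omega>\<^sup>2\<^sub>7\<close> is \<open>\<Phi>\<Phi>\<^sup>T/6\<close>
  with \<open>(\<Phi> v)\<^sub>i\<^sub>j = \<phi>\<^sub>i\<^sub>j\<^sub>k v\<^sub>k\<close>.

  Write the curvature operator as \<open>N + X + S\<close>, where \<open>N\<close> and \<open>S\<close> are the diagonal blocks on \<open>\<Omega>\<^sup>2\<^sub>7\<close> and
  \<open>\<Omega>\<^sup>2\<^sub>1\<^sub>4\<close> and \<open>X\<close> is the off-diagonal part. Then \<open>N\<close> is determined by
  \<open>\<Phi>\<^sup>T R \<Phi> = \<varpi> + 4/5 Rc\<^sup>0 - 2/7 R g\<close>, and the Bianchi identity gives \<open>90 Rc(X) = 56 Rc\<^sup>0 - 5\<varpi>\<close> and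
  \<open>180 Rc(S) = 64 Rc\<^sup>0 + 5\<varpi> + 120/7 R g\<close>. If \<open>S\<close> is Ricci-flat, it is an element of the 77-dimensional
  summand, whence \<open>|S|\<^sup>2 = S \<bullet> R = S \<bullet> W\<^sub>7\<^sub>7\<close>. If \<open>X\<close> is Ricci-flat, it is an element of the 64-dimensional
  summand, whence \<open>|X|\<^sup>2 = X \<bullet> W\<^sub>6\<^sub>4\<close>: the failure of the Bianchi identity for \<open>X\<close> is a 4-form whose
  contraction with \<open>\<psi>\<close> over three indices vanishes, and such a 4-form is zero. Conversely, the elements
  of these summands are block diagonal on \<open>\<Omega>\<^sup>2\<^sub>1\<^sub>4\<close> and purely off-diagonal, respectively.
\<close>

section \<open>Mixed second derivatives\<close>

text \<open>The metric is tied to \<phi> only by the relation with the factor -6, and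
  \<open>psi_comp\<close> is a Hodge dual for whichever orientation \<nu> carries. The contraction
  identity of \<phi>, including the sign of its \<psi> term, is therefore not an input and has to be
  extracted from that relation. The summands of the Weyl tensors are handled without irreducibility
  or Schur's lemma. U \<mapsto> X and U \<mapsto> S are self-adjoint idempotents on tensors, so the
  squared norm of a block is its inner product with R; a Ricci-flat block is orthogonal to the Ricci
  part of R, which leaves the Weyl tensor. Ricci-flatness of the block is the linear equation
  between the Ricci tensor and \<open>varpi\<close>, and the rest is orthogonality to one summand.
  The two cases differ: the 77-dimensional summand is defined without a Bianchi identity, so S
  belongs to it as soon as it is Ricci-flat, whereas for X the identity must be proved. The Ricci
  coefficients start from one fact: composing R with the projection to the 7-dimensional summand
  multiplies its Ricci contraction by 1/3, since the Bianchi identity removes the \<psi>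
  term.\<close>

lemma frechet_derivative_unique:
  "(f has_derivative f') (at x) \<Longrightarrow> frechet_derivative f (at x) = f'"
  using frechet_derivative_at by metis

lemma has_frechet_derivative:
  "f differentiable (at x) \<Longrightarrow> (f has_derivative frechet_derivative f (at x)) (at x)"
  using frechet_derivative_works by blast

lemma frechet_derivative_cong_open:
  assumes "open S" "x \<in> S" "\<And>y. y \<in> S \<Longrightarrow> f y = g y"
  shows "frechet_derivative f (at x) = frechet_derivative g (at x)"
proof -
  have "(f has_derivative D) (at x) \<longleftrightarrow> (g has_derivative D) (at x)" for D
    using has_derivative_transform_within_open[of f D x UNIV S g] has_derivative_transform_within_open[of g D x UNIV S f] assms
    by auto
  then show ?thesis by (simp add: frechet_derivative_def)
qed

text \<open>Cramer's rule presents the Christoffel symbols as quotients of determinants; their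
  differentiability rests on this.\<close>

lemma differentiable_det:
  fixes N :: "'a::real_normed_vector \<Rightarrow> real^'n^'n"
  assumes "\<And>i j. (\<lambda>y. N y $ i $ j) differentiable (at x)"
  shows "(\<lambda>y. det (N y)) differentiable (at x)"
proof -
  obtain D where "\<And>i j. ((\<lambda>y. N y $ i $ j) has_derivative D i j) (at x)"
    using assms unfolding differentiable_def by metis
  then have "\<exists>D'. ((\<lambda>y. \<Sum>p | p permutes UNIV. of_int (sign p) * (\<Prod>i\<in>UNIV. N y $ i $ p i)) has_derivative D') (at x)"
    by (intro exI) (rule derivative_eq_intros refl | assumption)+
  then show ?thesis unfolding det_def differentiable_def by simp
qed

lemma differentiable_vec_lambda:
  fixes f :: "'a::real_normed_vector \<Rightarrow> 'n::finite \<Rightarrow> real"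
  assumes "\<And>i. (\<lambda>y. f y i) differentiable (at x)"
  shows "(\<lambda>y. \<chi> i. f y i) differentiable (at x)"
  unfolding differentiable_componentwise_within[of "\<lambda>y. \<chi> i. f y i"]
  using assms by (auto simp: Basis_vec_def inner_axis)

lemma has_derivative_vec_nth:
  assumes "(a has_derivative a') F"
  shows "((\<lambda>y. (a y :: real^'n) $ i) has_derivative (\<lambda>h. a' h $ i)) F"
  using bounded_linear.has_derivative[OF bounded_linear_vec_nth assms] .

text \<open>The mean value theorem applied twice, along u to the increment in direction v and then
  along v to the derivative in direction u. The second difference on the left is symmetric in u and
  v, while the right-hand side records an order of differentiation.\<close>

lemma mixed_difference:
  fixes h :: "'a::euclidean_space \<Rightarrow> real"
  assumes t: "t > 0" and S: "\<And>r q. 0 \<le> r \<Longrightarrow> r \<le> t \<Longrightarrow> 0 \<le> q \<Longrightarrow> q \<le> t \<Longrightarrow> x + r *\<^sub>R u + q *\<^sub>R v \<in> S"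
    and dh: "\<And>y. y \<in> S \<Longrightarrow> h differentiable (at y)"
    and ddh: "\<And>y. y \<in> S \<Longrightarrow> (\<lambda>y. frechet_derivative h (at y) u) differentiable (at y)"
  obtains r q where "0 \<le> r" "r \<le> t" "0 \<le> q" "q \<le> t"
    "h (x + t *\<^sub>R u + t *\<^sub>R v) - h (x + t *\<^sub>R u) - h (x + t *\<^sub>R v) + h x
      = t\<^sup>2 * frechet_derivative (\<lambda>y. frechet_derivative h (at y) u) (at (x + r *\<^sub>R u + q *\<^sub>R v)) v"
proof -
  define Du where "Du y = frechet_derivative h (at y) u" for y
  have line: "((\<lambda>r. p + r *\<^sub>R w) has_derivative (\<lambda>d. d *\<^sub>R w)) (at r)" for p w :: 'a and r :: real
    by (auto intro!: derivative_eq_intros)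
  have Dh: "((\<lambda>r. h (x + r *\<^sub>R u + q *\<^sub>R v)) has_real_derivative Du (x + r *\<^sub>R u + q *\<^sub>R v)) (at r)"
    if "0 \<le> r" "r \<le> t" "0 \<le> q" "q \<le> t" for r q
  proof -
    let ?y = "x + r *\<^sub>R u + q *\<^sub>R v"
    have "(h has_derivative frechet_derivative h (at ?y)) (at (x + q *\<^sub>R v + r *\<^sub>R u))"
      using has_frechet_derivative[OF dh[OF S[OF that]]] by (simp add: add_ac)
    from has_derivative_compose[OF line this]
    have "((\<lambda>r. h (x + q *\<^sub>R v + r *\<^sub>R u)) has_derivative (\<lambda>d. frechet_derivative h (at ?y) (d *\<^sub>R u))) (at r)" .
    moreover have "frechet_derivative h (at ?y) (d *\<^sub>R u) = Du ?y * d" for d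
      using linear_cmul[OF linear_frechet_derivative[OF dh[OF S[OF that]]]] by (simp add: Du_def)
    ultimately show ?thesis by (simp add: has_field_derivative_def add_ac mult_commute_abs)
  qed
  have DDh: "((\<lambda>q. Du (x + r *\<^sub>R u + q *\<^sub>R v)) has_real_derivative frechet_derivative Du (at (x + r *\<^sub>R u + q *\<^sub>R v)) v) (at q)"
    if "0 \<le> r" "r \<le> t" "0 \<le> q" "q \<le> t" for r q
  proof -
    let ?y = "x + r *\<^sub>R u + q *\<^sub>R v"
    have d: "Du differentiable (at ?y)" using ddh[OF S[OF that]] by (simp add: Du_def[abs_def])
    have "(Du has_derivative frechet_derivative Du (at ?y)) (at (x + r *\<^sub>R u + q *\<^sub>R v))"
      by (rule has_frechet_derivative[OF d])
    from has_derivative_compose[OF line this]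
    have "((\<lambda>q. Du (x + r *\<^sub>R u + q *\<^sub>R v)) has_derivative (\<lambda>e. frechet_derivative Du (at ?y) (e *\<^sub>R v))) (at q)" .
    moreover have "frechet_derivative Du (at ?y) (e *\<^sub>R v) = frechet_derivative Du (at ?y) v * e" for e
      using linear_cmul[OF linear_frechet_derivative[OF d]] by simp
    ultimately show ?thesis by (simp add: has_field_derivative_def mult_commute_abs)
  qed
  define k where "k r = h (x + r *\<^sub>R u + t *\<^sub>R v) - h (x + r *\<^sub>R u + 0 *\<^sub>R v)" for r
  have "(k has_real_derivative Du (x + r *\<^sub>R u + t *\<^sub>R v) - Du (x + r *\<^sub>R u + 0 *\<^sub>R v)) (at r)" if "0 \<le> r" "r \<le> t" for r
    unfolding k_def using that t by (intro DERIV_diff Dh) auto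
  from MVT2[OF t this] obtain r where r: "0 < r" "r < t"
    and k: "k t - k 0 = t * (Du (x + r *\<^sub>R u + t *\<^sub>R v) - Du (x + r *\<^sub>R u + 0 *\<^sub>R v))"
    by auto
  have "((\<lambda>q. Du (x + r *\<^sub>R u + q *\<^sub>R v)) has_real_derivative frechet_derivative Du (at (x + r *\<^sub>R u + q *\<^sub>R v)) v) (at q)"
    if "0 \<le> q" "q \<le> t" for q using that r by (intro DDh) auto
  from MVT2[OF t this] obtain q where q: "0 < q" "q < t"
    and kk: "Du (x + r *\<^sub>R u + t *\<^sub>R v) - Du (x + r *\<^sub>R u + 0 *\<^sub>R v) = t * frechet_derivative Du (at (x + r *\<^sub>R u + q *\<^sub>R v)) v"
    by auto
  have "h (x + t *\<^sub>R u + t *\<^sub>R v) - h (x + t *\<^sub>R u) - h (x + t *\<^sub>R v) + h x = k t - k 0" by (simp add: k_def)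
  then show thesis using that[of r q] r q k kk by (simp add: power2_eq_square Du_def[abs_def])
qed

text \<open>Schwarz's theorem by contradiction: the same second difference equals t^2 times a value
  near x of either mixed derivative, so the two derivatives share a value near x, against continuity
  if they differ at x.\<close>

lemma second_derivative_symmetric:
  fixes h :: "'a::euclidean_space \<Rightarrow> real"
  assumes S: "open S" "x \<in> S" and C: "Ck_on 2 S h"
  shows "frechet_derivative (\<lambda>y. frechet_derivative h (at y) u) (at x) v
    = frechet_derivative (\<lambda>y. frechet_derivative h (at y) v) (at x) u"
proof (rule ccontr)
  let ?A = "\<lambda>u v x. frechet_derivative (\<lambda>y. frechet_derivative h (at y) u) (at x) v"
  assume ne: "?A u v x \<noteq> ?A v u x"
  have two: "2 = Suc (Suc 0)" by simp
  have dh: "y \<in> S \<Longrightarrow> h differentiable (at y)" for y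
    using C S(1) unfolding two Ck_on.simps differentiable_on_def by (metis at_within_open)
  have ddh: "y \<in> S \<Longrightarrow> (\<lambda>y. frechet_derivative h (at y) w) differentiable (at y)" for y w
    using C S(1) unfolding two Ck_on.simps differentiable_on_def by (metis at_within_open)
  have cont: "continuous_on S (?A u v)" for u v
    using C unfolding two Ck_on.simps by blast
  \<comment> \<open>Half the gap, so that no number lies within \<epsilon> of both values at
    x.\<close>
  define \<epsilon> where "\<epsilon> = \<bar>?A u v x - ?A v u x\<bar> / 2"
  have \<epsilon>: "\<epsilon> > 0" using ne by (simp add: \<epsilon>_def)
  obtain d1 where d1: "d1 > 0" "\<And>y. y \<in> S \<Longrightarrow> dist y x < d1 \<Longrightarrow> dist (?A u v y) (?A u v x) < \<epsilon>"
    using cont[of u v] S(2) \<epsilon> unfolding continuous_on_iff by metis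
  obtain d2 where d2: "d2 > 0" "\<And>y. y \<in> S \<Longrightarrow> dist y x < d2 \<Longrightarrow> dist (?A v u y) (?A v u x) < \<epsilon>"
    using cont[of v u] S(2) \<epsilon> unfolding continuous_on_iff by metis
  obtain d3 where d3: "d3 > 0" "ball x d3 \<subseteq> S" using S open_contains_ball by metis
  define d where "d = min d1 (min d2 d3)"
  have d: "d > 0" using d1 d2 d3 by (simp add: d_def)
  \<comment> \<open>This keeps the whole parallelogram within d / 2 of x; the summand 1 keeps the
    denominator positive.\<close>
  define t where "t = d / (2 * (norm u + norm v + 1))"
  have t: "t > 0" using d by (simp add: t_def add_nonneg_pos)
  have near: "dist (x + r *\<^sub>R u + q *\<^sub>R v) x < d" if "0 \<le> r" "r \<le> t" "0 \<le> q" "q \<le> t" for r q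
  proof -
    have "dist (x + r *\<^sub>R u + q *\<^sub>R v) x \<le> r * norm u + q * norm v"
      using norm_triangle_ineq[of "r *\<^sub>R u" "q *\<^sub>R v"] that by (simp add: dist_norm add.assoc)
    also have "\<dots> \<le> t * norm u + t * norm v" using that by (intro add_mono mult_right_mono) auto
    also have "\<dots> \<le> t * (norm u + norm v + 1)" using t by (simp add: distrib_left)
    also have "\<dots> = d / 2"
    proof -
      have "norm u + norm v + 1 > 0" by (simp add: add_nonneg_pos)
      then have nz: "norm u + norm v + 1 \<noteq> 0" by linarith
      have half: "d / (2 * n) * n = d / 2" if "n \<noteq> 0" for n :: real using that by simp
      show ?thesis unfolding t_def by (rule half[OF nz])
    qed
    also have "\<dots> < d" using d by simp
    finally show ?thesis .
  qed
  have nearS: "x + r *\<^sub>R u + q *\<^sub>R v \<in> S" if "0 \<le> r" "r \<le> t" "0 \<le> q" "q \<le> t" for r q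
    using near[OF that] d3(2) by (auto simp: d_def dist_commute)
  obtain r q where rq: "0 \<le> r" "r \<le> t" "0 \<le> q" "q \<le> t"
    and 1: "h (x + t *\<^sub>R u + t *\<^sub>R v) - h (x + t *\<^sub>R u) - h (x + t *\<^sub>R v) + h x = t\<^sup>2 * ?A u v (x + r *\<^sub>R u + q *\<^sub>R v)"
    by (rule mixed_difference[OF t nearS dh ddh[of _ u]])
  have nearS': "x + r *\<^sub>R v + q *\<^sub>R u \<in> S" if "0 \<le> r" "r \<le> t" "0 \<le> q" "q \<le> t" for r q
    using nearS[OF that(3,4,1,2)] by (simp add: add_ac)
  obtain r' q' where rq': "0 \<le> r'" "r' \<le> t" "0 \<le> q'" "q' \<le> t"
    and 2: "h (x + t *\<^sub>R v + t *\<^sub>R u) - h (x + t *\<^sub>R v) - h (x + t *\<^sub>R u) + h x = t\<^sup>2 * ?A v u (x + r' *\<^sub>R v + q' *\<^sub>R u)"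
    by (rule mixed_difference[OF t nearS' dh ddh[of _ v]])
  have "t\<^sup>2 * ?A u v (x + r *\<^sub>R u + q *\<^sub>R v) = t\<^sup>2 * ?A v u (x + q' *\<^sub>R u + r' *\<^sub>R v)"
  proof -
    have e: "x + t *\<^sub>R v + t *\<^sub>R u = x + t *\<^sub>R u + t *\<^sub>R v"
      "x + r' *\<^sub>R v + q' *\<^sub>R u = x + q' *\<^sub>R u + r' *\<^sub>R v" by (simp_all add: add_ac)
    show ?thesis using 1 2[unfolded e] by linarith
  qed
  then have eq: "?A u v (x + r *\<^sub>R u + q *\<^sub>R v) = ?A v u (x + q' *\<^sub>R u + r' *\<^sub>R v)" using t by simp
  have "dist (?A u v (x + r *\<^sub>R u + q *\<^sub>R v)) (?A u v x) < \<epsilon>"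
    by (rule d1(2)[OF nearS[OF rq]]) (use near[OF rq] in \<open>simp add: d_def\<close>)
  moreover have "dist (?A v u (x + q' *\<^sub>R u + r' *\<^sub>R v)) (?A v u x) < \<epsilon>"
    by (rule d2(2)[OF nearS[OF rq'(3,4,1,2)]]) (use near[OF rq'(3,4,1,2)] in \<open>simp add: d_def\<close>)
  moreover have False if "\<bar>p - a\<bar> < \<bar>a - b\<bar> / 2" "\<bar>p - b\<bar> < \<bar>a - b\<bar> / 2" for a b p :: real
    using that abs_triangle_ineq4[of "p - b" "p - a"] by simp
  ultimately show False unfolding eq dist_real_def \<epsilon>_def by blast
qed

section \<open>Symmetries of the curvature tensor\<close>

locale metric_on =
  fixes G :: "vec7 \<Rightarrow> vec7 \<Rightarrow> vec7 \<Rightarrow> real" and S :: "vec7 set"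
  assumes S: "open S"
    and bil: "x \<in> S \<Longrightarrow> bilinear (G x)"
    and sym: "x \<in> S \<Longrightarrow> G x u v = G x v u"
    and pos: "x \<in> S \<Longrightarrow> u \<noteq> 0 \<Longrightarrow> G x u u > 0"
    and smooth: "smooth_on S (\<lambda>x. G x u v)"
begin

lemma C2: "Ck_on 2 S (\<lambda>x. G x u v)"
  using smooth by (simp only: smooth_on_def)

definition D :: "vec7 \<Rightarrow> vec7 \<Rightarrow> vec7 \<Rightarrow> vec7 \<Rightarrow> real" where
  "D x u v w = frechet_derivative (\<lambda>y. G y v w) (at x) u"

lemma differentiable_G: "x \<in> S \<Longrightarrow> (\<lambda>y. G y u v) differentiable (at x)"
  using C2[of u v] S unfolding numeral_2_eq_2 Ck_on.simps differentiable_on_def by (metis at_within_open)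

lemma differentiable_D: "x \<in> S \<Longrightarrow> (\<lambda>y. D y u v w) differentiable (at x)"
  using C2[of v w] S unfolding numeral_2_eq_2 Ck_on.simps differentiable_on_def D_def by (metis at_within_open)

lemma G_derivative: "x \<in> S \<Longrightarrow> ((\<lambda>y. G y v w) has_derivative (\<lambda>u. D x u v w)) (at x)"
  using has_frechet_derivative[OF differentiable_G] by (simp add: D_def)

lemma D_unique: "x \<in> S \<Longrightarrow> ((\<lambda>y. G y v w) has_derivative d) (at x) \<Longrightarrow> D x u v w = d u"
  unfolding D_def by (simp add: frechet_derivative_unique)

lemma G_lin: "x \<in> S \<Longrightarrow> linear (G x u)" "x \<in> S \<Longrightarrow> linear (\<lambda>u. G x u v)"
  using bil by (auto simp: bilinear_def)

lemma G_add: "x \<in> S \<Longrightarrow> G x (u + v) w = G x u w + G x v w" "x \<in> S \<Longrightarrow> G x w (u + v) = G x w u + G x w v"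
  and G_scale: "x \<in> S \<Longrightarrow> G x (r *\<^sub>R u) w = r * G x u w" "x \<in> S \<Longrightarrow> G x w (r *\<^sub>R u) = r * G x w u"
  using linear_add[OF G_lin(1)] linear_add[OF G_lin(2)] linear_cmul[OF G_lin(1)] linear_cmul[OF G_lin(2)] by auto

lemma G_sub: "x \<in> S \<Longrightarrow> G x (u - v) w = G x u w - G x v w"
  using linear_diff[OF G_lin(2)] by auto

lemma D_lin1: "x \<in> S \<Longrightarrow> linear (\<lambda>u. D x u v w)"
  unfolding D_def using linear_frechet_derivative[OF differentiable_G] by simp

lemma D_sym: "x \<in> S \<Longrightarrow> D x u v w = D x u w v"
  unfolding D_def using frechet_derivative_cong_open[OF S, of x "\<lambda>y. G y v w" "\<lambda>y. G y w v"] sym by simp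

lemma D_lin2: "x \<in> S \<Longrightarrow> linear (\<lambda>v. D x u v w)"
proof (rule linearI)
  assume x: "x \<in> S"
  fix v v' r
  have "((\<lambda>y. G y (v + v') w) has_derivative (\<lambda>u. D x u v w + D x u v' w)) (at x)"
    by (rule has_derivative_transform_within_open[OF has_derivative_add[OF G_derivative[OF x] G_derivative[OF x]] S x])
      (simp add: G_add)
  then show "D x u (v + v') w = D x u v w + D x u v' w" by (rule D_unique[OF x])
  have "((\<lambda>y. G y (r *\<^sub>R v) w) has_derivative (\<lambda>u. r * D x u v w)) (at x)"
    by (rule has_derivative_transform_within_open[OF has_derivative_mult_right[OF G_derivative[OF x]] S x])
      (simp add: G_scale)
  then show "D x u (r *\<^sub>R v) w = r *\<^sub>R D x u v w" by (simp add: D_unique[OF x])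
qed

lemma D_lin3: "x \<in> S \<Longrightarrow> linear (\<lambda>w. D x u v w)"
  using D_lin2[of x u v] by (simp add: D_sym[of x u v])

text \<open>Koszul's formula for fields that are constant in the chart, that is, the Christoffel
  symbols of the first kind.\<close>

definition K :: "vec7 \<Rightarrow> vec7 \<Rightarrow> vec7 \<Rightarrow> vec7 \<Rightarrow> real" where
  "K x u v w = (D x u v w + D x v u w - D x w u v) / 2"

definition gram :: "vec7 \<Rightarrow> real^7^7" where
  "gram x = (\<chi> i j. G x (axis i 1) (axis j 1))"

text \<open>Cramer's rule for the linear system with matrix \<open>gram x\<close> that raises the
  index of \<open>K\<close>. In contrast to the definite description in \<open>christoffel\<close>,
  the formula shows how the symbols depend on the point, so they can be differentiated.\<close>

definition \<Gamma> :: "vec7 \<Rightarrow> vec7 \<Rightarrow> vec7 \<Rightarrow> vec7" where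
  "\<Gamma> x u v = (\<chi> k. det (\<chi> i j. if j = k then K x u v (axis i 1) else gram x $ i $ j) / det (gram x))"

lemma vec_axis: "(w :: vec7) = (\<Sum>i\<in>UNIV. w $ i *\<^sub>R axis i 1)"
  using basis_expansion[of w] by (simp add: scalar_mult_eq_scaleR)

lemma linear_axis:
  assumes "linear (l :: vec7 \<Rightarrow> real)"
  shows "l w = (\<Sum>i\<in>UNIV. w $ i * l (axis i 1))"
proof -
  have "l w = l (\<Sum>i\<in>UNIV. w $ i *\<^sub>R axis i 1)" by (rule arg_cong[OF vec_axis])
  then show ?thesis by (simp add: linear_sum[OF assms] linear_cmul[OF assms])
qed

lemma gram_mult:
  assumes x: "x \<in> S"
  shows "(gram x *v p) $ i = G x (axis i 1) p"
  using linear_axis[OF G_lin(1)[OF x], of "axis i 1" p] by (simp add: gram_def matrix_vector_mult_def mult.commute)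

lemma det_gram:
  assumes x: "x \<in> S"
  shows "det (gram x) \<noteq> 0"
proof -
  have "p = 0" if "gram x *v p = 0" for p
  proof -
    have "G x (axis i 1) p = 0" for i using gram_mult[OF x, of p i] that by simp
    then have "G x p p = 0" using linear_axis[OF G_lin(2)[OF x], of p p] by simp
    then show ?thesis using pos[OF x, of p] by fastforce
  qed
  then show ?thesis by (metis invertible_det_nz invertible_left_inverse matrix_left_invertible_ker)
qed

lemma K_lin:
  assumes x: "x \<in> S"
  shows "linear (\<lambda>u. K x u v w)" "linear (\<lambda>w. K x u v w)" "K x u v w = K x v u w"
proof -
  note l = D_lin1[OF x] D_lin2[OF x] D_lin3[OF x]
  show "linear (\<lambda>u. K x u v w)" unfolding K_def
    by (rule linearI) (simp_all add: linear_add[OF l(1)] linear_add[OF l(2)] linear_cmul[OF l(1)] linear_cmul[OF l(2)] linear_add[OF l(3)] linear_cmul[OF l(3)] field_simps)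
  show "linear (\<lambda>w. K x u v w)" unfolding K_def
    by (rule linearI) (simp_all add: linear_add[OF l(1)] linear_add[OF l(2)] linear_cmul[OF l(1)] linear_cmul[OF l(2)] linear_add[OF l(3)] linear_cmul[OF l(3)] field_simps)
  show "K x u v w = K x v u w" unfolding K_def using D_sym[OF x, of w u v] by simp
qed

lemma G_\<Gamma>:
  assumes x: "x \<in> S"
  shows "G x (\<Gamma> x u v) w = K x u v w"
proof -
  have "gram x *v \<Gamma> x u v = (\<chi> i. K x u v (axis i 1))"
    by (rule iffD2[OF cramer[OF det_gram[OF x]]]) (simp only: \<Gamma>_def vec_lambda_beta)
  then have "G x (axis i 1) (\<Gamma> x u v) = K x u v (axis i 1)" for i
    using gram_mult[OF x, of "\<Gamma> x u v" i] by simp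
  then have "G x w (\<Gamma> x u v) = K x u v w"
    using linear_axis[OF G_lin(2)[OF x], of w "\<Gamma> x u v"] linear_axis[OF K_lin(2)[OF x], of u v w] by simp
  then show ?thesis using sym[OF x] by metis
qed

lemma G_nondegenerate:
  assumes x: "x \<in> S" and eq: "\<And>w. G x a w = G x b w"
  shows "a = b"
proof -
  have "G x (a - b) (a - b) = 0" using eq by (simp add: G_sub[OF x])
  then show ?thesis using pos[OF x, of "a - b"] by fastforce
qed

lemma \<Gamma>_sym: "x \<in> S \<Longrightarrow> \<Gamma> x u v = \<Gamma> x v u"
  by (rule G_nondegenerate, assumption, simp only: G_\<Gamma>, rule K_lin(3))

lemma \<Gamma>_lin: assumes x: "x \<in> S" shows "linear (\<lambda>u. \<Gamma> x u v)"
proof (rule linearI)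
  show "\<Gamma> x (u + u') v = \<Gamma> x u v + \<Gamma> x u' v" for u u'
    by (rule G_nondegenerate[OF x]) (simp add: G_\<Gamma>[OF x] G_add[OF x] linear_add[OF K_lin(1)[OF x]])
  show "\<Gamma> x (r *\<^sub>R u) v = r *\<^sub>R \<Gamma> x u v" for r u
    by (rule G_nondegenerate[OF x]) (simp add: G_\<Gamma>[OF x] G_scale[OF x] linear_cmul[OF K_lin(1)[OF x]])
qed

lemma \<Gamma>_compat:
  assumes x: "x \<in> S"
  shows "D x u v w = G x (\<Gamma> x u v) w + G x v (\<Gamma> x u w)"
  unfolding sym[OF x, of v "\<Gamma> x u w"] G_\<Gamma>[OF x] K_def D_sym[OF x, of u w v] by (simp add: field_simps)

text \<open>Uniqueness is Koszul's computation: in the combination of the compatibility conditions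
  for (u,v,w), (v,u,w) and (w,u,v), symmetry of the candidate cancels every term except the one with
  \<open>C u v\<close>.\<close>

lemma christoffel_eq:
  assumes x: "x \<in> S"
  shows "christoffel G x = \<Gamma> x"
  unfolding christoffel_def
proof (rule the_equality)
  have "linear (\<lambda>v. \<Gamma> x u v)" for u using \<Gamma>_lin[OF x, of u] by (simp add: \<Gamma>_sym[OF x, of u])
  then have "bilinear (\<Gamma> x)" using \<Gamma>_lin[OF x] by (simp add: bilinear_def)
  then show "bilinear (\<Gamma> x) \<and> (\<forall>u v. \<Gamma> x u v = \<Gamma> x v u) \<and>
      (\<forall>u v w. frechet_derivative (\<lambda>y. G y v w) (at x) u = G x (\<Gamma> x u v) w + G x v (\<Gamma> x u w))"
    using \<Gamma>_sym[OF x] \<Gamma>_compat[OF x] by (auto simp: D_def)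
next
  fix C
  assume "bilinear C \<and> (\<forall>u v. C u v = C v u) \<and>
      (\<forall>u v w. frechet_derivative (\<lambda>y. G y v w) (at x) u = G x (C u v) w + G x v (C u w))"
  then have C: "\<And>u v. C u v = C v u" "\<And>u v w. D x u v w = G x (C u v) w + G x v (C u w)"
    by (auto simp: D_def)
  show "C = \<Gamma> x"
  proof (intro ext G_nondegenerate[OF x])
    show "G x (C u v) w = G x (\<Gamma> x u v) w" for u v w
      unfolding G_\<Gamma>[OF x] K_def C(2)[of u v w] C(2)[of v u w] C(2)[of w u v]
        C(1)[of v u] C(1)[of w u] C(1)[of w v] sym[OF x, of v "C u w"] sym[OF x, of u "C v w"]
      by simp
  qed
qed

lemma differentiable_\<Gamma>:
  assumes x: "x \<in> S"
  shows "(\<lambda>y. \<Gamma> y u v) differentiable (at x)"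
proof -
  have K: "(\<lambda>y. K y u v w) differentiable (at x)" for w
    unfolding K_def by (intro derivative_intros differentiable_D[OF x]) auto
  have g: "(\<lambda>y. gram y $ i $ j) differentiable (at x)" for i j
    unfolding gram_def by (simp add: differentiable_G[OF x])
  show ?thesis unfolding \<Gamma>_def
  proof (rule differentiable_vec_lambda)
    fix k
    have "(\<lambda>y. det (\<chi> i j. if j = k then K y u v (axis i 1) else gram y $ i $ j)) differentiable (at x)"
    proof (rule differentiable_det)
      show "(\<lambda>y. (\<chi> i j. if j = k then K y u v (axis i 1) else gram y $ i $ j) $ i $ j) differentiable (at x)" for i j
        by (cases "j = k") (simp_all add: K g)
    qed
    moreover have "(\<lambda>y. det (gram y)) differentiable (at x)"
      by (rule differentiable_det) (rule g)
    ultimately show "(\<lambda>y. det (\<chi> i j. if j = k then K y u v (axis i 1) else gram y $ i $ j) / det (gram y)) differentiable (at x)"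
      using det_gram[OF x] by (intro differentiable_divide)
  qed
qed

definition d\<Gamma> :: "vec7 \<Rightarrow> vec7 \<Rightarrow> vec7 \<Rightarrow> vec7 \<Rightarrow> vec7" where
  "d\<Gamma> x u v w = frechet_derivative (\<lambda>y. \<Gamma> y v w) (at x) u"

text \<open>The extensions are constant in the chart, so their bracket vanishes and only derivatives
  of \<Gamma> and products of two \<Gamma> remain.\<close>

lemma riemann_eq:
  assumes x: "x \<in> S"
  shows "riemann_tensor G x u v w z = G x (d\<Gamma> x u v w - d\<Gamma> x v u w + \<Gamma> x u (\<Gamma> x v w) - \<Gamma> x v (\<Gamma> x u w)) z"
proof -
  have n1: "nabla G (\<lambda>_. v) (\<lambda>_. w) y = \<Gamma> y v w" if "y \<in> S" for v w y
    using that by (simp add: nabla_def christoffel_eq frechet_derivative_const)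
  have n2: "nabla G (\<lambda>_. u) (nabla G (\<lambda>_. v) (\<lambda>_. w)) x = d\<Gamma> x u v w + \<Gamma> x u (\<Gamma> x v w)" for u v w
    unfolding nabla_def[of G "\<lambda>_. u" "nabla G (\<lambda>_. v) (\<lambda>_. w)"] n1[OF x] christoffel_eq[OF x] d\<Gamma>_def
    using frechet_derivative_cong_open[OF S x, of "nabla G (\<lambda>_. v) (\<lambda>_. w)" "\<lambda>y. \<Gamma> y v w"] n1 by simp
  have "\<Gamma> x 0 w = 0" using linear_0[OF \<Gamma>_lin[OF x]] by simp
  then have n3: "nabla G (lie_bracket (\<lambda>_. u) (\<lambda>_. v)) (\<lambda>_. w) x = 0"
    by (simp add: nabla_def lie_bracket_def christoffel_eq[OF x] frechet_derivative_const)
  show ?thesis unfolding riemann_tensor_def curvature_field_def n2 n3 by (simp add: algebra_simps)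
qed

lemma riemann_antisym12:
  assumes x: "x \<in> S"
  shows "riemann_tensor G x v u w z = - riemann_tensor G x u v w z"
proof -
  have "- G x a z = G x (- a) z" for a using linear_neg[OF G_lin(2)[OF x], of a] by simp
  then show ?thesis unfolding riemann_eq[OF x] by (simp add: algebra_simps)
qed

lemma d\<Gamma>_sym: "x \<in> S \<Longrightarrow> d\<Gamma> x u v w = d\<Gamma> x u w v"
  unfolding d\<Gamma>_def using frechet_derivative_cong_open[OF S, of x "\<lambda>y. \<Gamma> y v w" "\<lambda>y. \<Gamma> y w v"] \<Gamma>_sym by simp

text \<open>Torsion-freeness: by the symmetry of \<Gamma> and of its derivative, all terms of the
  cyclic sum cancel in pairs.\<close>

lemma riemann_bianchi:
  assumes x: "x \<in> S"
  shows "riemann_tensor G x u v w z + riemann_tensor G x v w u z + riemann_tensor G x w u v z = 0"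
  unfolding riemann_eq[OF x] G_add(1)[OF x, symmetric] d\<Gamma>_sym[OF x, of u w v] d\<Gamma>_sym[OF x, of v w u] d\<Gamma>_sym[OF x, of w v u]
    \<Gamma>_sym[OF x, of v w] \<Gamma>_sym[OF x, of u w] \<Gamma>_sym[OF x, of v u]
  using linear_0[OF G_lin(2)[OF x]] by simp

text \<open>A product rule for the metric applied to a variable field and a constant one. Expanding
  the field in the fixed basis separates its dependence on the point from that of the
  metric.\<close>

lemma derivative_G_field:
  assumes x: "x \<in> S" and a: "(a has_derivative a') (at x)"
  shows "((\<lambda>y. G y (a y) z) has_derivative (\<lambda>u. G x (a' u) z + D x u (a x) z)) (at x)"
proof -
  have "((\<lambda>y. \<Sum>i\<in>UNIV. a y $ i * G y (axis i 1) z) has_derivative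
      (\<lambda>u. \<Sum>i\<in>UNIV. a x $ i * D x u (axis i 1) z + a' u $ i * G x (axis i 1) z)) (at x)"
    by (intro has_derivative_sum has_derivative_mult has_derivative_vec_nth a G_derivative x)
  moreover have "(\<Sum>i\<in>UNIV. a x $ i * D x u (axis i 1) z + a' u $ i * G x (axis i 1) z) = G x (a' u) z + D x u (a x) z" for u
    using linear_axis[OF G_lin(2)[OF x], of "a' u" z] linear_axis[OF D_lin2[OF x], of u "a x" z] by (simp add: sum.distrib)
  ultimately have "((\<lambda>y. \<Sum>i\<in>UNIV. a y $ i * G y (axis i 1) z) has_derivative (\<lambda>u. G x (a' u) z + D x u (a x) z)) (at x)" by simp
  then show ?thesis
    by (rule has_derivative_transform_within_open[OF _ S x]) (use linear_axis[OF G_lin(2)] in metis)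
qed

lemma second_derivative_G:
  assumes x: "x \<in> S"
  shows "frechet_derivative (\<lambda>y. D y v w z) (at x) u =
    G x (d\<Gamma> x u v w) z + D x u (\<Gamma> x v w) z + (G x (d\<Gamma> x u v z) w + D x u (\<Gamma> x v z) w)"
proof -
  have "((\<lambda>y. \<Gamma> y v w) has_derivative (\<lambda>u. d\<Gamma> x u v w)) (at x)" for v w
    using has_frechet_derivative[OF differentiable_\<Gamma>[OF x]] by (simp add: d\<Gamma>_def)
  note d = derivative_G_field[OF x this]
  have "((\<lambda>y. G y (\<Gamma> y v w) z + G y (\<Gamma> y v z) w) has_derivative
     (\<lambda>u. G x (d\<Gamma> x u v w) z + D x u (\<Gamma> x v w) z + (G x (d\<Gamma> x u v z) w + D x u (\<Gamma> x v z) w))) (at x)"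
    by (rule has_derivative_add[OF d d])
  then have "((\<lambda>y. D y v w z) has_derivative
     (\<lambda>u. G x (d\<Gamma> x u v w) z + D x u (\<Gamma> x v w) z + (G x (d\<Gamma> x u v z) w + D x u (\<Gamma> x v z) w))) (at x)"
    by (rule has_derivative_transform_within_open[OF _ S x]) (use \<Gamma>_compat sym in metis)
  then show ?thesis by (simp add: frechet_derivative_unique)
qed

text \<open>Metric compatibility is differentiated once more and antisymmetrised in u and v. The
  second derivatives of the metric coefficients cancel because they commute; what is left is the sum
  of the two curvature components.\<close>

lemma riemann_antisym34:
  assumes x: "x \<in> S"
  shows "riemann_tensor G x u v z w = - riemann_tensor G x u v w z"
proof -
  have G2: "G x (a - b + c - d) z = G x a z - G x b z + G x c z - G x d z" for a b c d z
    by (simp add: G_add[OF x] G_sub[OF x])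
  have "frechet_derivative (\<lambda>y. D y v w z) (at x) u = frechet_derivative (\<lambda>y. D y u w z) (at x) v"
    unfolding D_def by (rule second_derivative_symmetric[OF S x C2])
  then show ?thesis
    unfolding second_derivative_G[OF x] riemann_eq[OF x] G2 \<Gamma>_compat[OF x] sym[OF x, of "\<Gamma> x u w" "\<Gamma> x v z"]
      sym[OF x, of "\<Gamma> x u z" "\<Gamma> x v w"]
    by linarith
qed

end

text \<open>The classical octahedron argument: four instances of the Bianchi identity, one for each
  choice of the last index, combine with the antisymmetries so that only the two stated components
  survive.\<close>

lemma curvature_pair_symmetric:
  fixes R :: "'i \<Rightarrow> 'i \<Rightarrow> 'i \<Rightarrow> 'i \<Rightarrow> real"
  assumes "\<And>i j k l. R j i k l = - R i j k l" "\<And>i j k l. R i j l k = - R i j k l"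
    and "\<And>i j k l. R i j k l + R j k i l + R k i j l = 0"
  shows "R k l i j = R i j k l"
  using assms(3)[of i j k l] assms(3)[of j k l i] assms(3)[of k l i j] assms(3)[of l i j k]
    assms(2)[of j k i l] assms(1)[of k i l j] assms(2)[of k i j l] assms(2)[of k l i j]
    assms(1)[of l j i k] assms(2)[of l j k i] assms(2)[of l i k j] assms(2)[of i j k l]
  by linarith

lemma riem_comp_curvature:
  assumes G2: "G2_structure X A \<phi> g \<nu>" and fr: "(c, p, e) \<in> frames A g S"
  defines "R \<equiv> riem_comp g (c, p, e)"
  shows "R \<in> curv_sym" and "R $ i $ j $ k $ l + R $ j $ k $ i $ l + R $ k $ i $ j $ l = 0"
proof -
  define x where "x = chart_map c p"
  have c: "c \<in> A" and x: "x \<in> chart_image c"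
    using fr by (auto simp: frames_def chart_image_def x_def)
  have "open (chart_image c)" using G2 c unfolding G2_structure_def smooth_manifold7_def is_chart_def by blast
  moreover have "riemannian_metric A g" using G2 by (simp add: G2_structure_def)
  ultimately interpret metric_on "g c" "chart_image c"
    using c unfolding riemannian_metric_def by unfold_locales blast+
  let ?r = "riemann_tensor (g c) x"
  have R: "R $ i $ j $ k $ l = ?r (e i) (e j) (e k) (e l)" for i j k l
    by (simp add: R_def riem_comp_def x_def)
  have pair: "?r w z u v = ?r u v w z" for u v w z
    by (rule curvature_pair_symmetric[of ?r]) (rule riemann_antisym12[OF x] riemann_antisym34[OF x] riemann_bianchi[OF x])+
  show "R \<in> curv_sym"
    unfolding curv_sym_def mem_Collect_eq R
  proof (intro allI conjI)
    fix i j k l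
    show "?r (e i) (e j) (e k) (e l) = - ?r (e j) (e i) (e k) (e l)" by (rule riemann_antisym12[OF x])
    show "?r (e i) (e j) (e k) (e l) = - ?r (e i) (e j) (e l) (e k)" by (rule riemann_antisym34[OF x])
    show "?r (e i) (e j) (e k) (e l) = ?r (e k) (e l) (e i) (e j)" by (rule pair)
  qed
  show "R $ i $ j $ k $ l + R $ j $ k $ i $ l + R $ k $ i $ j $ l = 0"
    unfolding R by (rule riemann_bianchi[OF x])
qed

section \<open>Wedge products in components\<close>

lemma exhaust_7:
  fixes x :: 7
  shows "x = 1 \<or> x = 2 \<or> x = 3 \<or> x = 4 \<or> x = 5 \<or> x = 6 \<or> x = 7"
proof (induct x)
  case (of_int z)
  \<comment> \<open>In this type 7 = 0, so the residue 0 is the index written 7.\<close>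
  then have "z = 0 \<or> z = 1 \<or> z = 2 \<or> z = 3 \<or> z = 4 \<or> z = 5 \<or> z = 6" by fastforce
  then show ?case by auto
qed

lemma UNIV_7: "UNIV = {1, 2, 3, 4, 5, 6, 7::7}"
  using exhaust_7 by auto

lemma sum_7: "sum f (UNIV::7 set) = f 1 + f 2 + f 3 + f 4 + f 5 + f 6 + f 7"
  unfolding UNIV_7 by (simp add: ac_simps)

text \<open>A signed sum over the rearrangements of a list. With lists the first entry can be split
  off, so that a sum over the 5040 permutations of seven indices unfolds one position at a
  time.\<close>

definition perm_sum :: "'a list \<Rightarrow> ('a list \<Rightarrow> real) \<Rightarrow> real" where
  "perm_sum xs F = (\<Sum>\<sigma> | \<sigma> permutes set xs. of_int (sign \<sigma>) * F (map \<sigma> xs))"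

lemma perm_sum_Nil: "perm_sum [] F = F []"
  by (simp add: perm_sum_def)

text \<open>The permutations that send x to b are a transposition composed with a permutation fixing
  x. Conjugation by the transposition turns the latter into permutations of the list with b replaced
  by x, and the transposition left over gives the minus sign.\<close>

lemma perm_sum_transpose:
  assumes "x \<notin> set r" "b \<in> set r"
  shows "(\<Sum>q | q permutes set r. of_int (sign (Transposition.transpose x b \<circ> q)) * F (map (Transposition.transpose x b \<circ> q) (x # r)))
    = - perm_sum (map (Transposition.transpose x b) r) (\<lambda>ys. F (b # ys))"
proof -
  let ?t = "Transposition.transpose x b"
  have bx: "b \<noteq> x" using assms by auto
  have tt: "?t \<circ> (?t \<circ> q \<circ> ?t) \<circ> ?t = q" for q :: "'a \<Rightarrow> 'a"
    by (simp add: fun_eq_iff)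
  have perm: "(?t \<circ> q \<circ> ?t) permutes (?t ` S)" if q: "q permutes S" for q S
  proof -
    have "bij (?t \<circ> q \<circ> ?t)" using permutes_bij[OF q] by (simp add: bij_comp)
    moreover have "(?t \<circ> q \<circ> ?t) y = y" if "y \<notin> ?t ` S" for y
    proof -
      have "?t y \<notin> S" using that by (metis imageI transpose_involutory)
      then show ?thesis using q by (simp add: permutes_not_in)
    qed
    ultimately show ?thesis unfolding permutes_def bij_iff by blast
  qed
  have im: "?t ` (?t ` set r) = set r" by (simp add: image_image)
  have "(\<Sum>q | q permutes set r. of_int (sign (?t \<circ> q)) * F (map (?t \<circ> q) (x # r)))
    = (\<Sum>q | q permutes ?t ` set r. - (of_int (sign q) * F (b # map q (map ?t r))))"
  proof (rule sum.reindex_bij_witness[where i = "\<lambda>q. ?t \<circ> q \<circ> ?t" and j = "\<lambda>q. ?t \<circ> q \<circ> ?t"])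
    fix q assume q: "q \<in> {q. q permutes set r}"
    then have fin: "permutation q" using permutes_imp_permutation finite_set by blast
    have pt: "permutation ?t" by (rule permutation_swap_id)
    have qx: "q x = x" using q assms(1) by (auto simp: permutes_not_in)
    have s: "sign (?t \<circ> q \<circ> ?t) = sign q"
      using bx by (simp add: sign_compose[OF permutation_compose[OF pt fin] pt] sign_compose[OF pt fin] sign_swap_id)
    have "sign (?t \<circ> q) = - sign q"
      using bx by (simp add: sign_compose[OF pt fin] sign_swap_id)
    then show "- (of_int (sign (?t \<circ> q \<circ> ?t)) * F (b # map (?t \<circ> q \<circ> ?t) (map ?t r)))
       = of_int (sign (?t \<circ> q)) * F (map (?t \<circ> q) (x # r))"
      unfolding s by (simp add: qx comp_def)
  next
    fix q assume "q \<in> {q. q permutes set r}"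
    then show "?t \<circ> q \<circ> ?t \<in> {q. q permutes ?t ` set r}" using perm by simp
  next
    fix q assume "q \<in> {q. q permutes ?t ` set r}"
    then show "?t \<circ> q \<circ> ?t \<in> {q. q permutes set r}" using perm[of q "?t ` set r"] im by simp
  qed (use tt in simp_all)
  also have "\<dots> = - perm_sum (map ?t r) (\<lambda>ys. F (b # ys))"
    by (simp add: perm_sum_def sum_negf)
  finally show ?thesis .
qed

text \<open>The summands are grouped by the image of x, as in a Laplace expansion along the first
  row.\<close>

lemma perm_sum_Cons:
  assumes "distinct (x # r)"
  shows "perm_sum (x # r) F = perm_sum r (\<lambda>ys. F (x # ys))
     - (\<Sum>b\<leftarrow>r. perm_sum (map (Transposition.transpose x b) r) (\<lambda>ys. F (b # ys)))"
proof -
  have x: "x \<notin> set r" and d: "distinct r" using assms by auto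
  have "perm_sum (x # r) F = (\<Sum>b\<in>insert x (set r). \<Sum>q | q permutes set r.
      of_int (sign (Transposition.transpose x b \<circ> q)) * F (map (Transposition.transpose x b \<circ> q) (x # r)))"
    unfolding perm_sum_def unfolding list.set(2) by (rule sum_over_permutations_insert[OF finite_set x])
  also have "\<dots> = (\<Sum>q | q permutes set r. of_int (sign q) * F (map q (x # r)))
     + (\<Sum>b\<in>set r. - perm_sum (map (Transposition.transpose x b) r) (\<lambda>ys. F (b # ys)))"
    using x perm_sum_transpose[OF x] by simp
  also have "(\<Sum>q | q permutes set r. of_int (sign q) * F (map q (x # r))) = perm_sum r (\<lambda>ys. F (x # ys))"
    unfolding perm_sum_def by (rule sum.cong) (use x in \<open>auto simp: permutes_not_in\<close>)
  finally show ?thesis using d by (simp add: sum_negf sum_list_distinct_conv_sum_set)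
qed

text \<open>The six (2,2)-shuffles of \<alpha> \<and> \<beta>. For alternating arguments the sum
  over all 24 permutations counts each of them 2! 2! = 4 times.\<close>

definition wedge22 :: "('i \<Rightarrow> 'i \<Rightarrow> real) \<Rightarrow> ('i \<Rightarrow> 'i \<Rightarrow> real) \<Rightarrow> 'i \<Rightarrow> 'i \<Rightarrow> 'i \<Rightarrow> 'i \<Rightarrow> real" where
  "wedge22 \<alpha> \<beta> i j k l = \<alpha> i j * \<beta> k l - \<alpha> i k * \<beta> j l + \<alpha> i l * \<beta> j k
     + \<alpha> j k * \<beta> i l - \<alpha> j l * \<beta> i k + \<alpha> k l * \<beta> i j"

lemma perm_sum_two:
  assumes "a \<noteq> b"
  shows "perm_sum [a, b] F = F [a, b] - F [b, a]"
  using assms by (simp add: perm_sum_Cons perm_sum_Nil)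

lemma perm_sum_3:
  assumes "a \<noteq> b" "a \<noteq> c" "b \<noteq> c"
  shows "perm_sum [a, b, c] F = F [a, b, c] - F [a, c, b] - F [b, a, c] + F [b, c, a] - F [c, b, a] + F [c, a, b]"
proof -
  have "Transposition.transpose a b c = c" "Transposition.transpose a c b = b"
    using assms by (auto simp: Transposition.transpose_def)
  then show ?thesis using assms
    by (simp add: perm_sum_Cons[of a] perm_sum_two)
qed

lemma perm_sum_4:
  assumes "a \<noteq> b" "a \<noteq> c" "a \<noteq> d" "b \<noteq> c" "b \<noteq> d" "c \<noteq> d"
  shows "perm_sum [a, b, c, d] F = perm_sum [b, c, d] (\<lambda>ys. F (a # ys)) - perm_sum [a, c, d] (\<lambda>ys. F (b # ys))
     - perm_sum [b, a, d] (\<lambda>ys. F (c # ys)) - perm_sum [b, c, a] (\<lambda>ys. F (d # ys))"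
proof -
  have "Transposition.transpose a b c = c" "Transposition.transpose a c b = b"
      "Transposition.transpose a b d = d" "Transposition.transpose a c d = d"
      "Transposition.transpose a d b = b" "Transposition.transpose a d c = c"
    using assms by (auto simp: Transposition.transpose_def)
  then show ?thesis using assms
    by (simp add: perm_sum_Cons[of a])
qed

lemma perm_sum_wedge22:
  assumes "distinct [a,b,c,d]" and al: "\<And>i j. \<alpha> j i = - \<alpha> i j" and be: "\<And>i j. \<beta> j i = - \<beta> i j"
  shows "perm_sum [a,b,c,d] (\<lambda>l. \<alpha> (l!0) (l!1) * \<beta> (l!2) (l!3) * C) = 4 * wedge22 \<alpha> \<beta> a b c d * C"
proof -
  have ne: "a \<noteq> b" "a \<noteq> c" "a \<noteq> d" "b \<noteq> c" "b \<noteq> d" "c \<noteq> d"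
    "b \<noteq> a" "c \<noteq> a" "d \<noteq> a" "c \<noteq> b" "d \<noteq> b" "d \<noteq> c"
    using assms(1) by auto
  have al': "\<alpha> b a = - \<alpha> a b" "\<alpha> c a = - \<alpha> a c" "\<alpha> d a = - \<alpha> a d" "\<alpha> c b = - \<alpha> b c" "\<alpha> d b = - \<alpha> b d" "\<alpha> d c = - \<alpha> c d"
    by (rule al)+
  have be': "\<beta> b a = - \<beta> a b" "\<beta> c a = - \<beta> a c" "\<beta> d a = - \<beta> a d" "\<beta> c b = - \<beta> b c" "\<beta> d b = - \<beta> b d" "\<beta> d c = - \<beta> c d"
    by (rule be)+
  show ?thesis
    by (simp add: perm_sum_4 perm_sum_3 ne al' be' wedge22_def numeral_3_eq_3) (simp add: algebra_simps)
qed

text \<open>The coefficient of \<alpha> \<and> \<beta> \<and> \<gamma> on the seven basis vectors,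
  expanded over the 35 triples of indices that can go to \<gamma>.\<close>

definition wedge_comp :: "(7 \<Rightarrow> 7 \<Rightarrow> real) \<Rightarrow> (7 \<Rightarrow> 7 \<Rightarrow> real) \<Rightarrow> (7 \<Rightarrow> 7 \<Rightarrow> 7 \<Rightarrow> real) \<Rightarrow> real" where
  "wedge_comp \<alpha> \<beta> \<gamma> = \<gamma> 1 2 3 * wedge22 \<alpha> \<beta> 4 5 6 7 - \<gamma> 1 2 4 * wedge22 \<alpha> \<beta> 3 5 6 7 + \<gamma> 1 2 5 * wedge22 \<alpha> \<beta> 3 4 6 7
     - \<gamma> 1 2 6 * wedge22 \<alpha> \<beta> 3 4 5 7 + \<gamma> 1 2 7 * wedge22 \<alpha> \<beta> 3 4 5 6 + \<gamma> 1 3 4 * wedge22 \<alpha> \<beta> 2 5 6 7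
     - \<gamma> 1 3 5 * wedge22 \<alpha> \<beta> 2 4 6 7 + \<gamma> 1 3 6 * wedge22 \<alpha> \<beta> 2 4 5 7 - \<gamma> 1 3 7 * wedge22 \<alpha> \<beta> 2 4 5 6
     + \<gamma> 1 4 5 * wedge22 \<alpha> \<beta> 2 3 6 7 - \<gamma> 1 4 6 * wedge22 \<alpha> \<beta> 2 3 5 7 + \<gamma> 1 4 7 * wedge22 \<alpha> \<beta> 2 3 5 6
     + \<gamma> 1 5 6 * wedge22 \<alpha> \<beta> 2 3 4 7 - \<gamma> 1 5 7 * wedge22 \<alpha> \<beta> 2 3 4 6 + \<gamma> 1 6 7 * wedge22 \<alpha> \<beta> 2 3 4 5
     - \<gamma> 2 3 4 * wedge22 \<alpha> \<beta> 1 5 6 7 + \<gamma> 2 3 5 * wedge22 \<alpha> \<beta> 1 4 6 7 - \<gamma> 2 3 6 * wedge22 \<alpha> \<beta> 1 4 5 7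
     + \<gamma> 2 3 7 * wedge22 \<alpha> \<beta> 1 4 5 6 - \<gamma> 2 4 5 * wedge22 \<alpha> \<beta> 1 3 6 7 + \<gamma> 2 4 6 * wedge22 \<alpha> \<beta> 1 3 5 7
     - \<gamma> 2 4 7 * wedge22 \<alpha> \<beta> 1 3 5 6 - \<gamma> 2 5 6 * wedge22 \<alpha> \<beta> 1 3 4 7 + \<gamma> 2 5 7 * wedge22 \<alpha> \<beta> 1 3 4 6
     - \<gamma> 2 6 7 * wedge22 \<alpha> \<beta> 1 3 4 5 + \<gamma> 3 4 5 * wedge22 \<alpha> \<beta> 1 2 6 7 - \<gamma> 3 4 6 * wedge22 \<alpha> \<beta> 1 2 5 7
     + \<gamma> 3 4 7 * wedge22 \<alpha> \<beta> 1 2 5 6 + \<gamma> 3 5 6 * wedge22 \<alpha> \<beta> 1 2 4 7 - \<gamma> 3 5 7 * wedge22 \<alpha> \<beta> 1 2 4 6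
     + \<gamma> 3 6 7 * wedge22 \<alpha> \<beta> 1 2 4 5 - \<gamma> 4 5 6 * wedge22 \<alpha> \<beta> 1 2 3 7 + \<gamma> 4 5 7 * wedge22 \<alpha> \<beta> 1 2 3 6
     - \<gamma> 4 6 7 * wedge22 \<alpha> \<beta> 1 2 3 5 + \<gamma> 5 6 7 * wedge22 \<alpha> \<beta> 1 2 3 4"

text \<open>One rule for each of the 23 nontrivial permutations; as rewrite rules they sort the
  indices.\<close>

lemma wedge22_permute:
  assumes al: "\<And>i j. \<alpha> j i = - \<alpha> i j" and be: "\<And>i j. \<beta> j i = - \<beta> i j"
  shows "wedge22 \<alpha> \<beta> a b d c = - wedge22 \<alpha> \<beta> a b c d" "wedge22 \<alpha> \<beta> a c b d = - wedge22 \<alpha> \<beta> a b c d"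
    "wedge22 \<alpha> \<beta> a c d b = wedge22 \<alpha> \<beta> a b c d" "wedge22 \<alpha> \<beta> a d b c = wedge22 \<alpha> \<beta> a b c d"
    "wedge22 \<alpha> \<beta> a d c b = - wedge22 \<alpha> \<beta> a b c d" "wedge22 \<alpha> \<beta> b a c d = - wedge22 \<alpha> \<beta> a b c d"
    "wedge22 \<alpha> \<beta> b a d c = wedge22 \<alpha> \<beta> a b c d" "wedge22 \<alpha> \<beta> b c a d = wedge22 \<alpha> \<beta> a b c d"
    "wedge22 \<alpha> \<beta> b c d a = - wedge22 \<alpha> \<beta> a b c d" "wedge22 \<alpha> \<beta> b d a c = - wedge22 \<alpha> \<beta> a b c d"
    "wedge22 \<alpha> \<beta> b d c a = wedge22 \<alpha> \<beta> a b c d" "wedge22 \<alpha> \<beta> c a b d = wedge22 \<alpha> \<beta> a b c d"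
    "wedge22 \<alpha> \<beta> c a d b = - wedge22 \<alpha> \<beta> a b c d" "wedge22 \<alpha> \<beta> c b a d = - wedge22 \<alpha> \<beta> a b c d"
    "wedge22 \<alpha> \<beta> c b d a = wedge22 \<alpha> \<beta> a b c d" "wedge22 \<alpha> \<beta> c d a b = wedge22 \<alpha> \<beta> a b c d"
    "wedge22 \<alpha> \<beta> c d b a = - wedge22 \<alpha> \<beta> a b c d" "wedge22 \<alpha> \<beta> d a b c = - wedge22 \<alpha> \<beta> a b c d"
    "wedge22 \<alpha> \<beta> d a c b = wedge22 \<alpha> \<beta> a b c d" "wedge22 \<alpha> \<beta> d b a c = wedge22 \<alpha> \<beta> a b c d"
    "wedge22 \<alpha> \<beta> d b c a = - wedge22 \<alpha> \<beta> a b c d" "wedge22 \<alpha> \<beta> d c a b = - wedge22 \<alpha> \<beta> a b c d"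
    "wedge22 \<alpha> \<beta> d c b a = wedge22 \<alpha> \<beta> a b c d"
  by (simp_all add: wedge22_def al[of a b] al[of a c] al[of a d] al[of b c] al[of b d] al[of c d]
      be[of a b] be[of a c] be[of a d] be[of b c] be[of b d] be[of c d])

lemma distinct_7: "1 \<noteq> (2::7)" "1 \<noteq> (3::7)" "1 \<noteq> (4::7)" "1 \<noteq> (5::7)" "1 \<noteq> (6::7)" "1 \<noteq> (7::7)" "2 \<noteq> (1::7)"
    "2 \<noteq> (3::7)" "2 \<noteq> (4::7)" "2 \<noteq> (5::7)" "2 \<noteq> (6::7)" "2 \<noteq> (7::7)" "3 \<noteq> (1::7)" "3 \<noteq> (2::7)"
    "3 \<noteq> (4::7)" "3 \<noteq> (5::7)" "3 \<noteq> (6::7)" "3 \<noteq> (7::7)" "4 \<noteq> (1::7)" "4 \<noteq> (2::7)" "4 \<noteq> (3::7)"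
    "4 \<noteq> (5::7)" "4 \<noteq> (6::7)" "4 \<noteq> (7::7)" "5 \<noteq> (1::7)" "5 \<noteq> (2::7)" "5 \<noteq> (3::7)" "5 \<noteq> (4::7)"
    "5 \<noteq> (6::7)" "5 \<noteq> (7::7)" "6 \<noteq> (1::7)" "6 \<noteq> (2::7)" "6 \<noteq> (3::7)" "6 \<noteq> (4::7)" "6 \<noteq> (5::7)"
    "6 \<noteq> (7::7)" "7 \<noteq> (1::7)" "7 \<noteq> (2::7)" "7 \<noteq> (3::7)" "7 \<noteq> (4::7)" "7 \<noteq> (5::7)" "7 \<noteq> (6::7)"
  by simp_all

lemma perm_sum_5:
  assumes "distinct [a,b,c,d,e]"
  shows "perm_sum [a,b,c,d,e] F = perm_sum [b,c,d,e] (\<lambda>ys. F (a # ys)) - perm_sum [a,c,d,e] (\<lambda>ys. F (b # ys))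
    - perm_sum [b,a,d,e] (\<lambda>ys. F (c # ys)) - perm_sum [b,c,a,e] (\<lambda>ys. F (d # ys))
    - perm_sum [b,c,d,a] (\<lambda>ys. F (e # ys))"
proof -
  have t1: "Transposition.transpose a x y = y" if "a \<noteq> y" "x \<noteq> y" for x y
    using that by (auto simp: Transposition.transpose_def)
  have t2: "Transposition.transpose a x y = y" if "a \<noteq> y" "y \<noteq> x" for x y
    using that by (auto simp: Transposition.transpose_def)
  show ?thesis
    using assms by (simp add: perm_sum_Cons[OF assms] t1 t2)
qed

lemma perm_sum_6:
  assumes "distinct [a,b,c,d,e,f]"
  shows "perm_sum [a,b,c,d,e,f] F = perm_sum [b,c,d,e,f] (\<lambda>ys. F (a # ys)) - perm_sum [a,c,d,e,f] (\<lambda>ys. F (b # ys))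
    - perm_sum [b,a,d,e,f] (\<lambda>ys. F (c # ys)) - perm_sum [b,c,a,e,f] (\<lambda>ys. F (d # ys))
    - perm_sum [b,c,d,a,f] (\<lambda>ys. F (e # ys)) - perm_sum [b,c,d,e,a] (\<lambda>ys. F (f # ys))"
proof -
  have t1: "Transposition.transpose a x y = y" if "a \<noteq> y" "x \<noteq> y" for x y
    using that by (auto simp: Transposition.transpose_def)
  have t2: "Transposition.transpose a x y = y" if "a \<noteq> y" "y \<noteq> x" for x y
    using that by (auto simp: Transposition.transpose_def)
  show ?thesis
    using assms by (simp add: perm_sum_Cons[OF assms] t1 t2)
qed

lemma perm_sum_7:
  assumes "distinct [a,b,c,d,e,f,g]"
  shows "perm_sum [a,b,c,d,e,f,g] F = perm_sum [b,c,d,e,f,g] (\<lambda>ys. F (a # ys)) - perm_sum [a,c,d,e,f,g] (\<lambda>ys. F (b # ys))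
    - perm_sum [b,a,d,e,f,g] (\<lambda>ys. F (c # ys)) - perm_sum [b,c,a,e,f,g] (\<lambda>ys. F (d # ys))
    - perm_sum [b,c,d,a,f,g] (\<lambda>ys. F (e # ys)) - perm_sum [b,c,d,e,a,g] (\<lambda>ys. F (f # ys))
    - perm_sum [b,c,d,e,f,a] (\<lambda>ys. F (g # ys))"
proof -
  have t1: "Transposition.transpose a x y = y" if "a \<noteq> y" "x \<noteq> y" for x y
    using that by (auto simp: Transposition.transpose_def)
  have t2: "Transposition.transpose a x y = y" if "a \<noteq> y" "y \<noteq> x" for x y
    using that by (auto simp: Transposition.transpose_def)
  show ?thesis
    using assms by (simp add: perm_sum_Cons[OF assms] t1 t2)
qed

text \<open>The constant is 2! 2! 3!, the normalisation in \<open>wedge223\<close>. The slots of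
  \<gamma> head the list, so that after three expansions \<gamma> is a constant factor and each of
  the 210 remaining sums runs over the four indices of \<alpha> and \<beta>.\<close>

lemma perm_sum_wedge_comp:
  assumes al: "\<And>i j. \<alpha> j i = - \<alpha> i j" and be: "\<And>i j. \<beta> j i = - \<beta> i j"
    and g1: "\<And>i j k. \<gamma> j i k = - \<gamma> i j k" and g2: "\<And>i j k. \<gamma> i k j = - \<gamma> i j k"
  shows "perm_sum [5,6,7,1,2,3,4::7] (\<lambda>l. \<alpha> (l!3) (l!4) * \<beta> (l!5) (l!6) * \<gamma> (l!0) (l!1) (l!2)) = 24 * wedge_comp \<alpha> \<beta> \<gamma>"
proof -
  have w: "perm_sum [a,b,c,d] (\<lambda>l. \<alpha> (l!0) (l!Suc 0) * \<beta> (l!2) (l!3) * C) = 4 * wedge22 \<alpha> \<beta> a b c d * C"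
    if "distinct [a,b,c,d]" for a b c d C
    using perm_sum_wedge22[of a b c d \<alpha> \<beta> C, OF that al be] by simp
  have w3: "perm_sum [a,b,c,d] (\<lambda>l. \<alpha> ((x#y#z#l)!3) ((x#y#z#l)!4) * \<beta> ((x#y#z#l)!5) ((x#y#z#l)!6)
       * \<gamma> ((x#y#z#l)!0) ((x#y#z#l)!1) ((x#y#z#l)!2)) = 4 * wedge22 \<alpha> \<beta> a b c d * \<gamma> x y z"
    if "distinct [a,b,c,d]" for a b c d x y z
    using w[OF that] by simp
  have g: "\<gamma> j i k = - \<gamma> i j k" "\<gamma> i k j = - \<gamma> i j k" "\<gamma> k i j = \<gamma> i j k" "\<gamma> j k i = \<gamma> i j k" "\<gamma> k j i = - \<gamma> i j k" for i j k
    using g1[of j i k] g2[of i k j] g1[of k i j] g2[of j k i] g1[of k j i] g1[of i k j] g2[of j i k] g2[of k i j] g1[of j k i]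
    by linarith+
  note g' = g[where i=1 and j=2 and k=3] g[where i=1 and j=2 and k=4] g[where i=1 and j=2 and k=5] g[where i=1 and j=2 and k=6]
    g[where i=1 and j=2 and k=7] g[where i=1 and j=3 and k=4] g[where i=1 and j=3 and k=5] g[where i=1 and j=3 and k=6]
    g[where i=1 and j=3 and k=7] g[where i=1 and j=4 and k=5] g[where i=1 and j=4 and k=6] g[where i=1 and j=4 and k=7]
    g[where i=1 and j=5 and k=6] g[where i=1 and j=5 and k=7] g[where i=1 and j=6 and k=7] g[where i=2 and j=3 and k=4]
    g[where i=2 and j=3 and k=5] g[where i=2 and j=3 and k=6] g[where i=2 and j=3 and k=7] g[where i=2 and j=4 and k=5]
    g[where i=2 and j=4 and k=6] g[where i=2 and j=4 and k=7] g[where i=2 and j=5 and k=6] g[where i=2 and j=5 and k=7]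
    g[where i=2 and j=6 and k=7] g[where i=3 and j=4 and k=5] g[where i=3 and j=4 and k=6] g[where i=3 and j=4 and k=7]
    g[where i=3 and j=5 and k=6] g[where i=3 and j=5 and k=7] g[where i=3 and j=6 and k=7] g[where i=4 and j=5 and k=6]
    g[where i=4 and j=5 and k=7] g[where i=4 and j=6 and k=7] g[where i=5 and j=6 and k=7]
  note wp = wedge22_permute[of \<alpha> \<beta>, OF al be]
  note w' = wp[where a=1 and b=2 and c=3 and d=4] wp[where a=1 and b=2 and c=3 and d=5]
    wp[where a=1 and b=2 and c=3 and d=6] wp[where a=1 and b=2 and c=3 and d=7]
    wp[where a=1 and b=2 and c=4 and d=5] wp[where a=1 and b=2 and c=4 and d=6]
    wp[where a=1 and b=2 and c=4 and d=7] wp[where a=1 and b=2 and c=5 and d=6]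
    wp[where a=1 and b=2 and c=5 and d=7] wp[where a=1 and b=2 and c=6 and d=7]
    wp[where a=1 and b=3 and c=4 and d=5] wp[where a=1 and b=3 and c=4 and d=6]
    wp[where a=1 and b=3 and c=4 and d=7] wp[where a=1 and b=3 and c=5 and d=6]
    wp[where a=1 and b=3 and c=5 and d=7] wp[where a=1 and b=3 and c=6 and d=7]
    wp[where a=1 and b=4 and c=5 and d=6] wp[where a=1 and b=4 and c=5 and d=7]
    wp[where a=1 and b=4 and c=6 and d=7] wp[where a=1 and b=5 and c=6 and d=7]
    wp[where a=2 and b=3 and c=4 and d=5] wp[where a=2 and b=3 and c=4 and d=6]
    wp[where a=2 and b=3 and c=4 and d=7] wp[where a=2 and b=3 and c=5 and d=6]
    wp[where a=2 and b=3 and c=5 and d=7] wp[where a=2 and b=3 and c=6 and d=7]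
    wp[where a=2 and b=4 and c=5 and d=6] wp[where a=2 and b=4 and c=5 and d=7]
    wp[where a=2 and b=4 and c=6 and d=7] wp[where a=2 and b=5 and c=6 and d=7]
    wp[where a=3 and b=4 and c=5 and d=6] wp[where a=3 and b=4 and c=5 and d=7]
    wp[where a=3 and b=4 and c=6 and d=7] wp[where a=3 and b=5 and c=6 and d=7]
    wp[where a=4 and b=5 and c=6 and d=7]
  show ?thesis
    apply (simp only: perm_sum_7 perm_sum_6 perm_sum_5 distinct.simps list.set insert_iff empty_iff distinct_7 simp_thms)
    apply (simp only: w3 distinct.simps list.set insert_iff empty_iff distinct_7 simp_thms)
    apply (simp only: g' w' wedge_comp_def)
    by (simp add: algebra_simps)
qed

section \<open>The normal form of a nondegenerate 3-form\<close>

lemma scaleR_matrix_mult: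
  fixes A :: "real^'n^'m" and B :: "real^'p^'n"
  shows "(k *\<^sub>R A) ** B = k *\<^sub>R (A ** B)" "A ** (k *\<^sub>R B) = k *\<^sub>R (A ** B)" "(- A) ** B = - (A ** B)" "A ** (- B) = - (A ** B)"
  by (simp_all add: matrix_matrix_mult_def vec_eq_iff sum_distrib_left sum_negf mult_ac)

text \<open>Up to the factor \<sigma> / m each Y inverts the corresponding X, so the triple product
  can be solved for \<open>X3\<close>, a multiple of \<open>X2 ** Y1\<close>. Anticommutation makes
  the square of that matrix a negative multiple of the identity. The second claim compares
  \<open>X3 ** X3\<close> with \<open>X3 ** Y3\<close>.\<close>

lemma clifford_triple:
  fixes X1 X2 X3 Y1 Y2 Y3 :: "real^'n^'n"
  assumes X1: "X1 ** Y1 = (\<sigma> / m) *\<^sub>R mat 1" "Y1 ** X1 = (\<sigma> / m) *\<^sub>R mat 1"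
    and X2: "X2 ** Y2 = (\<sigma> / m) *\<^sub>R mat 1" and X3: "X3 ** Y3 = (\<sigma> / m) *\<^sub>R mat 1"
    and anti: "Y1 ** X2 = - (Y2 ** X1)" and triple: "X1 ** Y2 ** X3 = \<sigma> *\<^sub>R mat 1"
    and \<sigma>: "\<sigma>\<^sup>2 = 1" and m: "m > 0"
  shows "X3 ** X3 = - (m\<^sup>2 *\<^sub>R mat 1)" and "X3 = - ((\<sigma> * m ^ 3) *\<^sub>R Y3)"
proof -
  have \<sigma>2: "\<sigma> * \<sigma> = 1" using \<sigma> by (simp add: power2_eq_square)
  have "(\<sigma> / m) *\<^sub>R (Y2 ** X3) = Y1 ** (X1 ** Y2 ** X3)"
    by (simp add: matrix_mul_assoc X1 scaleR_matrix_mult)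
  also have "\<dots> = \<sigma> *\<^sub>R Y1" by (simp add: triple scaleR_matrix_mult)
  finally have "(\<sigma> * m) *\<^sub>R ((\<sigma> / m) *\<^sub>R (Y2 ** X3)) = (\<sigma> * m) *\<^sub>R (\<sigma> *\<^sub>R Y1)" by simp
  moreover have "\<sigma> * m * (\<sigma> / m) = 1" "\<sigma> * m * \<sigma> = m" using \<sigma>2 m by (simp_all add: field_simps)
  ultimately have YX: "Y2 ** X3 = m *\<^sub>R Y1" by (simp only: scaleR_scaleR) simp
  have "(\<sigma> / m) *\<^sub>R X3 = X2 ** (Y2 ** X3)"
    by (simp add: matrix_mul_assoc X2 scaleR_matrix_mult)
  also have "\<dots> = m *\<^sub>R (X2 ** Y1)" by (simp add: YX scaleR_matrix_mult)
  finally have "(\<sigma> * m) *\<^sub>R ((\<sigma> / m) *\<^sub>R X3) = (\<sigma> * m) *\<^sub>R (m *\<^sub>R (X2 ** Y1))" by simp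
  moreover have "\<sigma> * m * (\<sigma> / m) = 1" using \<sigma>2 m by (simp add: field_simps)
  ultimately have X3_eq: "X3 = (\<sigma> * m\<^sup>2) *\<^sub>R (X2 ** Y1)" by (simp only: scaleR_scaleR power2_eq_square mult.assoc) simp
  have "(X2 ** Y1) ** (X2 ** Y1) = X2 ** (Y1 ** X2) ** Y1" by (simp add: matrix_mul_assoc)
  also have "\<dots> = - ((X2 ** Y2) ** (X1 ** Y1))" by (simp add: anti scaleR_matrix_mult matrix_mul_assoc)
  also have "\<dots> = - ((1 / m\<^sup>2) *\<^sub>R mat 1)"
    using \<sigma>2 by (simp add: X1 X2 scaleR_matrix_mult power2_eq_square)
  finally have sq: "(X2 ** Y1) ** (X2 ** Y1) = - ((1 / m\<^sup>2) *\<^sub>R mat 1)" .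
  have "X3 ** X3 = (\<sigma> * m\<^sup>2 * (\<sigma> * m\<^sup>2)) *\<^sub>R ((X2 ** Y1) ** (X2 ** Y1))"
    unfolding X3_eq by (simp add: scaleR_matrix_mult)
  also have "\<sigma> * m\<^sup>2 * (\<sigma> * m\<^sup>2) = m ^ 4" using \<sigma> by algebra
  also have "m ^ 4 *\<^sub>R ((X2 ** Y1) ** (X2 ** Y1)) = - (m\<^sup>2 *\<^sub>R mat 1)"
    unfolding sq using m by (simp add: power2_eq_square power4_eq_xxxx)
  finally show sq3: "X3 ** X3 = - (m\<^sup>2 *\<^sub>R mat 1)" .
  have "(\<sigma> / m) *\<^sub>R X3 = X3 ** (X3 ** Y3)" by (simp add: X3 scaleR_matrix_mult)
  also have "\<dots> = - (m\<^sup>2 *\<^sub>R Y3)" by (simp add: matrix_mul_assoc sq3 scaleR_matrix_mult)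
  finally have "(\<sigma> * m) *\<^sub>R ((\<sigma> / m) *\<^sub>R X3) = (\<sigma> * m) *\<^sub>R (- (m\<^sup>2 *\<^sub>R Y3))" by simp
  moreover have "\<sigma> * m * (\<sigma> / m) = 1" using \<sigma>2 m by (simp add: field_simps)
  ultimately show "X3 = - ((\<sigma> * m ^ 3) *\<^sub>R Y3)"
    by (simp add: power2_eq_square power3_eq_cube mult.assoc)
qed

definition skew4 :: "real \<Rightarrow> real \<Rightarrow> real \<Rightarrow> real \<Rightarrow> real \<Rightarrow> real \<Rightarrow> real^4^4" where
  "skew4 a b d r q p = vector [vector [0, a, b, d], vector [- a, 0, r, q], vector [- b, - r, 0, p], vector [- d, - q, - p, 0]]"

lemma skew4_nth:
  "skew4 a b d r q p $ 1 $ 1 = 0" "skew4 a b d r q p $ 1 $ 2 = a" "skew4 a b d r q p $ 1 $ 3 = b" "skew4 a b d r q p $ 1 $ 4 = d"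
  "skew4 a b d r q p $ 2 $ 1 = - a" "skew4 a b d r q p $ 2 $ 2 = 0" "skew4 a b d r q p $ 2 $ 3 = r" "skew4 a b d r q p $ 2 $ 4 = q"
  "skew4 a b d r q p $ 3 $ 1 = - b" "skew4 a b d r q p $ 3 $ 2 = - r" "skew4 a b d r q p $ 3 $ 3 = 0" "skew4 a b d r q p $ 3 $ 4 = p"
  "skew4 a b d r q p $ 4 $ 1 = - d" "skew4 a b d r q p $ 4 $ 2 = - q" "skew4 a b d r q p $ 4 $ 3 = - p" "skew4 a b d r q p $ 4 $ 4 = 0"
  by (simp_all add: skew4_def vector_def)

lemmas skew4_mult = matrix_matrix_mult_def sum_4 skew4_nth

text \<open>In an orthonormal basis whose first three vectors maximise the 3-form, with maximal value \<open>m\<close>,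
  the form is \<open>m e\<^sup>1\<^sup>2\<^sup>3 + \<Sum>\<^sub>i e\<^sup>i \<and> \<omega>\<^sub>i + \<rho>\<close>, where the \<open>\<omega>\<^sub>i\<close> and \<open>\<rho>\<close> live on the span of the last four
  basis vectors. The components of the metric relation force \<open>\<rho> = 0\<close>, and the \<open>\<omega>\<^sub>i\<close>, viewed as
  skew matrices \<open>A i\<close> with duals \<open>B i\<close>, satisfy Clifford relations from which \<open>m\<^sup>6 = 1\<close> follows.\<close>

locale adapted_form =
  fixes c :: "7 \<Rightarrow> 7 \<Rightarrow> 7 \<Rightarrow> real" and m \<sigma> :: real
  assumes alt12: "c j i k = - c i j k" and alt23: "c i k j = - c i j k"
    and m: "c 1 2 3 = m" "m > 0"
    and zero: "k \<in> {4,5,6,7} \<Longrightarrow> c 1 2 k = 0" "k \<in> {4,5,6,7} \<Longrightarrow> c 1 3 k = 0" "k \<in> {4,5,6,7} \<Longrightarrow> c 2 3 k = 0"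
    and wedge: "wedge_comp (c p) (c q) c = - 6 * kron p q * \<sigma>"
    and sigma: "\<sigma>\<^sup>2 = 1"
begin

lemma alt: "c j i k = - c i j k" "c i k j = - c i j k" "c k i j = c i j k" "c j k i = c i j k" "c k j i = - c i j k"
  using alt12[of j i k] alt23[of i k j] alt12[of k i j] alt23[of j k i] alt12[of k j i] alt12[of i k j] alt23[of j i k] alt23[of k i j] alt12[of j k i]
  by linarith+

lemma alt0: "c i i k = 0" "c i k k = 0" "c k i k = 0"
  using alt(1)[of i i k] alt(2)[of i k k] alt(5)[of k i k] by linarith+

lemmas alts = alt[where i=1 and j=2 and k=3] alt[where i=1 and j=2 and k=4] alt[where i=1 and j=2 and k=5]
    alt[where i=1 and j=2 and k=6] alt[where i=1 and j=2 and k=7] alt[where i=1 and j=3 and k=4]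
    alt[where i=1 and j=3 and k=5] alt[where i=1 and j=3 and k=6] alt[where i=1 and j=3 and k=7]
    alt[where i=1 and j=4 and k=5] alt[where i=1 and j=4 and k=6] alt[where i=1 and j=4 and k=7]
    alt[where i=1 and j=5 and k=6] alt[where i=1 and j=5 and k=7] alt[where i=1 and j=6 and k=7]
    alt[where i=2 and j=3 and k=4] alt[where i=2 and j=3 and k=5] alt[where i=2 and j=3 and k=6]
    alt[where i=2 and j=3 and k=7] alt[where i=2 and j=4 and k=5] alt[where i=2 and j=4 and k=6]
    alt[where i=2 and j=4 and k=7] alt[where i=2 and j=5 and k=6] alt[where i=2 and j=5 and k=7]
    alt[where i=2 and j=6 and k=7] alt[where i=3 and j=4 and k=5] alt[where i=3 and j=4 and k=6]
    alt[where i=3 and j=4 and k=7] alt[where i=3 and j=5 and k=6] alt[where i=3 and j=5 and k=7]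
    alt[where i=3 and j=6 and k=7] alt[where i=4 and j=5 and k=6] alt[where i=4 and j=5 and k=7]
    alt[where i=4 and j=6 and k=7] alt[where i=5 and j=6 and k=7]

lemma zeros: "c 1 2 4 = 0" "c 1 2 5 = 0" "c 1 2 6 = 0" "c 1 2 7 = 0"
    "c 1 3 4 = 0" "c 1 3 5 = 0" "c 1 3 6 = 0" "c 1 3 7 = 0"
    "c 2 3 4 = 0" "c 2 3 5 = 0" "c 2 3 6 = 0" "c 2 3 7 = 0"
  using zero by simp_all

lemmas expand = wedge_comp_def wedge22_def alt0 alts zeros

text \<open>The bracket is the Pfaffian of \<omega>_i. The component (i,i) of the metric relation
  equals 6 m times it and must be -6 \<sigma>.\<close>

lemma pf:
  "i \<in> {1,2,3} \<Longrightarrow> m * (c i 4 5 * c i 6 7 - c i 4 6 * c i 5 7 + c i 4 7 * c i 5 6) = - \<sigma>"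
proof -
  have "wedge_comp (c 1) (c 1) c = 6 * m * (c 1 4 5 * c 1 6 7 - c 1 4 6 * c 1 5 7 + c 1 4 7 * c 1 5 6)"
    by (simp only: expand m) (simp add: algebra_simps)
  moreover have "wedge_comp (c 2) (c 2) c = 6 * m * (c 2 4 5 * c 2 6 7 - c 2 4 6 * c 2 5 7 + c 2 4 7 * c 2 5 6)"
    by (simp only: expand m) (simp add: algebra_simps)
  moreover have "wedge_comp (c 3) (c 3) c = 6 * m * (c 3 4 5 * c 3 6 7 - c 3 4 6 * c 3 5 7 + c 3 4 7 * c 3 5 6)"
    by (simp only: expand m) (simp add: algebra_simps)
  ultimately show "i \<in> {1,2,3} \<Longrightarrow> ?thesis" using wedge[of i i] by auto
qed

text \<open>The components (1,k) with k > 3 say that the wedge product of \<omega>_1 with the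
  contraction of \<rho> by e_k is zero. Suitable combinations of these linear equations give P
  \<rho> = 0, where P is the Pfaffian of \<omega>_1, nonzero by \<open>pf\<close>.\<close>

lemma rho:
  "c 4 5 6 = 0" "c 4 5 7 = 0" "c 4 6 7 = 0" "c 5 6 7 = 0"
proof -
  have 4: "c 1 4 5 * c 4 6 7 - c 1 4 6 * c 4 5 7 + c 1 4 7 * c 4 5 6 = 0"
  proof -
    have "wedge_comp (c 1) (c 4) c = 3 * m * (c 1 4 5 * c 4 6 7 - c 1 4 6 * c 4 5 7 + c 1 4 7 * c 4 5 6)"
      by (simp only: expand m) (simp add: algebra_simps)
    then show ?thesis using wedge[of 1 4] m(2) by simp
  qed
  have 5: "c 1 4 5 * c 5 6 7 - c 1 5 6 * c 4 5 7 + c 1 5 7 * c 4 5 6 = 0"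
  proof -
    have "wedge_comp (c 1) (c 5) c = 3 * m * (c 1 4 5 * c 5 6 7 - c 1 5 6 * c 4 5 7 + c 1 5 7 * c 4 5 6)"
      by (simp only: expand m) (simp add: algebra_simps)
    then show ?thesis using wedge[of 1 5] m(2) by simp
  qed
  have 6: "c 1 4 6 * c 5 6 7 - c 1 5 6 * c 4 6 7 + c 1 6 7 * c 4 5 6 = 0"
  proof -
    have "wedge_comp (c 1) (c 6) c = 3 * m * (c 1 4 6 * c 5 6 7 - c 1 5 6 * c 4 6 7 + c 1 6 7 * c 4 5 6)"
      by (simp only: expand m) (simp add: algebra_simps)
    then show ?thesis using wedge[of 1 6] m(2) by simp
  qed
  have 7: "c 1 4 7 * c 5 6 7 - c 1 5 7 * c 4 6 7 + c 1 6 7 * c 4 5 7 = 0"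
  proof -
    have "wedge_comp (c 1) (c 7) c = 3 * m * (c 1 4 7 * c 5 6 7 - c 1 5 7 * c 4 6 7 + c 1 6 7 * c 4 5 7)"
      by (simp only: expand m) (simp add: algebra_simps)
    then show ?thesis using wedge[of 1 7] m(2) by simp
  qed
  define P where "P = c 1 4 5 * c 1 6 7 - c 1 4 6 * c 1 5 7 + c 1 4 7 * c 1 5 6"
  have P: "P \<noteq> 0" using pf[of 1] sigma unfolding P_def by auto
  have "P * c 4 5 6 = 0" using 4 5 6 unfolding P_def by algebra
  moreover have "P * c 4 5 7 = 0" using 4 5 7 unfolding P_def by algebra
  moreover have "P * c 4 6 7 = 0" using 4 6 7 unfolding P_def by algebra
  moreover have "P * c 5 6 7 = 0" using 5 6 7 unfolding P_def by algebra
  ultimately show "c 4 5 6 = 0" "c 4 5 7 = 0" "c 4 6 7 = 0" "c 5 6 7 = 0" using P by simp_all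
qed

text \<open>The polarised Pfaffian: the off-diagonal components among the first three indices say
  that \<omega>_i \<and> \<omega>_j = 0.\<close>

lemma pf_polar:
  assumes "(i, j) \<in> {(1,2),(1,3),(2,3)}"
  shows "c i 4 5 * c j 6 7 - c i 4 6 * c j 5 7 + c i 4 7 * c j 5 6
    + c j 4 5 * c i 6 7 - c j 4 6 * c i 5 7 + c j 4 7 * c i 5 6 = 0" (is "?P i j = 0")
proof -
  have "wedge_comp (c 1) (c 2) c = 3 * m * ?P 1 2"
    by (simp only: expand m) (simp add: algebra_simps)
  moreover have "wedge_comp (c 1) (c 3) c = 3 * m * ?P 1 3"
    by (simp only: expand m) (simp add: algebra_simps)
  moreover have "wedge_comp (c 2) (c 3) c = 3 * m * ?P 2 3"
    by (simp only: expand m) (simp add: algebra_simps)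
  ultimately show ?thesis using wedge[of 1 2] wedge[of 1 3] wedge[of 2 3] m(2) assms by auto
qed

definition A :: "7 \<Rightarrow> real^4^4" where
  "A i = skew4 (c i 4 5) (c i 4 6) (c i 4 7) (c i 5 6) (c i 5 7) (c i 6 7)"

text \<open>The Hodge dual of \<open>A i\<close> on the span of the last four vectors. A skew 4 by 4
  matrix times its dual is minus its Pfaffian times the identity, which turns the scalar relations
  \<open>pf\<close> and \<open>pf_polar\<close> into matrix relations.\<close>

definition B :: "7 \<Rightarrow> real^4^4" where
  "B i = skew4 (c i 6 7) (- c i 5 7) (c i 5 6) (c i 4 7) (- c i 4 6) (c i 4 5)"

lemma AB: "i \<in> {1,2,3} \<Longrightarrow> A i ** B i = (\<sigma> / m) *\<^sub>R mat 1"
  and BA: "i \<in> {1,2,3} \<Longrightarrow> B i ** A i = (\<sigma> / m) *\<^sub>R mat 1"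
proof -
  assume i: "i \<in> {1,2,3}"
  have *: "\<sigma> / m = - (c i 4 5 * c i 6 7 - c i 4 6 * c i 5 7 + c i 4 7 * c i 5 6)"
    using pf[OF i] m(2) by (simp add: field_simps)
  show "A i ** B i = (\<sigma> / m) *\<^sub>R mat 1" "B i ** A i = (\<sigma> / m) *\<^sub>R mat 1"
    unfolding * A_def B_def by (simp_all add: skew4_mult vec_eq_iff forall_4 mat_def algebra_simps)
qed

lemma AB_anti: "(i, j) \<in> {(1,2),(1,3),(2,3)} \<Longrightarrow> A i ** B j = (- 1) *\<^sub>R (A j ** B i)"
  and BA_anti: "(i, j) \<in> {(1,2),(1,3),(2,3)} \<Longrightarrow> B i ** A j = (- 1) *\<^sub>R (B j ** A i)"
proof -
  assume ij: "(i, j) \<in> {(1,2),(1,3),(2,3)}"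
  have *: "c j 4 5 * c i 6 7 = - (c i 4 5 * c j 6 7 - c i 4 6 * c j 5 7 + c i 4 7 * c j 5 6
     - c j 4 6 * c i 5 7 + c j 4 7 * c i 5 6)"
    using pf_polar[OF ij] by linarith
  show "A i ** B j = (- 1) *\<^sub>R (A j ** B i)" "B i ** A j = (- 1) *\<^sub>R (B j ** A i)"
    unfolding A_def B_def
    by (simp_all add: skew4_mult vec_eq_iff forall_4 algebra_simps) (use * in algebra)+
qed

text \<open>The components with both indices in 4, ..., 7 are cubic in the \<omega>_i: up to sign
  they are the entries of \<open>?S\<close>, the antisymmetrisation of
  \<open>A i ** B j ** A k\<close> over the three indices. By anticommutation its six terms
  coincide.\<close>

lemma triple: "A 1 ** B 2 ** A 3 = \<sigma> *\<^sub>R mat 1"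
proof -
  let ?S = "A 1 ** B 2 ** A 3 - A 1 ** B 3 ** A 2 - A 2 ** B 1 ** A 3 + A 2 ** B 3 ** A 1
     + A 3 ** B 1 ** A 2 - A 3 ** B 2 ** A 1"
  have e44: "wedge_comp (c 4) (c 4) c = - (?S $ 1 $ 1)"
    by (simp only: expand rho m A_def B_def skew4_mult vec_lambda_beta vector_minus_component vector_add_component) (simp add: algebra_simps)
  have e45: "wedge_comp (c 4) (c 5) c = - (?S $ 1 $ 2)"
    by (simp only: expand rho m A_def B_def skew4_mult vec_lambda_beta vector_minus_component vector_add_component) (simp add: algebra_simps)
  have e46: "wedge_comp (c 4) (c 6) c = - (?S $ 1 $ 3)"
    by (simp only: expand rho m A_def B_def skew4_mult vec_lambda_beta vector_minus_component vector_add_component) (simp add: algebra_simps)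
  have e47: "wedge_comp (c 4) (c 7) c = - (?S $ 1 $ 4)"
    by (simp only: expand rho m A_def B_def skew4_mult vec_lambda_beta vector_minus_component vector_add_component) (simp add: algebra_simps)
  have e54: "wedge_comp (c 5) (c 4) c = - (?S $ 2 $ 1)"
    by (simp only: expand rho m A_def B_def skew4_mult vec_lambda_beta vector_minus_component vector_add_component) (simp add: algebra_simps)
  have e55: "wedge_comp (c 5) (c 5) c = - (?S $ 2 $ 2)"
    by (simp only: expand rho m A_def B_def skew4_mult vec_lambda_beta vector_minus_component vector_add_component) (simp add: algebra_simps)
  have e56: "wedge_comp (c 5) (c 6) c = - (?S $ 2 $ 3)"
    by (simp only: expand rho m A_def B_def skew4_mult vec_lambda_beta vector_minus_component vector_add_component) (simp add: algebra_simps)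
  have e57: "wedge_comp (c 5) (c 7) c = - (?S $ 2 $ 4)"
    by (simp only: expand rho m A_def B_def skew4_mult vec_lambda_beta vector_minus_component vector_add_component) (simp add: algebra_simps)
  have e64: "wedge_comp (c 6) (c 4) c = - (?S $ 3 $ 1)"
    by (simp only: expand rho m A_def B_def skew4_mult vec_lambda_beta vector_minus_component vector_add_component) (simp add: algebra_simps)
  have e65: "wedge_comp (c 6) (c 5) c = - (?S $ 3 $ 2)"
    by (simp only: expand rho m A_def B_def skew4_mult vec_lambda_beta vector_minus_component vector_add_component) (simp add: algebra_simps)
  have e66: "wedge_comp (c 6) (c 6) c = - (?S $ 3 $ 3)"
    by (simp only: expand rho m A_def B_def skew4_mult vec_lambda_beta vector_minus_component vector_add_component) (simp add: algebra_simps)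
  have e67: "wedge_comp (c 6) (c 7) c = - (?S $ 3 $ 4)"
    by (simp only: expand rho m A_def B_def skew4_mult vec_lambda_beta vector_minus_component vector_add_component) (simp add: algebra_simps)
  have e74: "wedge_comp (c 7) (c 4) c = - (?S $ 4 $ 1)"
    by (simp only: expand rho m A_def B_def skew4_mult vec_lambda_beta vector_minus_component vector_add_component) (simp add: algebra_simps)
  have e75: "wedge_comp (c 7) (c 5) c = - (?S $ 4 $ 2)"
    by (simp only: expand rho m A_def B_def skew4_mult vec_lambda_beta vector_minus_component vector_add_component) (simp add: algebra_simps)
  have e76: "wedge_comp (c 7) (c 6) c = - (?S $ 4 $ 3)"
    by (simp only: expand rho m A_def B_def skew4_mult vec_lambda_beta vector_minus_component vector_add_component) (simp add: algebra_simps)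
  have e77: "wedge_comp (c 7) (c 7) c = - (?S $ 4 $ 4)"
    by (simp only: expand rho m A_def B_def skew4_mult vec_lambda_beta vector_minus_component vector_add_component) (simp add: algebra_simps)
  have "?S = (6 * \<sigma>) *\<^sub>R mat 1"
    using e44 e45 e46 e47 e54 e55 e56 e57 e64 e65 e66 e67 e74 e75 e76 e77
    by (simp only: wedge) (simp add: vec_eq_iff forall_4 mat_def)
  moreover have "?S = 6 *\<^sub>R (A 1 ** B 2 ** A 3)"
  proof -
    note an = AB_anti[of 1 2] AB_anti[of 1 3] AB_anti[of 2 3] BA_anti[of 1 2] BA_anti[of 1 3] BA_anti[of 2 3]
    have 1: "A 2 ** B 1 ** A 3 = - (A 1 ** B 2 ** A 3)"
      using an(1) by (simp add: scaleR_matrix_mult)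
    have 2: "A 1 ** B 3 ** A 2 = - (A 1 ** B 2 ** A 3)"
      using an(6) by (simp add: scaleR_matrix_mult matrix_mul_assoc[symmetric])
    have 3: "A 3 ** B 2 ** A 1 = - (A 2 ** B 3 ** A 1)"
      using an(3) by (simp add: scaleR_matrix_mult)
    have 4: "A 2 ** B 3 ** A 1 = - (A 2 ** B 1 ** A 3)"
      using an(5) by (simp add: scaleR_matrix_mult matrix_mul_assoc[symmetric])
    have 5: "A 3 ** B 1 ** A 2 = - (A 1 ** B 3 ** A 2)"
      using an(2) by (simp add: scaleR_matrix_mult)
    show ?thesis unfolding 3 5 4 2 1 by (simp add: vec_eq_iff)
  qed
  ultimately have "6 *\<^sub>R (A 1 ** B 2 ** A 3) = 6 *\<^sub>R (\<sigma> *\<^sub>R mat 1)" by simp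
  then show ?thesis by (simp only: scaleR_cancel_left) simp
qed

text \<open>Rotated versions of \<open>triple\<close>, so that \<open>clifford_triple\<close>
  applies with each of the three matrices in third place.\<close>

lemma triples: "A 2 ** B 3 ** A 1 = \<sigma> *\<^sub>R mat 1" "A 3 ** B 1 ** A 2 = \<sigma> *\<^sub>R mat 1"
proof -
  note an = AB_anti[of 1 2] AB_anti[of 1 3] AB_anti[of 2 3] BA_anti[of 1 2] BA_anti[of 1 3] BA_anti[of 2 3]
  have 1: "A 2 ** B 1 ** A 3 = - (A 1 ** B 2 ** A 3)"
    using an(1) by (simp add: scaleR_matrix_mult)
  have 2: "A 1 ** B 3 ** A 2 = - (A 1 ** B 2 ** A 3)"
    using an(6) by (simp add: scaleR_matrix_mult matrix_mul_assoc[symmetric])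
  have 4: "A 2 ** B 3 ** A 1 = - (A 2 ** B 1 ** A 3)"
    using an(5) by (simp add: scaleR_matrix_mult matrix_mul_assoc[symmetric])
  have 5: "A 3 ** B 1 ** A 2 = - (A 1 ** B 3 ** A 2)"
    using an(2) by (simp add: scaleR_matrix_mult)
  show "A 2 ** B 3 ** A 1 = \<sigma> *\<^sub>R mat 1" "A 3 ** B 1 ** A 2 = \<sigma> *\<^sub>R mat 1"
    unfolding 5 4 2 1 by (simp_all add: triple)
qed

lemma A_props:
  assumes "i \<in> {1,2,3}"
  shows "A i ** A i = - (m\<^sup>2 *\<^sub>R mat 1)" and "A i = - ((\<sigma> * m ^ 3) *\<^sub>R B i)"
proof -
  note ct = clifford_triple[OF AB BA AB AB _ _ sigma m(2)]
  have a: "B 1 ** A 2 = - (B 2 ** A 1)" "B 2 ** A 3 = - (B 3 ** A 2)" "B 3 ** A 1 = - (B 1 ** A 3)"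
    using BA_anti[of 1 2] BA_anti[of 2 3] BA_anti[of 1 3] by simp_all
  show "A i ** A i = - (m\<^sup>2 *\<^sub>R mat 1)" "A i = - ((\<sigma> * m ^ 3) *\<^sub>R B i)"
    using assms ct[OF _ _ _ _ a(1) triple] ct[OF _ _ _ _ a(2) triples(1)] ct[OF _ _ _ _ a(3) triples(2)]
    by auto
qed

lemma norms:
  assumes "i \<in> {1,2,3}"
  shows "(c i 4 5)\<^sup>2 + (c i 4 6)\<^sup>2 + (c i 4 7)\<^sup>2 = m\<^sup>2"
proof -
  have "(A i ** A i) $ 1 $ 1 = - m\<^sup>2" unfolding A_props(1)[OF assms] by (simp add: mat_def)
  then show ?thesis by (simp add: A_def skew4_mult power2_eq_square)
qed

lemma self_dual_scaled:
  assumes "i \<in> {1,2,3}"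
  shows "c i 4 5 = - \<sigma> * m ^ 3 * c i 6 7" "c i 4 6 = \<sigma> * m ^ 3 * c i 5 7" "c i 4 7 = - \<sigma> * m ^ 3 * c i 5 6"
    "c i 5 6 = - \<sigma> * m ^ 3 * c i 4 7" "c i 5 7 = \<sigma> * m ^ 3 * c i 4 6" "c i 6 7 = - \<sigma> * m ^ 3 * c i 4 5"
proof -
  have *: "A i $ x $ y = - ((\<sigma> * m ^ 3) * B i $ x $ y)" for x y
    using arg_cong[OF A_props(2)[OF assms], of "\<lambda>M. M $ x $ y"] by simp
  show "c i 4 5 = - \<sigma> * m ^ 3 * c i 6 7" "c i 4 6 = \<sigma> * m ^ 3 * c i 5 7" "c i 4 7 = - \<sigma> * m ^ 3 * c i 5 6"
    "c i 5 6 = - \<sigma> * m ^ 3 * c i 4 7" "c i 5 7 = \<sigma> * m ^ 3 * c i 4 6" "c i 6 7 = - \<sigma> * m ^ 3 * c i 4 5"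
    using *[of 1 2] *[of 1 3] *[of 1 4] *[of 2 3] *[of 2 4] *[of 3 4]
    by (simp_all add: A_def B_def skew4_nth)
qed

lemma m_eq_1: "m = 1"
proof -
  note d = self_dual_scaled[of 1, simplified] and n = norms[of 1, simplified]
  \<comment> \<open>Passing to the dual twice multiplies an entry by \<sigma>^2 m^6 = m^6, and by
    \<open>norms\<close> the three squares add up to m^2, which is positive.\<close>
  have "(m ^ 6) * (c 1 4 5)\<^sup>2 = (c 1 4 5)\<^sup>2" "(m ^ 6) * (c 1 4 6)\<^sup>2 = (c 1 4 6)\<^sup>2" "(m ^ 6) * (c 1 4 7)\<^sup>2 = (c 1 4 7)\<^sup>2"
    using d sigma by algebra+
  then have "m ^ 6 * m\<^sup>2 = m\<^sup>2" unfolding n[symmetric] by (simp only: distrib_left)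
  then have "(m ^ 6 - 1) * m\<^sup>2 = 0" by algebra
  then have "m ^ 6 = 1" using m(2) by (simp only: mult_eq_0_iff) simp
  then show ?thesis using m(2) using power_eq_1_iff[of m 6] by simp
qed

lemmas self_dual = self_dual_scaled[unfolded m_eq_1 power_one mult_1_right]

end

section \<open>Orthonormal frames and alternating 3-forms in dimension seven\<close>

definition orthonormal :: "('i \<Rightarrow> 'b::real_inner) \<Rightarrow> bool" where
  "orthonormal E \<longleftrightarrow> (\<forall>i j. E i \<bullet> E j = (if i = j then 1 else 0))"

lemma orthonormalD: "orthonormal E \<Longrightarrow> E i \<bullet> E j = (if i = j then 1 else 0)"
  by (simp add: orthonormal_def)

lemma orthonormal_matrix:
  fixes E :: "'n \<Rightarrow> real^'n"
  assumes "orthonormal E"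
  shows "orthogonal_matrix (\<chi> i. E i)"
proof -
  have "(\<chi> i. E i) ** Finite_Cartesian_Product.transpose (\<chi> i. E i) = mat 1"
    using assms by (simp add: matrix_matrix_mult_def vec_eq_iff Finite_Cartesian_Product.transpose_def mat_def
        orthonormal_def inner_vec_def)
  then show ?thesis by (simp add: orthogonal_matrix_def matrix_left_right_inverse)
qed

lemma orthonormal_det:
  fixes E :: "'n::finite \<Rightarrow> real^'n"
  assumes "orthonormal E"
  shows "(det (\<chi> i. E i))\<^sup>2 = 1"
  using det_orthogonal_matrix[OF orthonormal_matrix[OF assms]] by auto

lemma orthonormal_expand:
  fixes E :: "'n::finite \<Rightarrow> real^'n"
  assumes "orthonormal E"
  shows "x = (\<Sum>i\<in>UNIV. (x \<bullet> E i) *\<^sub>R E i)"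
proof -
  have "Finite_Cartesian_Product.transpose (\<chi> i. E i) ** (\<chi> i. E i) = mat 1"
    using orthonormal_matrix[OF assms] by (simp add: orthogonal_matrix_def)
  then have "Finite_Cartesian_Product.transpose (\<chi> i. E i) *v ((\<chi> i. E i) *v x) = x"
    by (simp add: matrix_vector_mul_assoc)
  then show ?thesis
    by (simp add: vec_eq_iff matrix_vector_mult_def Finite_Cartesian_Product.transpose_def inner_vec_def mult_ac)
qed

lemma orthonormal_inner:
  fixes E :: "'n::finite \<Rightarrow> real^'n"
  assumes "orthonormal E"
  shows "x \<bullet> y = (\<Sum>i\<in>UNIV. (x \<bullet> E i) * (y \<bullet> E i))"
proof -
  have "x \<bullet> y = (\<Sum>i\<in>UNIV. (x \<bullet> E i) *\<^sub>R E i) \<bullet> y"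
    using orthonormal_expand[OF assms, of x] by simp
  also have "\<dots> = (\<Sum>i\<in>UNIV. (x \<bullet> E i) * (E i \<bullet> y))" by (simp add: inner_sum_left)
  finally show ?thesis by (simp add: inner_commute[of y])
qed

lemma orthonormal_extend3:
  fixes a b c :: vec7
  assumes "a \<bullet> a = 1" "b \<bullet> b = 1" "c \<bullet> c = 1" "a \<bullet> b = 0" "a \<bullet> c = 0" "b \<bullet> c = 0"
  obtains E :: "7 \<Rightarrow> vec7" where "orthonormal E" "E 1 = a" "E 2 = b" "E 3 = c"
proof -
  let ?T = "{a, b, c}"
  let ?S = "{x. \<forall>y\<in>?T. orthogonal y x}"
  have ne: "a \<noteq> b" "a \<noteq> c" "b \<noteq> c" "0 \<notin> ?T" using assms by auto
  have "pairwise orthogonal ?T"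
    using assms by (auto simp: pairwise_def orthogonal_def inner_commute)
  then have ind: "independent ?T" using ne(4) by (rule pairwise_orthogonal_independent)
  have "dim {a,b,c} = 3" using ind ne by (simp add: dim_eq_card_independent)
  moreover have "dim ?S + dim ?T = dim (UNIV :: vec7 set)"
  proof -
    have "{y \<in> UNIV. \<forall>x\<in>span ?T. orthogonal x y} = ?S"
    proof (intro set_eqI iffI)
      fix y assume "y \<in> {y \<in> UNIV. \<forall>x\<in>span ?T. orthogonal x y}"
      then show "y \<in> ?S" using span_base[of _ ?T] by blast
    next
      fix y assume y: "y \<in> ?S"
      have "orthogonal y x" if "x \<in> span ?T" for x
        using that by (rule orthogonal_to_span) (use y in \<open>auto simp: orthogonal_commute\<close>)
      then show "y \<in> {y \<in> UNIV. \<forall>x\<in>span ?T. orthogonal x y}" by (simp add: orthogonal_commute)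
    qed
    then show ?thesis using dim_subspace_orthogonal_to_vectors[of "span ?T" UNIV] by (simp only: dim_span) simp
  qed
  ultimately have dS: "dim ?S = 4" by simp
  have sS: "subspace ?S" by (rule subspace_orthogonal_to_vectors)
  obtain Bs where Bs: "Bs \<subseteq> ?S" "pairwise orthogonal Bs" "\<And>x. x \<in> Bs \<Longrightarrow> norm x = 1" "independent Bs" "card Bs = dim ?S" "span Bs = ?S"
    using orthonormal_basis_subspace[OF sS] by blast
  have "finite Bs" using Bs(4) by (rule independent_imp_finite)
  moreover have "card {4,5,6,7::7} = card Bs" using Bs(5) dS by simp
  ultimately obtain h where h: "bij_betw h {4,5,6,7::7} Bs"
    using finite_same_card_bij[of "{4,5,6,7::7}" Bs] by auto
  define E where "E i = (if i = 1 then a else if i = 2 then b else if i = 3 then c else h i)" for i :: 7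
  have hB: "h i \<in> Bs" if "i \<in> {4,5,6,7}" for i using h that by (auto simp: bij_betw_def)
  have hh: "h i \<bullet> h j = (if i = j then 1 else 0)" if "i \<in> {4,5,6,7}" "j \<in> {4,5,6,7}" for i j
  proof (cases "i = j")
    case True then show ?thesis using Bs(3)[OF hB[OF that(1)]] by (simp add: dot_square_norm)
  next
    case False
    then have "h i \<noteq> h j" using h that by (auto simp: bij_betw_def inj_on_def)
    then show ?thesis using Bs(2) hB[OF that(1)] hB[OF that(2)] False by (auto simp: pairwise_def orthogonal_def)
  qed
  have ho: "a \<bullet> h i = 0" "b \<bullet> h i = 0" "c \<bullet> h i = 0" if "i \<in> {4,5,6,7}" for i
    using hB[OF that] Bs(1) by (auto simp: orthogonal_def)
  have "E i \<bullet> E j = (if i = j then 1 else 0)" for i j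
    using exhaust_7[of i] exhaust_7[of j] assms hh[of i j] ho[of i] ho[of j]
    by (elim disjE) (simp_all add: E_def inner_commute distinct_7)
  then show thesis using that[of E] by (simp add: orthonormal_def E_def)
qed

lemma three_formD:
  assumes "three_form f"
  shows "f v u w = - f u v w" "f u w v = - f u v w" "linear (\<lambda>u. f u v w)" "linear (\<lambda>v. f u v w)" "linear (\<lambda>w. f u v w)"
proof -
  have alt1: "f v u w = - f u v w" for u v w using assms unfolding three_form_def by blast
  have alt2: "f u w v = - f u v w" for u v w using assms unfolding three_form_def by blast
  show "f v u w = - f u v w" "f u w v = - f u v w" by (rule alt1, rule alt2)
  have l: "linear (\<lambda>u. f u v w)" for v w using assms unfolding three_form_def by blast
  then show "linear (\<lambda>u. f u v w)" by this
  have l2: "linear (\<lambda>v. f u v w)" for u w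
    using linear_compose_neg[OF l[of u w]] by (subst alt1)
  then show "linear (\<lambda>v. f u v w)" by this
  show "linear (\<lambda>w. f u v w)"
    using linear_compose_neg[OF l2[of u v]] by (subst alt2)
qed

lemma three_form_expand:
  fixes E :: "7 \<Rightarrow> vec7"
  assumes f: "three_form f" and E: "orthonormal E"
  shows "f u v w = (\<Sum>i\<in>UNIV. \<Sum>j\<in>UNIV. \<Sum>k\<in>UNIV. (u \<bullet> E i) * (v \<bullet> E j) * (w \<bullet> E k) * f (E i) (E j) (E k))"
proof -
  note L = three_formD(3-5)[OF f]
  have 1: "f u v w = (\<Sum>i\<in>UNIV. (u \<bullet> E i) * f (E i) v w)" for u v w
  proof -
    have "f u v w = f (\<Sum>i\<in>UNIV. (u \<bullet> E i) *\<^sub>R E i) v w" using orthonormal_expand[OF E, of u] by simp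
    also have "\<dots> = (\<Sum>i\<in>UNIV. (u \<bullet> E i) * f (E i) v w)"
      by (simp add: linear_sum[OF L(1)] linear_cmul[OF L(1)])
    finally show ?thesis .
  qed
  have 2: "f u v w = (\<Sum>i\<in>UNIV. (v \<bullet> E i) * f u (E i) w)" for u v w
  proof -
    have "f u v w = - (\<Sum>i\<in>UNIV. (v \<bullet> E i) * f (E i) u w)"
      by (subst three_formD(1)[OF f]) (subst 1, rule refl)
    also have "\<dots> = - (\<Sum>i\<in>UNIV. (v \<bullet> E i) * - f u (E i) w)"
      by (intro arg_cong[where f = uminus] sum.cong refl) (subst three_formD(1)[OF f], rule refl)
    finally show ?thesis by (simp add: sum_negf)
  qed
  have 3: "f u v w = (\<Sum>i\<in>UNIV. (w \<bullet> E i) * f u v (E i))" for u v w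
  proof -
    have "f u v w = - (\<Sum>i\<in>UNIV. (w \<bullet> E i) * f u (E i) v)"
      by (subst three_formD(2)[OF f]) (subst 2, rule refl)
    also have "\<dots> = - (\<Sum>i\<in>UNIV. (w \<bullet> E i) * - f u v (E i))"
      by (intro arg_cong[where f = uminus] sum.cong refl) (subst three_formD(2)[OF f], rule refl)
    finally show ?thesis by (simp add: sum_negf)
  qed
  have "f u v w = (\<Sum>i\<in>UNIV. (u \<bullet> E i) * (\<Sum>j\<in>UNIV. (v \<bullet> E j) * (\<Sum>k\<in>UNIV. (w \<bullet> E k) * f (E i) (E j) (E k))))"
    by (subst 1, rule sum.cong[OF refl], subst 2, intro arg_cong2[where f = times] sum.cong refl, rule 3)
  then show ?thesis by (simp add: sum_distrib_left mult.assoc)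
qed

lemma orthonormal_axis: "orthonormal (\<lambda>i. axis i (1::real))"
  by (simp add: orthonormal_def inner_axis_axis)

text \<open>The metric relation at one point, after an orthonormal frame has identified the tangent
  space with the standard inner product space. The sign s is the value of the volume form on that
  frame, so frames of both orientations are covered.\<close>

locale g2_form =
  fixes f :: "vec7 \<Rightarrow> vec7 \<Rightarrow> vec7 \<Rightarrow> real" and s :: real
  assumes form: "three_form f" and s: "s\<^sup>2 = 1"
    and wedge: "wedge223 (f u) (f v) f E = - 6 * (u \<bullet> v) * (s * det (\<chi> i. E i))"
begin

lemma alt: "f v u w = - f u v w" "f u w v = - f u v w"
  by (rule three_formD[OF form])+

lemma alt0: "f u u w = 0" "f u w w = 0" "f u w u = 0"
  using alt(1)[of u u w] alt(2)[of u w w] alt(1)[of u w u] alt(2)[of w u u] by linarith+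

lemma cyc: "f v w u = f u v w"
  using alt(1)[of v u w] alt(2)[of v w u] by linarith

lemmas lin = three_formD(3-5)[OF form]

lemma wedge_frame:
  assumes "orthonormal E"
  shows "wedge_comp (\<lambda>i j. f (E p) (E i) (E j)) (\<lambda>i j. f (E q) (E i) (E j)) (\<lambda>i j k. f (E i) (E j) (E k))
    = - 6 * kron p q * (s * det (\<chi> i. E i))"
proof -
  have U: "set [5,6,7,1,2,3,4::7] = UNIV" unfolding UNIV_7 by auto
  have "perm_sum [5,6,7,1,2,3,4::7] (\<lambda>l. f (E p) (E (l!3)) (E (l!4)) * f (E q) (E (l!5)) (E (l!6)) * f (E (l!0)) (E (l!1)) (E (l!2)))
     = 24 * wedge_comp (\<lambda>i j. f (E p) (E i) (E j)) (\<lambda>i j. f (E q) (E i) (E j)) (\<lambda>i j k. f (E i) (E j) (E k))"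
    by (rule perm_sum_wedge_comp[of "\<lambda>i j. f (E p) (E i) (E j)" "\<lambda>i j. f (E q) (E i) (E j)" "\<lambda>i j k. f (E i) (E j) (E k)"]) (rule alt)+
  moreover have "perm_sum [5,6,7,1,2,3,4::7] (\<lambda>l. f (E p) (E (l!3)) (E (l!4)) * f (E q) (E (l!5)) (E (l!6)) * f (E (l!0)) (E (l!1)) (E (l!2)))
     = 24 * wedge223 (f (E p)) (f (E q)) f E"
    unfolding perm_sum_def U wedge223_def by (simp add: fact_numeral mult.assoc)
  ultimately show ?thesis using wedge[of "E p" "E q" E] orthonormalD[OF assms, of p q] by simp
qed

lemma nonzero: "\<exists>u v w. f u v w \<noteq> 0"
proof (rule ccontr)
  assume "\<not> ?thesis"
  then have "f = (\<lambda>u v w. 0)" by (auto simp: fun_eq_iff)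
  then have "wedge_comp (\<lambda>i j. f (axis 1 1) (axis i 1) (axis j 1)) (\<lambda>i j. f (axis 1 1) (axis i 1) (axis j 1)) (\<lambda>i j k. f (axis i 1) (axis j 1) (axis k 1)) = 0"
    by (simp add: wedge_comp_def wedge22_def)
  then show False
    using wedge_frame[OF orthonormal_axis, of 1 1] orthonormal_det[OF orthonormal_axis, where 'n = 7] s by auto
qed

text \<open>The product of three unit spheres is compact. The maximum is positive because f is
  nonzero and changes sign when two arguments are exchanged.\<close>

lemma max_triple:
  obtains a b c m where "m > 0" "norm a = 1" "norm b = 1" "norm c = 1" "f a b c = m"
    "\<And>u v w. norm u = 1 \<Longrightarrow> norm v = 1 \<Longrightarrow> norm w = 1 \<Longrightarrow> f u v w \<le> m"
proof -
  let ?K = "sphere (0::vec7) 1 \<times> sphere (0::vec7) 1 \<times> sphere (0::vec7) 1"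
  have "compact ?K" by (intro compact_Times compact_sphere)
  moreover have "?K \<noteq> {}" by simp
  moreover have "continuous_on ?K (\<lambda>(u, v, w). f u v w)"
  proof -
    have eq: "(\<lambda>(u, v, w). f u v w) = (\<lambda>(u, v, w). \<Sum>i\<in>UNIV. \<Sum>j\<in>UNIV. \<Sum>k\<in>UNIV.
        (u \<bullet> axis i 1) * (v \<bullet> axis j 1) * (w \<bullet> axis k 1) * f (axis i 1) (axis j 1) (axis k 1))"
      by (intro ext) (clarsimp, rule three_form_expand[OF form orthonormal_axis])
    show ?thesis unfolding eq case_prod_beta by (intro continuous_intros)
  qed
  ultimately obtain p where p: "p \<in> ?K" "\<And>q. q \<in> ?K \<Longrightarrow> (\<lambda>(u, v, w). f u v w) q \<le> (\<lambda>(u, v, w). f u v w) p"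
    using continuous_attains_sup[of ?K "\<lambda>(u, v, w). f u v w"] by blast
  obtain a b c where abc: "p = (a, b, c)" by (cases p)
  have max: "f u v w \<le> f a b c" if "norm u = 1" "norm v = 1" "norm w = 1" for u v w
    using p(2)[of "(u, v, w)"] that abc by simp
  obtain u v w where uvw: "f u v w > 0"
  proof -
    obtain u v w where "f u v w \<noteq> 0" using nonzero by blast
    then show thesis using that[of u v w] that[of v u w] alt(1)[of v u w] by linarith
  qed
  have ne: "u \<noteq> 0" "v \<noteq> 0" "w \<noteq> 0"
    using uvw linear_0[OF lin(1)[of v w]] linear_0[OF lin(2)[of u w]] linear_0[OF lin(3)[of u v]] by auto
  have "f (u /\<^sub>R norm u) (v /\<^sub>R norm v) (w /\<^sub>R norm w) = inverse (norm u) * (inverse (norm v) * (inverse (norm w) * f u v w))"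
    by (simp add: linear_cmul[OF lin(1)] linear_cmul[OF lin(2)] linear_cmul[OF lin(3)])
  then have "f (u /\<^sub>R norm u) (v /\<^sub>R norm v) (w /\<^sub>R norm w) > 0" using uvw ne by simp
  then have "f a b c > 0" using max[of "u /\<^sub>R norm u" "v /\<^sub>R norm v" "w /\<^sub>R norm w"] ne by simp
  then show thesis using that[of "f a b c" a b c] max p(1) abc by simp
qed

definition cross :: "vec7 \<Rightarrow> vec7 \<Rightarrow> vec7" where
  "cross u v = (\<chi> k. f u v (axis k 1))"

lemma cross_inner: "cross u v \<bullet> w = f u v w"
proof -
  have w: "w = (\<Sum>k\<in>UNIV. w $ k *\<^sub>R axis k 1)"
    using orthonormal_expand[OF orthonormal_axis, of w] by (simp add: inner_axis)
  have "f u v w = f u v (\<Sum>k\<in>UNIV. w $ k *\<^sub>R axis k 1)" by (rule arg_cong[OF w])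
  also have "\<dots> = cross u v \<bullet> w"
    by (simp add: linear_sum[OF lin(3)] linear_cmul[OF lin(3)] cross_def inner_vec_def mult.commute)
  finally show ?thesis by simp
qed

text \<open>The equality case of Cauchy-Schwarz: testing the maximum on the normalised cross product
  of a and b bounds its norm by m, while its inner product with the unit vector c is m. Hence it
  equals m c, which makes the components of f with only two indices from a maximal triple
  vanish.\<close>

lemma cross_max:
  assumes m: "m > 0" and c: "norm c = 1" "f a b c = m" and ab: "norm a = 1" "norm b = 1"
    and max: "\<And>u v w. norm u = 1 \<Longrightarrow> norm v = 1 \<Longrightarrow> norm w = 1 \<Longrightarrow> f u v w \<le> m"
  shows "f a b w = m * (c \<bullet> w)"
proof -
  let ?n = "cross a b"
  have nc: "?n \<bullet> c = m" using cross_inner c by simp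
  then have n0: "?n \<noteq> 0" using m by auto
  have "f a b (?n /\<^sub>R norm ?n) \<le> m" using max[OF ab] n0 by simp
  then have "norm ?n \<le> m" using n0 by (simp add: cross_inner[symmetric] dot_square_norm power2_eq_square field_simps)
  then have n2: "?n \<bullet> ?n \<le> m\<^sup>2" by (simp add: dot_square_norm power_mono)
  have cn: "c \<bullet> ?n = m" using nc by (simp only: inner_commute)
  have cc: "c \<bullet> c = 1" using c(1) by (simp add: dot_square_norm)
  have "(?n - m *\<^sub>R c) \<bullet> (?n - m *\<^sub>R c) = ?n \<bullet> ?n - m\<^sup>2"
    unfolding inner_diff_left inner_diff_right inner_scaleR_left inner_scaleR_right nc cn cc by (simp add: power2_eq_square)
  then have "(?n - m *\<^sub>R c) \<bullet> (?n - m *\<^sub>R c) \<le> 0" using n2 by simp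
  then have "?n = m *\<^sub>R c" by (metis eq_iff_diff_eq_0 inner_eq_zero_iff inner_ge_zero order_antisym)
  then show ?thesis using cross_inner[of a b w] by simp
qed

lemma adapted:
  assumes E: "orthonormal E" and m: "m > 0"
    and max: "\<And>w. f (E 1) (E 2) w = m * (E 3 \<bullet> w)" "\<And>w. f (E 2) (E 3) w = m * (E 1 \<bullet> w)" "\<And>w. f (E 3) (E 1) w = m * (E 2 \<bullet> w)"
  shows "adapted_form (\<lambda>i j k. f (E i) (E j) (E k)) m (s * det (\<chi> i. E i))"
proof
  show "f (E j) (E i) (E k) = - f (E i) (E j) (E k)" "f (E i) (E k) (E j) = - f (E i) (E j) (E k)" for i j k
    by (rule alt)+
  show "f (E 1) (E 2) (E 3) = m" using max(1) orthonormalD[OF E] by simp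
  show "k \<in> {4,5,6,7} \<Longrightarrow> f (E 1) (E 2) (E k) = 0" "k \<in> {4,5,6,7} \<Longrightarrow> f (E 1) (E 3) (E k) = 0" "k \<in> {4,5,6,7} \<Longrightarrow> f (E 2) (E 3) (E k) = 0" for k
    using max alt(1)[of "E 1" "E 3" "E k"] orthonormalD[OF E] by auto
  show "(s * det (\<chi> i. E i))\<^sup>2 = 1" using s orthonormal_det[OF E] by (simp add: power_mult_distrib)
qed (use wedge_frame[OF E] m in auto)

end

context g2_form
begin

lemma permutes3: "f v u w = - f u v w" "f u w v = - f u v w" "f v w u = f u v w" "f w u v = f u v w" "f w v u = - f u v w"
  using alt(1)[of v u w] alt(2)[of u w v] alt(1)[of w u v] alt(2)[of v w u] alt(1)[of w v u] alt(1)[of u w v] alt(2)[of v u w] alt(2)[of w u v] alt(1)[of v w u]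
  by linarith+

text \<open>A maximal triple a, b, c is completed arbitrarily, which already yields m = 1. The last
  three vectors are then replaced by the cross products of a, b, c with the fourth vector d. This
  normalises the row of d in each \<omega>_i, and duality determines the other entries.\<close>

lemma normal_form:
  obtains E where "orthonormal E" "s * det (\<chi> i. E i) = 1"
    "f (E 1) (E 2) (E 3) = 1" "f (E 1) (E 4) (E 5) = 1" "f (E 1) (E 6) (E 7) = - 1" "f (E 2) (E 4) (E 6) = 1"
    "f (E 2) (E 5) (E 7) = 1" "f (E 3) (E 4) (E 7) = 1" "f (E 3) (E 5) (E 6) = - 1"
    "f (E 1) (E 2) (E 4) = 0" "f (E 1) (E 2) (E 5) = 0" "f (E 1) (E 2) (E 6) = 0" "f (E 1) (E 2) (E 7) = 0"
    "f (E 1) (E 3) (E 4) = 0" "f (E 1) (E 3) (E 5) = 0" "f (E 1) (E 3) (E 6) = 0" "f (E 1) (E 3) (E 7) = 0"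
    "f (E 2) (E 3) (E 4) = 0" "f (E 2) (E 3) (E 5) = 0" "f (E 2) (E 3) (E 6) = 0" "f (E 2) (E 3) (E 7) = 0"
    "f (E 1) (E 4) (E 6) = 0" "f (E 1) (E 4) (E 7) = 0" "f (E 1) (E 5) (E 6) = 0" "f (E 1) (E 5) (E 7) = 0"
    "f (E 2) (E 4) (E 5) = 0" "f (E 2) (E 4) (E 7) = 0" "f (E 2) (E 5) (E 6) = 0" "f (E 2) (E 6) (E 7) = 0"
    "f (E 3) (E 4) (E 5) = 0" "f (E 3) (E 4) (E 6) = 0" "f (E 3) (E 5) (E 7) = 0" "f (E 3) (E 6) (E 7) = 0"
    "f (E 4) (E 5) (E 6) = 0" "f (E 4) (E 5) (E 7) = 0" "f (E 4) (E 6) (E 7) = 0" "f (E 5) (E 6) (E 7) = 0"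
proof (rule max_triple)
  fix a b c :: vec7 and m :: real
  assume m: "m > 0" and n: "norm a = 1" "norm b = 1" "norm c = 1" and fm: "f a b c = m"
    and max: "\<And>u v w. norm u = 1 \<Longrightarrow> norm v = 1 \<Longrightarrow> norm w = 1 \<Longrightarrow> f u v w \<le> m"
  have ab: "f a b w = m * (c \<bullet> w)" for w by (rule cross_max[OF m n(3) fm n(1,2) max])
  have bc: "f b c w = m * (a \<bullet> w)" for w by (rule cross_max[OF m n(1) _ n(2,3) max]) (simp_all add: cyc fm)
  have ca: "f c a w = m * (b \<bullet> w)" for w by (rule cross_max[OF m n(2) _ n(3,1) max]) (simp_all add: cyc fm cyc[of a b c, symmetric])
  have orth: "a \<bullet> b = 0" "a \<bullet> c = 0" "b \<bullet> c = 0"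
    using bc[of b] bc[of c] ca[of c] m by (simp_all add: alt0)
  have unit: "a \<bullet> a = 1" "b \<bullet> b = 1" "c \<bullet> c = 1" using n by (simp_all add: dot_square_norm)
  obtain E0 :: "7 \<Rightarrow> vec7" where E0: "orthonormal E0" "E0 1 = a" "E0 2 = b" "E0 3 = c"
    using orthonormal_extend3[OF unit orth] by metis
  let ?c0 = "\<lambda>i j k. f (E0 i) (E0 j) (E0 k)"
  interpret A0: adapted_form ?c0 m "s * det (\<chi> i. E0 i)"
    by (rule adapted[OF E0(1) m]) (simp_all add: E0 ab bc ca)
  have m1: "m = 1" by (rule A0.m_eq_1)
  define d where "d = E0 4"
  have coord: "cross (E0 i) d \<bullet> E0 k = ?c0 i 4 k" for i k by (simp add: cross_inner d_def)
  have inn: "cross (E0 i) d \<bullet> cross (E0 j) d = (\<Sum>k\<in>UNIV. ?c0 i 4 k * ?c0 j 4 k)" for i j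
    using orthonormal_inner[OF E0(1), of "cross (E0 i) d" "cross (E0 j) d"] by (simp add: coord)
  have c4: "?c0 i 4 1 = 0" "?c0 i 4 2 = 0" "?c0 i 4 3 = 0" "?c0 i 4 4 = 0" if "i \<in> {1,2,3}" for i
    using that by (auto simp: A0.zeros A0.alts A0.alt0)
  have nn: "cross (E0 i) d \<bullet> cross (E0 i) d = 1" if "i \<in> {1,2,3}" for i
    using A0.norms[OF that] unfolding inn by (simp add: sum_7 c4[OF that] m1 power2_eq_square)
  have no: "cross (E0 i) d \<bullet> cross (E0 j) d = 0" if "(i, j) \<in> {(1,2),(1,3),(2,3)}" for i j
  proof -
    have i: "i \<in> {1,2,3}" "j \<in> {1,2,3}" using that by auto
    \<comment> \<open>Duality expresses the entries with indices 56, 57, 67 through those in the row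
      of 4, which turns the polarised Pfaffian into an inner product.\<close>
    have "?c0 i 4 5 * ?c0 j 4 5 + ?c0 i 4 6 * ?c0 j 4 6 + ?c0 i 4 7 * ?c0 j 4 7 = 0"
      using A0.pf_polar[OF that] A0.sigma A0.self_dual(4-6)[OF i(1)] A0.self_dual(4-6)[OF i(2)] by algebra
    then show ?thesis unfolding inn by (simp add: sum_7 c4[OF i(1)])
  qed
  define E where "E i = (if i = 5 then cross a d else if i = 6 then cross b d else if i = 7 then cross c d else E0 i)" for i :: 7
  have Ev: "E 1 = a" "E 2 = b" "E 3 = c" "E 4 = d" "E 5 = cross a d" "E 6 = cross b d" "E 7 = cross c d"
    by (simp_all add: E_def d_def E0)
  have co: "cross x d \<bullet> y = 0" if "x \<in> {a,b,c}" "y \<in> {a,b,c,d}" for x y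
    using that c4[of 1] c4[of 2] c4[of 3] by (auto simp: cross_inner E0 d_def)
  have d: "d \<bullet> d = 1" "d \<bullet> a = 0" "d \<bullet> b = 0" "d \<bullet> c = 0"
    using orthonormalD[OF E0(1), of 4 4] orthonormalD[OF E0(1), of 4 1] orthonormalD[OF E0(1), of 4 2] orthonormalD[OF E0(1), of 4 3]
    by (simp_all add: d_def E0)
  have nn': "cross a d \<bullet> cross a d = 1" "cross b d \<bullet> cross b d = 1" "cross c d \<bullet> cross c d = 1"
    and no': "cross a d \<bullet> cross b d = 0" "cross a d \<bullet> cross c d = 0" "cross b d \<bullet> cross c d = 0"
    using nn[of 1] nn[of 2] nn[of 3] no[of 1 2] no[of 1 3] no[of 2 3] by (simp_all add: E0)
  have co': "cross a d \<bullet> a = 0" "cross a d \<bullet> b = 0" "cross a d \<bullet> c = 0" "cross a d \<bullet> d = 0"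
     "cross b d \<bullet> a = 0" "cross b d \<bullet> b = 0" "cross b d \<bullet> c = 0" "cross b d \<bullet> d = 0"
     "cross c d \<bullet> a = 0" "cross c d \<bullet> b = 0" "cross c d \<bullet> c = 0" "cross c d \<bullet> d = 0"
    by (rule co; simp)+
  note zero = d(2-4) orth no' co'
  note zero' = zero zero[THEN trans[OF inner_commute]]
  have E: "orthonormal E"
  proof -
    have "E i \<bullet> E j = (if i = j then 1 else 0)" for i j
      using exhaust_7[of i] exhaust_7[of j]
      by (elim disjE) (simp_all only: Ev zero' nn' d unit distinct_7 if_True if_False simp_thms)
    then show ?thesis by (simp add: orthonormal_def)
  qed
  let ?c = "\<lambda>i j k. f (E i) (E j) (E k)"
  interpret A: adapted_form ?c m "s * det (\<chi> i. E i)"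
    by (rule adapted[OF E m]) (simp_all add: Ev ab bc ca)
  have v: "?c 1 4 k = E 5 \<bullet> E k" "?c 2 4 k = E 6 \<bullet> E k" "?c 3 4 k = E 7 \<bullet> E k" for k
    by (simp_all add: Ev cross_inner)
  have vals: "?c 1 4 5 = 1" "?c 1 4 6 = 0" "?c 1 4 7 = 0" "?c 2 4 5 = 0" "?c 2 4 6 = 1" "?c 2 4 7 = 0"
      "?c 3 4 5 = 0" "?c 3 4 6 = 0" "?c 3 4 7 = 1"
    unfolding v by (simp_all add: orthonormalD[OF E])
  \<comment> \<open>On the normalised entries this diagonal entry is 1, which fixes the orientation
    of the frame.\<close>
  have "(A.A 1 ** A.B 2 ** A.A 3) $ 1 $ 1 = s * det (\<chi> i. E i)"
    unfolding A.triple by (simp add: mat_def)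
  then have sd: "s * det (\<chi> i. E i) = 1"
    by (simp add: A.A_def A.B_def skew4_mult vals A.self_dual)
  show thesis
    by (rule that[OF E sd]) (simp_all add: vals A.self_dual(4-6) sd A.zeros A.rho A.m(1) m1)
qed

text \<open>In the normal form this is a polynomial identity in the coordinates of u and v: the
  multiplicativity of the octonion norm, restricted to imaginary octonions.\<close>

lemma norm_cross: "cross u v \<bullet> cross u v = (u \<bullet> u) * (v \<bullet> v) - (u \<bullet> v)\<^sup>2"
proof (rule normal_form)
  fix E :: "7 \<Rightarrow> vec7"
  let ?c = "\<lambda>i j k. f (E i) (E j) (E k)"
  assume E: "orthonormal E"
    and vals: "?c 1 2 3 = 1" "?c 1 4 5 = 1" "?c 1 6 7 = - 1" "?c 2 4 6 = 1"
    "?c 2 5 7 = 1" "?c 3 4 7 = 1" "?c 3 5 6 = - 1"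
    "?c 1 2 4 = 0" "?c 1 2 5 = 0" "?c 1 2 6 = 0" "?c 1 2 7 = 0"
    "?c 1 3 4 = 0" "?c 1 3 5 = 0" "?c 1 3 6 = 0" "?c 1 3 7 = 0"
    "?c 2 3 4 = 0" "?c 2 3 5 = 0" "?c 2 3 6 = 0" "?c 2 3 7 = 0"
    "?c 1 4 6 = 0" "?c 1 4 7 = 0" "?c 1 5 6 = 0" "?c 1 5 7 = 0"
    "?c 2 4 5 = 0" "?c 2 4 7 = 0" "?c 2 5 6 = 0" "?c 2 6 7 = 0"
    "?c 3 4 5 = 0" "?c 3 4 6 = 0" "?c 3 5 7 = 0" "?c 3 6 7 = 0"
    "?c 4 5 6 = 0" "?c 4 5 7 = 0" "?c 4 6 7 = 0" "?c 5 6 7 = 0"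
  note alts = permutes3[where u = "E 1" and v = "E 2" and w = "E 3"] permutes3[where u = "E 1" and v = "E 2" and w = "E 4"] permutes3[where u = "E 1" and v = "E 2" and w = "E 5"]
    permutes3[where u = "E 1" and v = "E 2" and w = "E 6"] permutes3[where u = "E 1" and v = "E 2" and w = "E 7"] permutes3[where u = "E 1" and v = "E 3" and w = "E 4"]
    permutes3[where u = "E 1" and v = "E 3" and w = "E 5"] permutes3[where u = "E 1" and v = "E 3" and w = "E 6"] permutes3[where u = "E 1" and v = "E 3" and w = "E 7"]
    permutes3[where u = "E 1" and v = "E 4" and w = "E 5"] permutes3[where u = "E 1" and v = "E 4" and w = "E 6"] permutes3[where u = "E 1" and v = "E 4" and w = "E 7"]
    permutes3[where u = "E 1" and v = "E 5" and w = "E 6"] permutes3[where u = "E 1" and v = "E 5" and w = "E 7"] permutes3[where u = "E 1" and v = "E 6" and w = "E 7"]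
    permutes3[where u = "E 2" and v = "E 3" and w = "E 4"] permutes3[where u = "E 2" and v = "E 3" and w = "E 5"] permutes3[where u = "E 2" and v = "E 3" and w = "E 6"]
    permutes3[where u = "E 2" and v = "E 3" and w = "E 7"] permutes3[where u = "E 2" and v = "E 4" and w = "E 5"] permutes3[where u = "E 2" and v = "E 4" and w = "E 6"]
    permutes3[where u = "E 2" and v = "E 4" and w = "E 7"] permutes3[where u = "E 2" and v = "E 5" and w = "E 6"] permutes3[where u = "E 2" and v = "E 5" and w = "E 7"]
    permutes3[where u = "E 2" and v = "E 6" and w = "E 7"] permutes3[where u = "E 3" and v = "E 4" and w = "E 5"] permutes3[where u = "E 3" and v = "E 4" and w = "E 6"]
    permutes3[where u = "E 3" and v = "E 4" and w = "E 7"] permutes3[where u = "E 3" and v = "E 5" and w = "E 6"] permutes3[where u = "E 3" and v = "E 5" and w = "E 7"]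
    permutes3[where u = "E 3" and v = "E 6" and w = "E 7"] permutes3[where u = "E 4" and v = "E 5" and w = "E 6"] permutes3[where u = "E 4" and v = "E 5" and w = "E 7"]
    permutes3[where u = "E 4" and v = "E 6" and w = "E 7"] permutes3[where u = "E 5" and v = "E 6" and w = "E 7"]
  have co: "cross u v \<bullet> E k = (\<Sum>i\<in>UNIV. \<Sum>j\<in>UNIV. (u \<bullet> E i) * (v \<bullet> E j) * ?c i j k)" for k
  proof -
    have "cross u v \<bullet> E k = (\<Sum>i\<in>UNIV. \<Sum>j\<in>UNIV. \<Sum>l\<in>UNIV. (u \<bullet> E i) * (v \<bullet> E j) * (E k \<bullet> E l) * ?c i j l)"
      unfolding cross_inner by (rule three_form_expand[OF form E])
    then show ?thesis by (simp add: orthonormalD[OF E] if_distrib[of "\<lambda>x. x * _"] if_distrib[of "\<lambda>x. _ * x"] sum.delta cong: if_cong)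
  qed
  define a b where "a i = u \<bullet> E i" and "b i = v \<bullet> E i" for i
  have n: "u \<bullet> u = (\<Sum>i\<in>UNIV. a i * a i)" "v \<bullet> v = (\<Sum>i\<in>UNIV. b i * b i)" "u \<bullet> v = (\<Sum>i\<in>UNIV. a i * b i)"
    unfolding a_def b_def by (rule orthonormal_inner[OF E])+
  have "cross u v \<bullet> cross u v = (\<Sum>k\<in>UNIV. (\<Sum>i\<in>UNIV. \<Sum>j\<in>UNIV. a i * b j * ?c i j k) * (\<Sum>i\<in>UNIV. \<Sum>j\<in>UNIV. a i * b j * ?c i j k))"
    unfolding orthonormal_inner[OF E, of "cross u v" "cross u v"] co a_def b_def by (rule refl)
  also have "\<dots> = (u \<bullet> u) * (v \<bullet> v) - (u \<bullet> v)\<^sup>2"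
    unfolding n sum_7
    apply (simp only: alts vals alt0 mult_zero_right add_0_left add_0_right mult_1_right mult_minus_right minus_zero minus_minus)
    by algebra
  finally show ?thesis .
qed

end

section \<open>The Hodge dual 4-form\<close>

lemma sum_mult_kron:
  fixes F :: "'n::finite \<Rightarrow> real"
  shows "(\<Sum>j\<in>UNIV. F j * (if i = j then 1 else 0)) = F i" "(\<Sum>j\<in>UNIV. F j * (if j = i then 1 else 0)) = F i"
    "(\<Sum>j\<in>UNIV. (if i = j then 1 else 0) * F j) = F i" "(\<Sum>j\<in>UNIV. (if j = i then 1 else 0) * F j) = F i"
  by (simp_all add: if_distrib[of "\<lambda>x. _ * x"] if_distrib[of "\<lambda>x. x * _"] cong: if_cong)

lemma vector_7:
  fixes a b c d e f g :: "'a::zero"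
  shows "(vector [a,b,c,d,e,f,g] :: 'a^7) $ 1 = a" "(vector [a,b,c,d,e,f,g] :: 'a^7) $ 2 = b"
    "(vector [a,b,c,d,e,f,g] :: 'a^7) $ 3 = c" "(vector [a,b,c,d,e,f,g] :: 'a^7) $ 4 = d"
    "(vector [a,b,c,d,e,f,g] :: 'a^7) $ 5 = e" "(vector [a,b,c,d,e,f,g] :: 'a^7) $ 6 = f"
    "(vector [a,b,c,d,e,f,g] :: 'a^7) $ 7 = g"
  by (simp_all add: vector_def)

text \<open>A map on indices given by its seven values. It translates between permutations, over
  which determinants and wedge products are summed, and tuples of tensor indices.\<close>

definition tuple :: "7 \<Rightarrow> 7 \<Rightarrow> 7 \<Rightarrow> 7 \<Rightarrow> 7 \<Rightarrow> 7 \<Rightarrow> 7 \<Rightarrow> 7 \<Rightarrow> 7" where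
  "tuple a b c d e f g = ($) (vector [a,b,c,d,e,f,g])"

lemma tuple_nth:
  "tuple a b c d e f g 1 = a" "tuple a b c d e f g 2 = b" "tuple a b c d e f g 3 = c" "tuple a b c d e f g 4 = d"
  "tuple a b c d e f g 5 = e" "tuple a b c d e f g 6 = f" "tuple a b c d e f g 7 = g"
  by (simp_all add: tuple_def vector_7)

lemma tuple_eta: "tuple (p 1) (p 2) (p 3) (p 4) (p 5) (p 6) (p 7) = p"
proof
  show "tuple (p 1) (p 2) (p 3) (p 4) (p 5) (p 6) (p 7) x = p x" for x
    using exhaust_7[of x] by (elim disjE) (simp_all only: tuple_nth)
qed

lemma tuple_permutes:
  assumes "distinct [a,b,c,d,e,f,g]"
  shows "tuple a b c d e f g permutes UNIV"
proof -
  have "a \<noteq> b" "a \<noteq> c" "a \<noteq> d" "a \<noteq> e" "a \<noteq> f" "a \<noteq> g" "b \<noteq> c" "b \<noteq> d" "b \<noteq> e" "b \<noteq> f" "b \<noteq> g"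
     "c \<noteq> d" "c \<noteq> e" "c \<noteq> f" "c \<noteq> g" "d \<noteq> e" "d \<noteq> f" "d \<noteq> g" "e \<noteq> f" "e \<noteq> g" "f \<noteq> g"
    using assms by auto
  note ne = this this[symmetric]
  have "x = y" if "tuple a b c d e f g x = tuple a b c d e f g y" for x y
    using that exhaust_7[of x] exhaust_7[of y]
    by (elim disjE) (simp_all only: tuple_nth ne)
  then have "inj (tuple a b c d e f g)" by (auto simp: inj_on_def)
  then show ?thesis by (simp add: permutes_def finite_UNIV_inj_surj bij_def bij_iff[symmetric])
qed

lemma permutes_distinct:
  assumes "p permutes (UNIV :: 7 set)"
  shows "distinct [p 1, p 2, p 3, p 4, p 5, p 6, p 7]"
  using permutes_inj[OF assms] by (simp add: inj_eq)

lemma sum_permutes_tuple: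
  fixes H :: "7 \<Rightarrow> 7 \<Rightarrow> 7 \<Rightarrow> 7 \<Rightarrow> 7 \<Rightarrow> 7 \<Rightarrow> 7 \<Rightarrow> real"
  shows "(\<Sum>p | p permutes UNIV. H (p 1) (p 2) (p 3) (p 4) (p 5) (p 6) (p 7))
    = (\<Sum>a\<in>UNIV. \<Sum>b\<in>UNIV. \<Sum>c\<in>UNIV. \<Sum>d\<in>UNIV. \<Sum>e\<in>UNIV. \<Sum>f\<in>UNIV. \<Sum>g\<in>UNIV.
        if distinct [a,b,c,d,e,f,g] then H a b c d e f g else 0)"
proof -
  have "(\<Sum>a\<in>UNIV. \<Sum>b\<in>UNIV. \<Sum>c\<in>UNIV. \<Sum>d\<in>UNIV. \<Sum>e\<in>UNIV. \<Sum>f\<in>UNIV. \<Sum>g\<in>UNIV.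
        if distinct [a,b,c,d,e,f,g] then H a b c d e f g else 0)
    = (\<Sum>(a,b,c,d,e,f,g)\<in>UNIV. if distinct [a,b,c,d,e,f,g] then H a b c d e f g else 0)"
    unfolding sum.cartesian_product UNIV_Times_UNIV case_prod_beta by simp
  also have "\<dots> = (\<Sum>(a,b,c,d,e,f,g) | distinct [a,b,c,d,e,f,g]. H a b c d e f g)"
    by (rule sum.mono_neutral_cong_right) auto
  also have "\<dots> = (\<Sum>p | p permutes UNIV. H (p 1) (p 2) (p 3) (p 4) (p 5) (p 6) (p 7))"
    by (rule sum.reindex_bij_witness[where i = "\<lambda>p. (p 1, p 2, p 3, p 4, p 5, p 6, p 7)"
          and j = "\<lambda>(a,b,c,d,e,f,g). tuple a b c d e f g"])
      (use permutes_distinct tuple_permutes in \<open>auto simp: tuple_nth tuple_eta simp del: distinct.simps\<close>)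
  finally show ?thesis by simp
qed

lemma sum_distinct_Cons:
  fixes c :: real and xs :: "7 list"
  shows "(\<Sum>x\<in>UNIV. if distinct (x # xs) then c else 0) = (if distinct xs then (7 - real (length xs)) * c else 0)"
proof (cases "distinct xs")
  case True
  have "(\<Sum>x\<in>UNIV. if distinct (x # xs) then c else 0) = (\<Sum>x\<in>UNIV - set xs. c)"
    using True by (intro sum.mono_neutral_cong_right) auto
  moreover have "card (UNIV - set xs) = 7 - length xs" using True by (simp add: card_Diff_subset distinct_card)
  moreover have "length xs \<le> 7" using True card_mono[of UNIV "set xs"] by (simp add: distinct_card)
  ultimately show ?thesis using True by (simp add: of_nat_diff)
qed simp

lemma sum_distinct_three:
  fixes h :: real and d e f g :: 7
  shows "(\<Sum>a\<in>UNIV. \<Sum>b\<in>UNIV. \<Sum>c\<in>UNIV. if distinct [a,b,c,d,e,f,g] then h else 0)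
     = (if distinct [d,e,f,g] then 6 * h else 0)"
proof -
  have "(\<Sum>c\<in>UNIV. if distinct [a,b,c,d,e,f,g] then h else 0) = (if distinct [a,b,d,e,f,g] then h else 0)" for a b
  proof -
    have "distinct [a,b,c,d,e,f,g] = distinct (c # [a,b,d,e,f,g])" for c by auto
    then show ?thesis by (simp only: sum_distinct_Cons) simp
  qed
  moreover have "(\<Sum>b\<in>UNIV. if distinct [a,b,d,e,f,g] then h else 0) = (if distinct [a,d,e,f,g] then 2 * h else 0)" for a
  proof -
    have "distinct [a,b,d,e,f,g] = distinct (b # [a,d,e,f,g])" for b by auto
    then show ?thesis by (simp only: sum_distinct_Cons) simp
  qed
  ultimately show ?thesis by (simp only: sum_distinct_Cons) simp
qed

text \<open>Four distinct values leave 3! = 6 ways to fill the first three positions; in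
  \<open>sum_permutes_first3\<close> the other four positions give 4! = 24.\<close>

lemma sum_permutes_last4:
  fixes H :: "7 \<Rightarrow> 7 \<Rightarrow> 7 \<Rightarrow> 7 \<Rightarrow> real"
  shows "(\<Sum>p | p permutes UNIV. H (p 4) (p 5) (p 6) (p 7))
    = 6 * (\<Sum>d\<in>UNIV. \<Sum>e\<in>UNIV. \<Sum>f\<in>UNIV. \<Sum>g\<in>UNIV. if distinct [d,e,f,g] then H d e f g else 0)"
proof -
  note inner = sum_distinct_three
  have "(\<Sum>p | p permutes UNIV. H (p 4) (p 5) (p 6) (p 7)) = (\<Sum>a\<in>UNIV. \<Sum>b\<in>UNIV. \<Sum>c\<in>UNIV. \<Sum>d\<in>UNIV. \<Sum>e\<in>UNIV. \<Sum>f\<in>UNIV. \<Sum>g\<in>UNIV.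
        if distinct [a,b,c,d,e,f,g] then H d e f g else 0)"
    by (rule sum_permutes_tuple)
  also have "\<dots> = (\<Sum>(d,e,f,g)\<in>UNIV. \<Sum>a\<in>UNIV. \<Sum>b\<in>UNIV. \<Sum>c\<in>UNIV. if distinct [a,b,c,d,e,f,g] then H d e f g else 0)"
    (is "?L = ?R")
  proof -
    have "?L = (\<Sum>a\<in>UNIV. \<Sum>b\<in>UNIV. \<Sum>c\<in>UNIV. \<Sum>(d,e,f,g)\<in>UNIV. if distinct [a,b,c,d,e,f,g] then H d e f g else 0)"
      unfolding sum.cartesian_product UNIV_Times_UNIV case_prod_beta by simp
    also have "\<dots> = (\<Sum>a\<in>UNIV. \<Sum>b\<in>UNIV. \<Sum>(d,e,f,g)\<in>UNIV. \<Sum>c\<in>UNIV. if distinct [a,b,c,d,e,f,g] then H d e f g else 0)"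
      unfolding case_prod_beta by (intro sum.cong refl sum.swap)
    also have "\<dots> = (\<Sum>a\<in>UNIV. \<Sum>(d,e,f,g)\<in>UNIV. \<Sum>b\<in>UNIV. \<Sum>c\<in>UNIV. if distinct [a,b,c,d,e,f,g] then H d e f g else 0)"
      unfolding case_prod_beta by (intro sum.cong refl sum.swap)
    also have "\<dots> = ?R"
      unfolding case_prod_beta by (intro sum.cong refl sum.swap)
    finally show ?thesis .
  qed
  also have "\<dots> = (\<Sum>(d,e,f,g)\<in>UNIV. if distinct [d,e,f,g] then 6 * H d e f g else 0)"
    unfolding inner by (rule refl)
  also have "\<dots> = 6 * (\<Sum>d\<in>UNIV. \<Sum>e\<in>UNIV. \<Sum>f\<in>UNIV. \<Sum>g\<in>UNIV. if distinct [d,e,f,g] then H d e f g else 0)"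
    unfolding sum.cartesian_product UNIV_Times_UNIV case_prod_beta sum_distrib_left
    by (intro sum.cong refl) simp
  finally show ?thesis .
qed

lemma sum_permutes_first3:
  fixes H :: "7 \<Rightarrow> 7 \<Rightarrow> 7 \<Rightarrow> real"
  shows "(\<Sum>p | p permutes UNIV. H (p 1) (p 2) (p 3))
    = 24 * (\<Sum>a\<in>UNIV. \<Sum>b\<in>UNIV. \<Sum>c\<in>UNIV. if distinct [a,b,c] then H a b c else 0)"
proof -
  have "(\<Sum>d\<in>UNIV. \<Sum>e\<in>UNIV. \<Sum>f\<in>UNIV. \<Sum>g\<in>UNIV. if distinct [a,b,c,d,e,f,g] then H a b c else 0)
     = 24 * (if distinct [a,b,c] then H a b c else 0)" for a b c
  proof -
    have 1: "(\<Sum>g\<in>UNIV. if distinct [a,b,c,d,e,f,g] then H a b c else 0) = (if distinct [a,b,c,d,e,f] then H a b c else 0)" for d e f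
    proof -
      have "distinct [a,b,c,d,e,f,g] = distinct (g # [a,b,c,d,e,f])" for g by auto
      then show ?thesis by (simp only: sum_distinct_Cons) simp
    qed
    have 2: "(\<Sum>f\<in>UNIV. if distinct [a,b,c,d,e,f] then H a b c else 0) = (if distinct [a,b,c,d,e] then 2 * H a b c else 0)" for d e
    proof -
      have "distinct [a,b,c,d,e,f] = distinct (f # [a,b,c,d,e])" for f by auto
      then show ?thesis by (simp only: sum_distinct_Cons) simp
    qed
    have 3: "(\<Sum>e\<in>UNIV. if distinct [a,b,c,d,e] then 2 * H a b c else 0) = (if distinct [a,b,c,d] then 6 * H a b c else 0)" for d
    proof -
      have "distinct [a,b,c,d,e] = distinct (e # [a,b,c,d])" for e by auto
      then show ?thesis by (simp only: sum_distinct_Cons) simp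
    qed
    have 4: "(\<Sum>d\<in>UNIV. if distinct [a,b,c,d] then 6 * H a b c else 0) = (if distinct [a,b,c] then 24 * H a b c else 0)"
    proof -
      have "distinct [a,b,c,d] = distinct (d # [a,b,c])" for d by auto
      then show ?thesis by (simp only: sum_distinct_Cons) simp
    qed
    show ?thesis unfolding 1 2 3 4 by simp
  qed
  note inner = this
  show ?thesis
    unfolding sum_permutes_tuple[of "\<lambda>a b c d e f g. H a b c"] inner sum_distrib_left by (rule refl)
qed

text \<open>The shift by 4 rearranges 1, ..., 7 into 5, 6, 7, 1, 2, 3, 4, the order of the slots in
  \<open>perm_sum_wedge_comp\<close>. It is the square of the shift by 2 and hence even.\<close>

lemma sign_shift:
  "of_int (sign (\<lambda>n::7. n + 4)) = (1::real)" "(\<lambda>n::7. n + 4) permutes UNIV"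
proof -
  have p: "(\<lambda>n::7. n + 2) permutes UNIV" "(\<lambda>n::7. n + 4) permutes UNIV"
    by (auto simp: permutes_def intro: exI[of _ "_ - 2"] exI[of _ "_ - 4"] ex1I[of _ "_ - 2"] ex1I[of _ "_ - 4"])
  have "(\<lambda>n::7. n + 4) = (\<lambda>n. n + 2) \<circ> (\<lambda>n. n + 2)" by (auto simp: fun_eq_iff)
  then have "sign (\<lambda>n::7. n + 4) = sign (\<lambda>n::7. n + 2) * sign (\<lambda>n::7. n + 2)"
    using sign_compose[of "\<lambda>n::7. n + 2" "\<lambda>n::7. n + 2"] permutes_imp_permutation[OF _ p(1)] by simp
  then show "of_int (sign (\<lambda>n::7. n + 4)) = (1::real)" by (simp add: sign_def)
  show "(\<lambda>n::7. n + 4) permutes UNIV" by (rule p(2))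
qed

lemma det_axis_permutes:
  assumes "p permutes (UNIV::'n::finite set)"
  shows "det (\<chi> i. (axis (p i) 1 :: real^'n)) = of_int (sign p)"
proof -
  have "(\<chi> i. (axis (p i) 1 :: real^'n)) = (\<chi> i. (mat 1 :: real^'n^'n) $ p i)"
    by (simp add: vec_eq_iff mat_def axis_def)
  then show ?thesis using det_permute_rows[OF assms, of "mat 1 :: real^'n^'n"] by simp
qed

lemma det_axis_not_inj:
  assumes "p i = p j" "i \<noteq> (j::'n::finite)"
  shows "det (\<chi> i. (axis (p i) 1 :: real^'n)) = 0"
  by (rule det_identical_rows[OF assms(2)]) (simp add: row_def assms)

context g2_form
begin

definition F :: "7 \<Rightarrow> 7 \<Rightarrow> 7 \<Rightarrow> real" where
  "F i j k = f (axis i 1) (axis j 1) (axis k 1)"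

lemma F_perm: "F j i k = - F i j k" "F i k j = - F i j k" "F j k i = F i j k" "F k i j = F i j k" "F k j i = - F i j k"
  unfolding F_def by (rule permutes3)+

lemma F_zero: "F i i k = 0" "F i k k = 0" "F i k i = 0"
  unfolding F_def by (rule alt0)+

text \<open>The tensor that the contraction identity predicts for \<psi>. That it is alternating,
  and that it is the Hodge dual, is \<open>Psi_perm\<close> and \<open>Psi_star\<close>.\<close>

definition Psi :: "7 \<Rightarrow> 7 \<Rightarrow> 7 \<Rightarrow> 7 \<Rightarrow> real" where
  "Psi i j a b = kron i a * kron j b - kron i b * kron j a - (\<Sum>k\<in>UNIV. F i j k * F a b k)"

text \<open>\<open>norm_cross\<close> polarised twice, in the second factor and then in the
  first.\<close>

lemma inner_cross: "cross u v \<bullet> cross w x + cross w v \<bullet> cross u x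
   = 2 * (u \<bullet> w) * (v \<bullet> x) - (u \<bullet> v) * (w \<bullet> x) - (w \<bullet> v) * (u \<bullet> x)"
proof -
  have cl: "cross (u + w) v = cross u v + cross w v" for u w v
    unfolding cross_def vec_eq_iff by (simp add: linear_add[OF lin(1)])
  have cr: "cross u (v + w) = cross u v + cross u w" for u w v
    unfolding cross_def vec_eq_iff by (simp add: linear_add[OF lin(2)])
  have 1: "cross u v \<bullet> cross u x = (u \<bullet> u) * (v \<bullet> x) - (u \<bullet> v) * (u \<bullet> x)" for u v x
  proof -
    have "cross u (v + x) \<bullet> cross u (v + x) = cross u v \<bullet> cross u v + 2 * (cross u v \<bullet> cross u x) + cross u x \<bullet> cross u x"
      unfolding cr inner_add_left inner_add_right by (simp add: inner_commute)
    moreover have "(v + x) \<bullet> (v + x) = v \<bullet> v + 2 * (v \<bullet> x) + x \<bullet> x" "u \<bullet> (v + x) = u \<bullet> v + u \<bullet> x"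
      unfolding inner_add_left inner_add_right by (simp_all add: inner_commute)
    ultimately show ?thesis unfolding norm_cross by (simp add: power2_eq_square algebra_simps)
  qed
  have "cross (u + w) v \<bullet> cross (u + w) x = cross u v \<bullet> cross u x + (cross u v \<bullet> cross w x + cross w v \<bullet> cross u x) + cross w v \<bullet> cross w x"
    unfolding cl inner_add_left inner_add_right by simp
  then show ?thesis unfolding 1 inner_add_left inner_add_right inner_commute[of w u] by (simp add: algebra_simps)
qed

lemma cross_axis: "cross (axis i 1) (axis j 1) \<bullet> cross (axis a 1) (axis b 1) = (\<Sum>k\<in>UNIV. F i j k * F a b k)"
  unfolding cross_def inner_vec_def F_def by simp

text \<open>Antisymmetry within a pair and symmetry between the pairs can be read off the
  definition. Antisymmetry in the first and third index is the polarised norm identity; together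
  they yield all permutations.\<close>

lemma Psi_perm: "Psi j i a b = - Psi i j a b" "Psi i j b a = - Psi i j a b" "Psi a b i j = Psi i j a b" "Psi i a j b = - Psi i j a b"
proof -
  show 1: "Psi j i a b = - Psi i j a b" for i j a b
    unfolding Psi_def F_perm(1)[of j i] by (simp add: sum_negf)
  show 2: "Psi a b i j = Psi i j a b" for i j a b
    unfolding Psi_def by (simp add: mult.commute eq_commute)
  show "Psi i j b a = - Psi i j a b"
    using 1[of a b i j] 2[of a b i j] 2[of b a i j] by simp
  have 3: "Psi a j i b = - Psi i j a b" for i j a b
  proof -
    have "(\<Sum>k\<in>UNIV. F i j k * F a b k) + (\<Sum>k\<in>UNIV. F a j k * F i b k)
      = 2 * kron i a * kron j b - kron i j * kron a b - kron a j * kron i b"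
      using inner_cross[of "axis i 1" "axis j 1" "axis a 1" "axis b 1"]
      unfolding cross_axis inner_axis_axis inner_real_def mult_1 by blast
    moreover have "kron a i = kron i a" "kron j i = kron i j" "kron j a = kron a j" by auto
    ultimately show ?thesis unfolding Psi_def by algebra
  qed
  have "Psi i a j b = - Psi a i j b" by (rule 1)
  also have "\<dots> = Psi j i a b" using 3[of j i a b] by simp
  also have "\<dots> = - Psi i j a b" by (rule 1)
  finally show "Psi i a j b = - Psi i j a b" .
qed

lemma Psi_not_distinct: "\<not> distinct [i,j,a,b] \<Longrightarrow> Psi i j a b = 0"
proof -
  have 1: "Psi i i a b = 0" "Psi i j a a = 0" "Psi i j i b = 0" "Psi i j a j = 0" "Psi i j j b = 0" "Psi i j a i = 0" for i j a b
    using Psi_perm(1)[of i i a b] Psi_perm(2)[of i j a a] Psi_perm(4)[of i i j b] Psi_perm(1)[of i i j b]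
      Psi_perm(4)[of i a j j] Psi_perm(2)[of i a j j] Psi_perm(4)[of i j j b] Psi_perm(1)[of j i a i] Psi_perm(4)[of j i a i]
      Psi_perm(3)[of i j a i] Psi_perm(2)[of i a j i] Psi_perm(4)[of i a i j] Psi_perm(1)[of i i a j] Psi_perm(2)[of i j i a]
      Psi_perm(4)[of i i j a] Psi_perm(1)[of i i j a]
    by linarith+
  show "\<not> distinct [i,j,a,b] \<Longrightarrow> Psi i j a b = 0" using 1 by auto
qed

lemma sum_FF: "(\<Sum>k\<in>UNIV. F i j k * F a b k) = kron i a * kron j b - kron i b * kron j a - Psi i j a b"
  by (simp add: Psi_def)

lemma sum_FF2: "(\<Sum>i\<in>UNIV. \<Sum>j\<in>UNIV. F i j k * F i j l) = 6 * kron k l"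
proof -
  have "(\<Sum>j\<in>UNIV. F i j k * F i j l) = kron k l - kron k i * kron i l" for i
  proof -
    have "(\<Sum>j\<in>UNIV. F i j k * F i j l) = (\<Sum>j\<in>UNIV. F k i j * F l i j)" by (simp only: F_perm(4))
    also have "\<dots> = kron k l - kron k i * kron i l" unfolding sum_FF by (simp add: Psi_not_distinct)
    finally show ?thesis .
  qed
  then have "(\<Sum>i\<in>UNIV. \<Sum>j\<in>UNIV. F i j k * F i j l) = (\<Sum>i\<in>UNIV. kron k l - kron k i * kron i l)" by simp
  also have "\<dots> = 6 * kron k l" by (simp add: sum_subtractf sum_mult_kron)
  finally show ?thesis .
qed

lemma sum_F_sq: "(\<Sum>i\<in>UNIV. \<Sum>j\<in>UNIV. \<Sum>k\<in>UNIV. (F i j k)\<^sup>2) = 42"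
proof -
  have "(\<Sum>i\<in>UNIV. \<Sum>j\<in>UNIV. \<Sum>k\<in>UNIV. (F i j k)\<^sup>2) = (\<Sum>i\<in>UNIV. \<Sum>k\<in>UNIV. \<Sum>j\<in>UNIV. F i j k * F i j k)"
    unfolding power2_eq_square by (intro sum.cong refl sum.swap)
  also have "\<dots> = (\<Sum>k\<in>UNIV. \<Sum>i\<in>UNIV. \<Sum>j\<in>UNIV. F i j k * F i j k)" by (rule sum.swap)
  also have "\<dots> = 42" unfolding sum_FF2 by simp
  finally show ?thesis .
qed

text \<open>168 = 252 - 2 * 42. The metric part paired with \<open>Psi\<close> gives zero, because
  indices are repeated; paired with the contracted product it gives 2 |F|^2; the square of the
  contracted product is 6 |F|^2 by \<open>sum_FF2\<close>.\<close>

lemma sum_Psi_sq: "(\<Sum>i\<in>UNIV. \<Sum>j\<in>UNIV. \<Sum>a\<in>UNIV. \<Sum>b\<in>UNIV. (Psi i j a b)\<^sup>2) = 168"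
proof -
  let ?Q = "\<lambda>i j a b. \<Sum>k\<in>UNIV. F i j k * F a b k"
  have Q2: "(\<Sum>i\<in>UNIV. \<Sum>j\<in>UNIV. \<Sum>a\<in>UNIV. \<Sum>b\<in>UNIV. ?Q i j a b * ?Q i j a b) = 252"
  proof -
    have "(\<Sum>a\<in>UNIV. \<Sum>b\<in>UNIV. ?Q i j a b * ?Q i j a b) = 6 * (\<Sum>k\<in>UNIV. (F i j k)\<^sup>2)" for i j
    proof -
      have "?Q i j a b * ?Q i j a b = (\<Sum>k\<in>UNIV. \<Sum>l\<in>UNIV. (F i j k * F i j l) * (F a b k * F a b l))" for a b
        unfolding sum_product by (simp add: mult_ac)
      then have "(\<Sum>a\<in>UNIV. \<Sum>b\<in>UNIV. ?Q i j a b * ?Q i j a b)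
        = (\<Sum>a\<in>UNIV. \<Sum>b\<in>UNIV. \<Sum>k\<in>UNIV. \<Sum>l\<in>UNIV. (F i j k * F i j l) * (F a b k * F a b l))" by simp
      also have "\<dots> = (\<Sum>a\<in>UNIV. \<Sum>k\<in>UNIV. \<Sum>b\<in>UNIV. \<Sum>l\<in>UNIV. (F i j k * F i j l) * (F a b k * F a b l))"
        by (intro sum.cong refl sum.swap)
      also have "\<dots> = (\<Sum>a\<in>UNIV. \<Sum>k\<in>UNIV. \<Sum>l\<in>UNIV. \<Sum>b\<in>UNIV. (F i j k * F i j l) * (F a b k * F a b l))"
        by (intro sum.cong refl sum.swap)
      also have "\<dots> = (\<Sum>k\<in>UNIV. \<Sum>a\<in>UNIV. \<Sum>l\<in>UNIV. \<Sum>b\<in>UNIV. (F i j k * F i j l) * (F a b k * F a b l))"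
        by (rule sum.swap)
      also have "\<dots> = (\<Sum>k\<in>UNIV. \<Sum>l\<in>UNIV. \<Sum>a\<in>UNIV. \<Sum>b\<in>UNIV. (F i j k * F i j l) * (F a b k * F a b l))"
        by (intro sum.cong refl sum.swap)
      also have "\<dots> = (\<Sum>k\<in>UNIV. \<Sum>l\<in>UNIV. (F i j k * F i j l) * (6 * kron k l))"
        unfolding sum_distrib_left[symmetric] sum_FF2 by (rule refl)
      also have "\<dots> = 6 * (\<Sum>k\<in>UNIV. (F i j k)\<^sup>2)"
        by (simp add: sum_mult_kron mult.assoc[symmetric] mult.commute[of _ 6] sum_distrib_left power2_eq_square)
      finally show ?thesis .
    qed
    then show ?thesis using sum_F_sq by (simp add: sum_distrib_left[symmetric])
  qed
  have Q1: "(\<Sum>a\<in>UNIV. \<Sum>b\<in>UNIV. (kron i a * kron j b - kron i b * kron j a) * x a b) = x i j - x j i" for i j and x :: "7 \<Rightarrow> 7 \<Rightarrow> real"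
  proof -
    have "(\<Sum>b\<in>UNIV. (kron i a * kron j b - kron i b * kron j a) * x a b) = kron i a * x a j - kron j a * x a i" for a
      by (simp add: left_diff_distrib sum_subtractf mult.assoc sum_distrib_left[symmetric] sum_mult_kron mult.left_commute[of "kron i _" "kron j a"])
    then show ?thesis by (simp add: sum_subtractf sum_mult_kron)
  qed
  have "(\<Sum>a\<in>UNIV. \<Sum>b\<in>UNIV. (Psi i j a b)\<^sup>2) = - (2 * (\<Sum>k\<in>UNIV. (F i j k)\<^sup>2)) + (\<Sum>a\<in>UNIV. \<Sum>b\<in>UNIV. ?Q i j a b * ?Q i j a b)" for i j
  proof -
    have "(Psi i j a b)\<^sup>2 = (kron i a * kron j b - kron i b * kron j a) * Psi i j a b - (kron i a * kron j b - kron i b * kron j a) * ?Q i j a b + ?Q i j a b * ?Q i j a b" for a b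
      unfolding Psi_def by algebra
    then have "(\<Sum>a\<in>UNIV. \<Sum>b\<in>UNIV. (Psi i j a b)\<^sup>2) = (Psi i j i j - Psi i j j i) - (?Q i j i j - ?Q i j j i) + (\<Sum>a\<in>UNIV. \<Sum>b\<in>UNIV. ?Q i j a b * ?Q i j a b)"
      by (simp only: sum.distrib sum_subtractf Q1)
    moreover have "?Q i j j i = - ?Q i j i j" by (simp add: F_perm(1)[of j i] sum_negf)
    ultimately show ?thesis by (simp add: Psi_not_distinct power2_eq_square)
  qed
  then have "(\<Sum>i\<in>UNIV. \<Sum>j\<in>UNIV. \<Sum>a\<in>UNIV. \<Sum>b\<in>UNIV. (Psi i j a b)\<^sup>2)
    = (\<Sum>i\<in>UNIV. \<Sum>j\<in>UNIV. - (2 * (\<Sum>k\<in>UNIV. (F i j k)\<^sup>2)) + (\<Sum>a\<in>UNIV. \<Sum>b\<in>UNIV. ?Q i j a b * ?Q i j a b))"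
    by (intro sum.cong refl)
  also have "\<dots> = 168" by (simp only: sum.distrib sum_negf sum_distrib_left[symmetric] Q2 sum_F_sq)
  finally show ?thesis .
qed

text \<open>On distinct indices the metric part of \<open>Psi\<close> vanishes. What remains is, up
  to sign, the sum over m of the components (m,m) of the metric relation, each equal to 24 times -6
  s; and 7 * 144 = 1008.\<close>

lemma sum_sign_F_Psi:
  "(\<Sum>p | p permutes UNIV. of_int (sign p) * F (p 1) (p 2) (p 3) * Psi (p 4) (p 5) (p 6) (p 7)) = 1008 * s"
proof -
  let ?G = "\<lambda>m p. of_int (sign p) * F (p 1) (p 2) (p 3) * (F m (p 4) (p 5) * F m (p 6) (p 7))"
  have 1: "(\<Sum>p | p permutes UNIV. ?G m p) = - 144 * s" for m
  proof -
    let ?q = "\<lambda>n::7. n + 4"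
    have U: "set [5,6,7,1,2,3,4::7] = UNIV" unfolding UNIV_7 by auto
    have eq: "(8::7) = 1" "(9::7) = 2" "(10::7) = 3" "(11::7) = 4" by simp_all
    have "(\<Sum>p | p permutes UNIV. ?G m p) = (\<Sum>p | p permutes UNIV. ?G m (p \<circ> ?q))"
      by (rule sum_permutations_compose_right[OF sign_shift(2)])
    also have "\<dots> = perm_sum [5,6,7,1,2,3,4::7] (\<lambda>l. F m (l!3) (l!4) * F m (l!5) (l!6) * F (l!0) (l!1) (l!2))"
      unfolding perm_sum_def U
    proof (rule sum.cong[OF refl])
      fix p :: "7 \<Rightarrow> 7" assume "p \<in> {p. p permutes UNIV}"
      then have "sign (p \<circ> ?q) = sign p * sign ?q"
        using sign_compose permutes_imp_permutation sign_shift(2) finite by (metis mem_Collect_eq)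
      then have "of_int (sign (p \<circ> ?q)) = (of_int (sign p) :: real)" using sign_shift(1) by simp
      then show "?G m (p \<circ> ?q) = of_int (sign p) * (\<lambda>l. F m (l!3) (l!4) * F m (l!5) (l!6) * F (l!0) (l!1) (l!2)) (map p [5,6,7,1,2,3,4])"
        by (simp add: eq)
    qed
    also have "\<dots> = 24 * wedge_comp (F m) (F m) F"
      by (rule perm_sum_wedge_comp[of "F m" "F m" F]) (rule F_perm)+
    also have "wedge_comp (F m) (F m) F = - 6 * (s * det (\<chi> i. (axis i 1 :: vec7)))"
      using wedge_frame[OF orthonormal_axis, of m m] unfolding F_def by simp
    also have "(\<chi> i. (axis i 1 :: vec7)) = mat 1" by (simp add: vec_eq_iff mat_def axis_def)
    finally show ?thesis by simp
  qed
  have "(\<Sum>p | p permutes UNIV. of_int (sign p) * F (p 1) (p 2) (p 3) * Psi (p 4) (p 5) (p 6) (p 7))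
     = (\<Sum>p | p permutes UNIV. - (\<Sum>m\<in>UNIV. ?G m p))"
  proof (rule sum.cong[OF refl])
    fix p :: "7 \<Rightarrow> 7" assume "p \<in> {p. p permutes UNIV}"
    then have "distinct [p 1, p 2, p 3, p 4, p 5, p 6, p 7]" using permutes_distinct by simp
    then have "Psi (p 4) (p 5) (p 6) (p 7) = - (\<Sum>m\<in>UNIV. F m (p 4) (p 5) * F m (p 6) (p 7))"
      unfolding Psi_def F_perm(4)[of _ "p 4"] F_perm(4)[of _ "p 6"] by simp
    then show "of_int (sign p) * F (p 1) (p 2) (p 3) * Psi (p 4) (p 5) (p 6) (p 7) = - (\<Sum>m\<in>UNIV. ?G m p)"
      by (simp add: sum_distrib_left)
  qed
  also have "\<dots> = - (\<Sum>m\<in>UNIV. \<Sum>p | p permutes UNIV. ?G m p)"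
    unfolding sum_negf by (subst sum.swap) (rule refl)
  also have "\<dots> = 1008 * s" unfolding 1 by simp
  finally show ?thesis .
qed

text \<open>Both sides, as functions of \<open>p\<close>, have squared norm \<open>1008\<close>, and this is also their inner product.\<close>

lemma Psi_permutes:
  assumes "p permutes UNIV"
  shows "Psi (p 4) (p 5) (p 6) (p 7) = s * of_int (sign p) * F (p 1) (p 2) (p 3)"
proof -
  let ?X = "\<lambda>p. Psi (p 4) (p 5) (p 6) (p 7)" and ?Y = "\<lambda>p. s * of_int (sign p) * F (p 1) (p 2) (p 3)"
  have X: "(\<Sum>p | p permutes UNIV. (?X p)\<^sup>2) = 1008"
  proof -
    have "(\<Sum>p | p permutes UNIV. (?X p)\<^sup>2) = 6 * (\<Sum>d\<in>UNIV. \<Sum>e\<in>UNIV. \<Sum>f\<in>UNIV. \<Sum>g\<in>UNIV. if distinct [d,e,f,g] then (Psi d e f g)\<^sup>2 else 0)"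
      by (rule sum_permutes_last4)
    also have "(\<Sum>d\<in>UNIV. \<Sum>e\<in>UNIV. \<Sum>f\<in>UNIV. \<Sum>g\<in>UNIV. if distinct [d,e,f,g] then (Psi d e f g)\<^sup>2 else 0) = 168"
      unfolding sum_Psi_sq[symmetric] using Psi_not_distinct by (intro sum.cong refl) (simp del: distinct.simps)
    finally show ?thesis by simp
  qed
  have Y: "(\<Sum>p | p permutes UNIV. (?Y p)\<^sup>2) = 1008"
  proof -
    have "(\<Sum>p | p permutes UNIV. (?Y p)\<^sup>2) = (\<Sum>p | p permutes UNIV. (F (p 1) (p 2) (p 3))\<^sup>2)"
      by (intro sum.cong refl) (simp add: power_mult_distrib s, simp add: sign_def)
    also have "\<dots> = 24 * (\<Sum>a\<in>UNIV. \<Sum>b\<in>UNIV. \<Sum>c\<in>UNIV. if distinct [a,b,c] then (F a b c)\<^sup>2 else 0)"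
      by (rule sum_permutes_first3)
    also have "(\<Sum>a\<in>UNIV. \<Sum>b\<in>UNIV. \<Sum>c\<in>UNIV. if distinct [a,b,c] then (F a b c)\<^sup>2 else 0) = 42"
      unfolding sum_F_sq[symmetric] by (intro sum.cong refl) (auto simp: F_zero)
    finally show ?thesis by simp
  qed
  have XY: "(\<Sum>p | p permutes UNIV. ?X p * ?Y p) = 1008"
  proof -
    have "(\<Sum>p | p permutes UNIV. ?X p * ?Y p) = s * (\<Sum>p | p permutes UNIV. of_int (sign p) * F (p 1) (p 2) (p 3) * Psi (p 4) (p 5) (p 6) (p 7))"
      by (simp add: sum_distrib_left mult_ac)
    then show ?thesis using s by (simp add: sum_sign_F_Psi power2_eq_square)
  qed
  have "(\<Sum>p | p permutes UNIV. (?X p - ?Y p)\<^sup>2) = (\<Sum>p | p permutes UNIV. (?X p)\<^sup>2 + (?Y p)\<^sup>2 - 2 * (?X p * ?Y p))"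
    by (intro sum.cong refl) algebra
  also have "\<dots> = 0" unfolding sum.distrib sum_subtractf sum_distrib_left[symmetric] X Y XY by simp
  finally have "(\<Sum>p | p permutes UNIV. (?X p - ?Y p)\<^sup>2) = 0" .
  then have "\<forall>p\<in>{p. p permutes UNIV}. (?X p - ?Y p)\<^sup>2 = 0"
    by (subst (asm) sum_nonneg_eq_0_iff) (simp_all add: finite_permutations)
  then show ?thesis using assms by simp
qed

text \<open>The determinant is the sign of a permutation or zero, so by \<open>Psi_permutes\<close>
  each of the 3! orderings of the complementary triple contributes
  \<open>Psi i j k l\<close>.\<close>

lemma Psi_star:
  "(\<Sum>a\<in>UNIV. \<Sum>b\<in>UNIV. \<Sum>c\<in>UNIV. F a b c * (s * det (\<chi> n. (axis (tuple a b c i j k l n) 1 :: vec7)))) = 6 * Psi i j k l"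
proof -
  have "F a b c * (s * det (\<chi> n. (axis (tuple a b c i j k l n) 1 :: vec7))) = (if distinct [a,b,c,i,j,k,l] then Psi i j k l else 0)" for a b c
  proof (cases "distinct [a,b,c,i,j,k,l]")
    case True
    have p: "tuple a b c i j k l permutes UNIV" by (rule tuple_permutes[OF True])
    show ?thesis using True Psi_permutes[OF p] det_axis_permutes[OF p] by (simp add: tuple_nth mult_ac)
  next
    case False
    then have "\<not> tuple a b c i j k l permutes UNIV" using permutes_distinct[of "tuple a b c i j k l"] by (auto simp: tuple_nth)
    then have "\<not> inj (tuple a b c i j k l)"
      using finite_UNIV_inj_surj[of "tuple a b c i j k l"] by (auto simp: permutes_def bij_def bij_iff[symmetric])
    then obtain x y where "tuple a b c i j k l x = tuple a b c i j k l y" "x \<noteq> y" by (auto simp: inj_on_def)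
    then have "det (\<chi> n. (axis (tuple a b c i j k l n) 1 :: vec7)) = 0" by (rule det_axis_not_inj)
    then show ?thesis using False by (simp del: distinct.simps)
  qed
  then have "(\<Sum>a\<in>UNIV. \<Sum>b\<in>UNIV. \<Sum>c\<in>UNIV. F a b c * (s * det (\<chi> n. (axis (tuple a b c i j k l n) 1 :: vec7))))
    = (\<Sum>a\<in>UNIV. \<Sum>b\<in>UNIV. \<Sum>c\<in>UNIV. if distinct [a,b,c,i,j,k,l] then Psi i j k l else 0)" by simp
  also have "\<dots> = (if distinct [i,j,k,l] then 6 * Psi i j k l else 0)"
    by (rule sum_distinct_three)
  finally show ?thesis using Psi_not_distinct[of i j k l] by (simp del: distinct.simps split: if_splits)
qed

end

text \<open>The interface between geometry and algebra: all later computations with the structure at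
  a point rest on these component identities.\<close>

locale g2_tensors =
  fixes f :: tensor3 and \<psi> :: tensor4
  assumes f_alt: "f $ j $ i $ k = - f $ i $ j $ k" "f $ i $ k $ j = - f $ i $ j $ k"
    and psi_alt: "\<psi> $ j $ i $ k $ l = - \<psi> $ i $ j $ k $ l" "\<psi> $ i $ k $ j $ l = - \<psi> $ i $ j $ k $ l"
      "\<psi> $ i $ j $ l $ k = - \<psi> $ i $ j $ k $ l"
    and ff: "(\<Sum>k\<in>UNIV. f $ i $ j $ k * f $ a $ b $ k)
      = kron i a * kron j b - kron i b * kron j a - \<psi> $ i $ j $ a $ b"

lemma G2_structure_tensors:
  assumes G2: "G2_structure X A \<phi> g \<nu>" and fr: "(c, p, e) \<in> frames A g S"
  shows "g2_tensors (phi_comp \<phi> (c, p, e)) (psi_comp \<phi> \<nu> (c, p, e))"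
proof -
  define x where "x = chart_map c p"
  have c: "c \<in> A" and x: "x \<in> chart_image c" and e: "orthonormal_frame (g c x) e"
    using fr by (auto simp: frames_def chart_image_def x_def)
  have tf: "three_form (\<phi> c x)" using G2 c x by (auto simp: G2_structure_def smooth_three_form_def)
  have g: "bilinear (g c x)" using G2 c x unfolding G2_structure_def riemannian_metric_def by blast
  have s: "\<bar>top_form (\<nu> c x) e\<bar> = 1" using G2 c x e unfolding G2_structure_def volume_form_def by blast
  have w: "wedge223 (\<phi> c x u) (\<phi> c x v) (\<phi> c x) E = - 6 * g c x u v * top_form (\<nu> c x) E" for u v E
    using G2 c x unfolding G2_structure_def by blast
  \<comment> \<open>The isometry from the standard inner product space to the tangent space that
    sends the standard basis to the frame; all data are pulled back along it.\<close>
  define L where "L u = (\<Sum>i\<in>UNIV. u $ i *\<^sub>R e i)" for u :: vec7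
  define s where "s = top_form (\<nu> c x) e"
  define f where "f u v w = \<phi> c x (L u) (L v) (L w)" for u v w
  have L: "linear L" unfolding L_def
    by (intro linearI) (simp_all add: scaleR_add_left sum.distrib scaleR_sum_right)
  have Lax: "L (axis i 1) = e i" for i
    unfolding L_def by (simp add: axis_def if_distrib[of "\<lambda>r. r *\<^sub>R _"] cong: if_cong)
  have gL: "g c x (L u) (L v) = u \<bullet> v" for u v
  proof -
    have "g c x (L u) (L v) = (\<Sum>j\<in>UNIV. \<Sum>i\<in>UNIV. (u $ i * v $ j) * g c x (e i) (e j))"
      unfolding L_def using g
      by (simp add: bilinear_def linear_sum[of "\<lambda>u. g c x u _"] linear_sum[of "g c x _"] linear_cmul[of "\<lambda>u. g c x u _"]
          linear_cmul[of "g c x _"] sum_distrib_left mult_ac)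
    also have "\<dots> = u \<bullet> v"
      using e unfolding orthonormal_frame_def by (simp add: sum_mult_kron inner_vec_def)
    finally show ?thesis .
  qed
  have top: "top_form (\<nu> c x) (\<lambda>i. L (E i)) = s * det (\<chi> i. E i)" for E
  proof -
    have "(\<chi> i. L (E i)) = (\<chi> i. E i) ** (\<chi> i. e i)"
      by (simp add: L_def vec_eq_iff matrix_matrix_mult_def)
    then show ?thesis by (simp add: top_form_def s_def det_mul)
  qed
  interpret g2_form f s
  proof
    show "three_form f"
      unfolding three_form_def
    proof (intro conjI allI)
      show "linear (\<lambda>u. f u v w)" for v w
        using linear_compose[OF L three_formD(3)[OF tf]] by (simp add: f_def comp_def)
      show "f v u w = - f u v w" "f u w v = - f u v w" for u v w
        unfolding f_def by (rule three_formD[OF tf])+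
    qed
    show "s\<^sup>2 = 1" using s unfolding s_def by (metis abs_1 power2_abs power_one)
    show "wedge223 (f u) (f v) f E = - 6 * (u \<bullet> v) * (s * det (\<chi> i. E i))" for u v E
    proof -
      have "wedge223 (f u) (f v) f E = wedge223 (\<phi> c x (L u)) (\<phi> c x (L v)) (\<phi> c x) (\<lambda>i. L (E i))"
        unfolding wedge223_def f_def by (rule refl)
      then show ?thesis by (simp add: w gL top)
    qed
  qed
  have ph: "phi_comp \<phi> (c, p, e) $ i $ j $ k = F i j k" for i j k
    by (simp add: phi_comp_def F_def f_def Lax x_def)
  have ps: "psi_comp \<phi> \<nu> (c, p, e) $ i $ j $ k $ l = Psi i j k l" for i j k l
  proof -
    have t: "top_form (\<nu> c x) (($) (vector [e a, e b, e d, e i, e j, e k, e l])) = s * det (\<chi> n. (axis (tuple a b d i j k l n) 1 :: vec7))" for a b d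
    proof -
      have "($) (vector [e a, e b, e d, e i, e j, e k, e l]) = (\<lambda>n. L (axis (tuple a b d i j k l n) 1))"
      proof
        show "vector [e a, e b, e d, e i, e j, e k, e l] $ n = L (axis (tuple a b d i j k l n) 1)" for n
          unfolding Lax using exhaust_7[of n] by (elim disjE) (simp_all only: vector_7 tuple_nth)
      qed
      then show ?thesis by (simp add: top)
    qed
    have "psi_comp \<phi> \<nu> (c, p, e) $ i $ j $ k $ l
      = (\<Sum>a\<in>UNIV. \<Sum>b\<in>UNIV. \<Sum>d\<in>UNIV. F a b d * (s * det (\<chi> n. (axis (tuple a b d i j k l n) 1 :: vec7)))) / 6"
      unfolding psi_comp_def by (simp add: ph x_def[symmetric] t fact_numeral)
    then show ?thesis by (simp only: Psi_star)
  qed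
  show ?thesis
    by (unfold_locales, unfold ph ps) (rule F_perm Psi_perm sum_FF)+
qed

section \<open>Contractions with 2-forms and 4-forms\<close>

lemma sum_rot3: "(\<Sum>a\<in>A. \<Sum>b\<in>B. \<Sum>c\<in>C. h a b c) = (\<Sum>b\<in>B. \<Sum>c\<in>C. \<Sum>a\<in>A. h a b c)"
proof -
  have "(\<Sum>a\<in>A. \<Sum>b\<in>B. \<Sum>c\<in>C. h a b c) = (\<Sum>b\<in>B. \<Sum>a\<in>A. \<Sum>c\<in>C. h a b c)" by (rule sum.swap)
  also have "\<dots> = (\<Sum>b\<in>B. \<Sum>c\<in>C. \<Sum>a\<in>A. h a b c)" by (intro sum.cong refl sum.swap)
  finally show ?thesis .
qed

lemma sum_swap22: "(\<Sum>a\<in>A. \<Sum>b\<in>B. \<Sum>c\<in>C. \<Sum>d\<in>D. h a b c d) = (\<Sum>c\<in>C. \<Sum>d\<in>D. \<Sum>a\<in>A. \<Sum>b\<in>B. h a b c d)"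
proof -
  have "(\<Sum>a\<in>A. \<Sum>b\<in>B. \<Sum>c\<in>C. \<Sum>d\<in>D. h a b c d) = (\<Sum>a\<in>A. \<Sum>c\<in>C. \<Sum>d\<in>D. \<Sum>b\<in>B. h a b c d)"
    by (intro sum.cong refl sum_rot3)
  also have "\<dots> = (\<Sum>c\<in>C. \<Sum>d\<in>D. \<Sum>a\<in>A. \<Sum>b\<in>B. h a b c d)" by (rule sum_rot3)
  finally show ?thesis .
qed

lemma sum_swap3: "(\<Sum>a\<in>A. \<Sum>b\<in>B. \<Sum>c\<in>C. h a b c) = (\<Sum>a\<in>A. \<Sum>c\<in>C. \<Sum>b\<in>B. h a b c)"
  by (intro sum.cong refl sum.swap)

context g2_tensors
begin

lemma f_cyc: "f $ j $ k $ i = f $ i $ j $ k" "f $ k $ i $ j = f $ i $ j $ k" "f $ k $ j $ i = - f $ i $ j $ k"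
  using f_alt(1)[of j i k] f_alt(2)[of j k i] f_alt(2)[of i k j] f_alt(1)[of k i j] f_alt(2)[of k j i] by linarith+

lemma ff': "(\<Sum>k\<in>UNIV. f $ k $ i $ j * f $ k $ a $ b) = kron i a * kron j b - kron i b * kron j a - \<psi> $ i $ j $ a $ b"
proof -
  have "(\<Sum>k\<in>UNIV. f $ k $ i $ j * f $ k $ a $ b) = (\<Sum>k\<in>UNIV. f $ i $ j $ k * f $ a $ b $ k)"
    by (intro sum.cong refl arg_cong2[where f = times] f_cyc(2))
  then show ?thesis by (simp only: ff)
qed

lemma psi_zero: "\<psi> $ i $ i $ k $ l = 0" "\<psi> $ i $ j $ j $ l = 0" "\<psi> $ i $ j $ k $ k = 0" "\<psi> $ i $ j $ i $ l = 0" "\<psi> $ i $ j $ k $ j = 0"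
  using psi_alt(1)[of i i k l] psi_alt(2)[of i j j l] psi_alt(3)[of i j k k] psi_alt(1)[of i j i l] psi_alt(2)[of j i i l]
    psi_alt(3)[of i j k j] psi_alt(2)[of i j j k] by linarith+

lemma ff2: "(\<Sum>i\<in>UNIV. \<Sum>j\<in>UNIV. f $ i $ j $ k * f $ i $ j $ l) = 6 * kron k l"
proof -
  have "(\<Sum>j\<in>UNIV. f $ i $ j $ k * f $ i $ j $ l) = kron k l - kron k i * kron i l" for i
  proof -
    have "(\<Sum>j\<in>UNIV. f $ i $ j $ k * f $ i $ j $ l) = (\<Sum>j\<in>UNIV. f $ j $ k $ i * f $ j $ l $ i)"
      by (intro sum.cong refl arg_cong2[where f = times] f_cyc(1)[symmetric])
    also have "\<dots> = kron k l - kron k i * kron i l" unfolding ff' by (simp add: psi_zero)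
    finally show ?thesis .
  qed
  then have "(\<Sum>i\<in>UNIV. \<Sum>j\<in>UNIV. f $ i $ j $ k * f $ i $ j $ l) = (\<Sum>i\<in>UNIV. kron k l - kron k i * kron i l)" by simp
  also have "\<dots> = 6 * kron k l" by (simp add: sum_subtractf sum_mult_kron)
  finally show ?thesis .
qed

text \<open>With the contraction identity inserted for \<psi>, the two metric terms both give
  \<beta>, and the remaining term is six times the projection to the 7-dimensional summand.\<close>

lemma psi_contract2:
  assumes "\<And>i j. \<beta> j i = - \<beta> i j"
  shows "(\<Sum>i\<in>UNIV. \<Sum>j\<in>UNIV. \<beta> i j * \<psi> $ i $ j $ a $ b)
    = 2 * \<beta> a b - (\<Sum>k\<in>UNIV. (\<Sum>i\<in>UNIV. \<Sum>j\<in>UNIV. \<beta> i j * f $ i $ j $ k) * f $ a $ b $ k)"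
proof -
  have psi: "\<psi> $ i $ j $ a $ b = kron i a * kron j b - kron i b * kron j a - (\<Sum>k\<in>UNIV. f $ i $ j $ k * f $ a $ b $ k)" for i j
    using ff[of i j a b] by simp
  have "(\<Sum>i\<in>UNIV. \<Sum>j\<in>UNIV. \<beta> i j * \<psi> $ i $ j $ a $ b)
     = (\<Sum>i\<in>UNIV. \<Sum>j\<in>UNIV. \<beta> i j * kron i a * kron j b) - (\<Sum>i\<in>UNIV. \<Sum>j\<in>UNIV. \<beta> i j * kron i b * kron j a)
       - (\<Sum>i\<in>UNIV. \<Sum>j\<in>UNIV. \<Sum>k\<in>UNIV. \<beta> i j * f $ i $ j $ k * f $ a $ b $ k)"
    unfolding psi by (simp only: right_diff_distrib sum_subtractf sum_distrib_left mult.assoc)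
  also have "(\<Sum>i\<in>UNIV. \<Sum>j\<in>UNIV. \<beta> i j * kron i a * kron j b) = \<beta> a b" by (simp only: sum_mult_kron)
  also have "(\<Sum>i\<in>UNIV. \<Sum>j\<in>UNIV. \<beta> i j * kron i b * kron j a) = \<beta> b a" by (simp only: sum_mult_kron)
  also have "(\<Sum>i\<in>UNIV. \<Sum>j\<in>UNIV. \<Sum>k\<in>UNIV. \<beta> i j * f $ i $ j $ k * f $ a $ b $ k)
    = (\<Sum>k\<in>UNIV. (\<Sum>i\<in>UNIV. \<Sum>j\<in>UNIV. \<beta> i j * f $ i $ j $ k) * f $ a $ b $ k)"
    unfolding sum_distrib_right by (rule sum_rot3[symmetric])
  also have "\<beta> b a = - \<beta> a b" by (rule assms)
  finally show ?thesis by simp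
qed

text \<open>The Lie algebra \<open>\<Omega>\<^sup>2\<^sub>1\<^sub>4\<close> annihilates the 3-form: the squared norm of the 3-form on the left-hand
  side is \<open>18|\<beta>|\<^sup>2 - 18|\<beta>|\<^sup>2\<close>.\<close>

lemma Omega14_derivation:
  assumes anti: "\<And>i j. \<beta> j i = - \<beta> i j" and z: "\<And>k. (\<Sum>i\<in>UNIV. \<Sum>j\<in>UNIV. \<beta> i j * f $ i $ j $ k) = 0"
  shows "(\<Sum>p\<in>UNIV. \<beta> i p * f $ p $ j $ k) + (\<Sum>p\<in>UNIV. \<beta> j p * f $ p $ k $ i) + (\<Sum>p\<in>UNIV. \<beta> k p * f $ p $ i $ j) = 0"
proof -
  define A where "A i j k = (\<Sum>p\<in>UNIV. \<beta> i p * f $ p $ j $ k)" for i j k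
  have A2: "A i k j = - A i j k" for i j k unfolding A_def by (simp add: f_alt(2)[of _ j k] sum_negf)
  define b2 where "b2 = (\<Sum>i\<in>UNIV. \<Sum>j\<in>UNIV. \<beta> i j * \<beta> i j)"
  have AA: "(\<Sum>i\<in>UNIV. \<Sum>j\<in>UNIV. \<Sum>k\<in>UNIV. A i j k * A i j k) = 6 * b2"
  proof -
    have "(\<Sum>j\<in>UNIV. \<Sum>k\<in>UNIV. A i j k * A i j k) = (\<Sum>p\<in>UNIV. \<Sum>q\<in>UNIV. \<beta> i p * \<beta> i q * (6 * kron p q))" for i
    proof -
      have "(\<Sum>j\<in>UNIV. \<Sum>k\<in>UNIV. A i j k * A i j k)
        = (\<Sum>j\<in>UNIV. \<Sum>k\<in>UNIV. \<Sum>p\<in>UNIV. \<Sum>q\<in>UNIV. (\<beta> i p * \<beta> i q) * (f $ j $ k $ p * f $ j $ k $ q))"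
        unfolding A_def sum_product
      proof (intro sum.cong refl)
        fix j k p q
        show "\<beta> i p * f $ p $ j $ k * (\<beta> i q * f $ q $ j $ k) = \<beta> i p * \<beta> i q * (f $ j $ k $ p * f $ j $ k $ q)"
          unfolding f_cyc(1)[of j k p] f_cyc(1)[of j k q] by simp
      qed
      also have "\<dots> = (\<Sum>p\<in>UNIV. \<Sum>q\<in>UNIV. \<Sum>j\<in>UNIV. \<Sum>k\<in>UNIV. (\<beta> i p * \<beta> i q) * (f $ j $ k $ p * f $ j $ k $ q))"
        by (rule sum_swap22)
      finally show ?thesis unfolding sum_distrib_left[symmetric] ff2 .
    qed
    moreover have "(\<Sum>p\<in>UNIV. \<Sum>q\<in>UNIV. \<beta> i p * \<beta> i q * (6 * kron p q)) = 6 * (\<Sum>p\<in>UNIV. \<beta> i p * \<beta> i p)" for i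
      by (simp only: mult.left_commute[of _ 6] sum_distrib_left[symmetric] sum_mult_kron)
    ultimately show ?thesis unfolding b2_def by (simp only: sum_distrib_left)
  qed
  have AX: "(\<Sum>i\<in>UNIV. \<Sum>j\<in>UNIV. \<Sum>k\<in>UNIV. A i j k * A j i k) = 3 * b2"
  proof -
    have "(\<Sum>i\<in>UNIV. \<Sum>j\<in>UNIV. \<Sum>k\<in>UNIV. A i j k * A j i k)
       = (\<Sum>i\<in>UNIV. \<Sum>j\<in>UNIV. \<Sum>p\<in>UNIV. \<Sum>q\<in>UNIV. \<beta> i p * \<beta> j q * (\<Sum>k\<in>UNIV. f $ k $ p $ j * f $ k $ q $ i))"
    proof (rule sum.cong[OF refl], rule sum.cong[OF refl])
      fix i j
      have "(\<Sum>k\<in>UNIV. A i j k * A j i k) = (\<Sum>k\<in>UNIV. \<Sum>p\<in>UNIV. \<Sum>q\<in>UNIV. \<beta> i p * \<beta> j q * (f $ k $ p $ j * f $ k $ q $ i))"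
        unfolding A_def sum_product
      proof (intro sum.cong refl)
        fix k p q
        show "\<beta> i p * f $ p $ j $ k * (\<beta> j q * f $ q $ i $ k) = \<beta> i p * \<beta> j q * (f $ k $ p $ j * f $ k $ q $ i)"
          unfolding f_cyc(2)[of k p j] f_cyc(2)[of k q i] by simp
      qed
      then show "(\<Sum>k\<in>UNIV. A i j k * A j i k) = (\<Sum>p\<in>UNIV. \<Sum>q\<in>UNIV. \<beta> i p * \<beta> j q * (\<Sum>k\<in>UNIV. f $ k $ p $ j * f $ k $ q $ i))"
        unfolding sum_distrib_left by (rule trans[OF _ sum_rot3])
    qed
    also have "\<dots> = (\<Sum>i\<in>UNIV. \<Sum>j\<in>UNIV. \<Sum>p\<in>UNIV. \<Sum>q\<in>UNIV. \<beta> i p * \<beta> j q * (kron p q * kron j i - kron p i * kron j q + \<psi> $ i $ p $ j $ q))"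
    proof (intro sum.cong refl)
      fix i j p q
      have "\<psi> $ p $ j $ q $ i = - \<psi> $ i $ p $ j $ q"
        using psi_alt(1)[of i p j q] psi_alt(2)[of p i j q] psi_alt(3)[of p j i q] by simp
      then show "\<beta> i p * \<beta> j q * (\<Sum>k\<in>UNIV. f $ k $ p $ j * f $ k $ q $ i) = \<beta> i p * \<beta> j q * (kron p q * kron j i - kron p i * kron j q + \<psi> $ i $ p $ j $ q)"
        unfolding ff' by simp
    qed
    \<comment> \<open>The middle term vanishes because \<beta> has zero diagonal. The last one is a
      contraction of \<beta> with \<psi>, which by \<open>psi_contract2\<close> is 2 \<beta> since
      the contraction with the 3-form is zero.\<close>
    also have "\<dots> = b2 - 0 + 2 * b2"
    proof -
      have 1: "(\<Sum>p\<in>UNIV. \<Sum>q\<in>UNIV. \<beta> i p * \<beta> j q * (kron p q * kron j i)) = kron j i * (\<Sum>p\<in>UNIV. \<beta> i p * \<beta> j p)" for i j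
        by (simp only: mult.assoc[symmetric] sum_distrib_right[symmetric] sum_mult_kron mult.commute[of "kron j i"])
      have 2: "(\<Sum>p\<in>UNIV. \<Sum>q\<in>UNIV. \<beta> i p * \<beta> j q * (kron p i * kron j q)) = 0" for i j
      proof -
        have "\<beta> i i = 0" using anti[of i i] by simp
        moreover have "(\<Sum>q\<in>UNIV. \<beta> i p * \<beta> j q * (kron p i * kron j q)) = \<beta> i p * \<beta> j j * kron p i" for p
          by (simp only: mult.assoc[symmetric] sum_mult_kron)
        ultimately show ?thesis by (simp add: sum_mult_kron)
      qed
      have 3: "(\<Sum>i\<in>UNIV. \<Sum>j\<in>UNIV. \<Sum>p\<in>UNIV. \<Sum>q\<in>UNIV. \<beta> i p * \<beta> j q * \<psi> $ i $ p $ j $ q) = 2 * b2"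
      proof -
        have "(\<Sum>i\<in>UNIV. \<Sum>j\<in>UNIV. \<Sum>p\<in>UNIV. \<Sum>q\<in>UNIV. \<beta> i p * \<beta> j q * \<psi> $ i $ p $ j $ q)
          = (\<Sum>j\<in>UNIV. \<Sum>q\<in>UNIV. \<beta> j q * (\<Sum>i\<in>UNIV. \<Sum>p\<in>UNIV. \<beta> i p * \<psi> $ i $ p $ j $ q))"
        proof -
          have "(\<Sum>i\<in>UNIV. \<Sum>j\<in>UNIV. \<Sum>p\<in>UNIV. \<Sum>q\<in>UNIV. \<beta> i p * \<beta> j q * \<psi> $ i $ p $ j $ q)
            = (\<Sum>i\<in>UNIV. \<Sum>p\<in>UNIV. \<Sum>j\<in>UNIV. \<Sum>q\<in>UNIV. \<beta> j q * (\<beta> i p * \<psi> $ i $ p $ j $ q))"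
            by (rule sum.cong[OF refl], subst sum.swap, intro sum.cong refl) (simp add: mult_ac)
          also have "\<dots> = (\<Sum>j\<in>UNIV. \<Sum>q\<in>UNIV. \<Sum>i\<in>UNIV. \<Sum>p\<in>UNIV. \<beta> j q * (\<beta> i p * \<psi> $ i $ p $ j $ q))"
            by (rule sum_swap22)
          finally show ?thesis by (simp only: sum_distrib_left)
        qed
        then show ?thesis unfolding psi_contract2[OF anti] z b2_def by (simp add: sum_distrib_left mult_ac)
      qed
      show ?thesis
        by (simp only: right_diff_distrib distrib_left sum.distrib sum_subtractf 1 2 3) (simp add: sum_mult_kron b2_def)
    qed
    finally show ?thesis by simp
  qed
  define \<eta> where "\<eta> i j k = A i j k - A j i k + A k i j" for i j k
  have AA2: "(\<Sum>i\<in>UNIV. \<Sum>j\<in>UNIV. \<Sum>k\<in>UNIV. A j i k * A j i k) = 6 * b2"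
    using AA by (subst sum.swap)
  have AA3: "(\<Sum>i\<in>UNIV. \<Sum>j\<in>UNIV. \<Sum>k\<in>UNIV. A k i j * A k i j) = 6 * b2"
    unfolding AA[symmetric] by (rule sum_rot3[symmetric])
  have AX2: "(\<Sum>i\<in>UNIV. \<Sum>j\<in>UNIV. \<Sum>k\<in>UNIV. A i k j * A k i j) = 3 * b2"
    using AX by (subst sum_swap3)
  have AX3: "(\<Sum>i\<in>UNIV. \<Sum>j\<in>UNIV. \<Sum>k\<in>UNIV. A j k i * A k j i) = 3 * b2"
    using AX by (subst sum_rot3)
  have "(\<Sum>i\<in>UNIV. \<Sum>j\<in>UNIV. \<Sum>k\<in>UNIV. (\<eta> i j k)\<^sup>2)
     = (\<Sum>i\<in>UNIV. \<Sum>j\<in>UNIV. \<Sum>k\<in>UNIV. A i j k * A i j k + A j i k * A j i k + A k i j * A k i j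
         - 2 * (A i j k * A j i k) - 2 * (A i k j * A k i j) - 2 * (A j k i * A k j i))"
  proof (intro sum.cong refl)
    fix i j k
    show "(\<eta> i j k)\<^sup>2 = A i j k * A i j k + A j i k * A j i k + A k i j * A k i j
         - 2 * (A i j k * A j i k) - 2 * (A i k j * A k i j) - 2 * (A j k i * A k j i)"
      unfolding \<eta>_def A2[of i j k] A2[of j i k] A2[of k i j] by algebra
  qed
  also have "\<dots> = 6 * b2 + 6 * b2 + 6 * b2 - 2 * (3 * b2) - 2 * (3 * b2) - 2 * (3 * b2)"
    by (simp only: sum.distrib sum_subtractf sum_distrib_left[symmetric] AA AA2 AA3 AX AX2 AX3)
  finally have s0: "(\<Sum>i\<in>UNIV. \<Sum>j\<in>UNIV. \<Sum>k\<in>UNIV. (\<eta> i j k)\<^sup>2) = 0" by simp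
  have "(\<eta> i j k)\<^sup>2 = 0" for i j k
  proof -
    have "\<forall>i\<in>UNIV. (\<Sum>j\<in>UNIV. \<Sum>k\<in>UNIV. (\<eta> i j k)\<^sup>2) = 0"
      using s0 by (subst (asm) sum_nonneg_eq_0_iff) (auto intro!: sum_nonneg)
    then have "\<forall>j\<in>UNIV. (\<Sum>k\<in>UNIV. (\<eta> i j k)\<^sup>2) = 0"
      by (subst (asm) sum_nonneg_eq_0_iff) (auto intro!: sum_nonneg)
    then show ?thesis by (subst (asm) sum_nonneg_eq_0_iff) auto
  qed
  then have "\<eta> i j k = 0" by simp
  moreover have "A j i k = - A j k i" by (rule A2)
  ultimately show ?thesis unfolding \<eta>_def A_def by simp
qed

end

context g2_tensors
begin

text \<open>The antisymmetrisation \<open>\<Lambda>\<^sup>3 \<otimes> \<Lambda>\<^sup>2 \<rightarrow> \<Lambda>\<^sup>2 \<otimes> \<Lambda>\<^sup>3\<close> is injective.\<close>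

lemma alternating_swap_zero:
  fixes z :: "'i \<Rightarrow> 'i \<Rightarrow> 'i \<Rightarrow> 'i \<Rightarrow> 'i \<Rightarrow> real"
  assumes z1: "\<And>i j k a b. z j i k a b = - z i j k a b" and z2: "\<And>i j k a b. z i k j a b = - z i j k a b"
    and z3: "\<And>i j k a b. z i j k b a = - z i j k a b"
    and E: "\<And>i j k a b. z i j k a b + z i j a b k + z i j b k a = 0"
  shows "z i j k a b = 0"
proof -
  have zp: "z j i k a b = - z i j k a b" "z i k j a b = - z i j k a b" "z j k i a b = z i j k a b" "z k i j a b = z i j k a b" "z k j i a b = - z i j k a b"
    "z i j k b a = - z i j k a b" "z j i k b a = z i j k a b" "z i k j b a = z i j k a b" "z j k i b a = - z i j k a b" "z k i j b a = - z i j k a b" "z k j i b a = z i j k a b"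
    for i j k a b
    using z1[of i j k a b] z2[of i j k a b] z1[of k j i a b] z1[of i k j a b] z2[of j i k a b] z2[of k i j a b]
      z3[of i j k a b] z3[of j i k a b] z3[of i k j a b] z3[of j k i a b] z3[of k i j a b] z3[of k j i a b] z1[of j k i a b]
    by linarith+
  note zps = zp[where i=k and j=a and k=b and a=i and b=j] zp[where i=j and j=a and k=b and a=i and b=k] zp[where i=j and j=k and k=b and a=i and b=a] zp[where i=j and j=k and k=a and a=i and b=b]
      zp[where i=i and j=a and k=b and a=j and b=k] zp[where i=i and j=k and k=b and a=j and b=a] zp[where i=i and j=k and k=a and a=j and b=b] zp[where i=i and j=j and k=b and a=k and b=a]
      zp[where i=i and j=j and k=a and a=k and b=b] zp[where i=i and j=j and k=k and a=a and b=b]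
  \<comment> \<open>Up to sign z has ten values on rearrangements of the five indices, one for each
    splitting into three and two. The ten instances of \<open>E\<close>, one for each pair kept in
    the first two slots, force them to vanish.\<close>
  show ?thesis
    using E[of i j k a b, unfolded zps] E[of i k j a b, unfolded zps]
      E[of i a j k b, unfolded zps] E[of i b j k a, unfolded zps]
      E[of j k i a b, unfolded zps] E[of j a i k b, unfolded zps]
      E[of j b i k a, unfolded zps] E[of k a i j b, unfolded zps]
      E[of k b i j a, unfolded zps] E[of a b i j k, unfolded zps]
    by linarith
qed

text \<open>The aim is that the contraction Y of b with the 3-form vanishes. For a fixed first index
  its antisymmetric part \<alpha> satisfies the hypothesis of \<open>Omega14_derivation\<close>,
  hence annihilates the 3-form and is orthogonal to Y. Once Y = 0, the same lemma applies to each
  2-form \<open>b i j\<close> and supplies the cyclic identity for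
  \<open>alternating_swap_zero\<close>.\<close>

lemma four_form_zero:
  assumes b1: "\<And>i j k l. b j i k l = - b i j k l" and b2: "\<And>i j k l. b i k j l = - b i j k l" and b3: "\<And>i j k l. b i j l k = - b i j k l"
    and z: "\<And>i m. (\<Sum>j\<in>UNIV. \<Sum>k\<in>UNIV. \<Sum>l\<in>UNIV. b i j k l * \<psi> $ m $ j $ k $ l) = 0"
  shows "b i j k l = 0"
proof -
  have b0: "b i j j l = 0" "b i j k j = 0" for i j k l
    using b2[of i j j l] b3[of i j k j] b2[of i j j k] by linarith+
  define Y where "Y i j m = (\<Sum>k\<in>UNIV. \<Sum>l\<in>UNIV. b i j k l * f $ k $ l $ m)" for i j m
  have Y1: "Y j i m = - Y i j m" for i j m
    unfolding Y_def by (simp add: b1[of j i] sum_negf)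
  \<comment> \<open>The contraction identity leaves minus the contraction of b with \<psi> over
    three indices; the metric terms vanish because b is alternating.\<close>
  have Yf: "(\<Sum>j\<in>UNIV. \<Sum>m\<in>UNIV. Y i j m * f $ j $ m $ n) = 0" for i n
  proof -
    have "(\<Sum>m\<in>UNIV. Y i j m * f $ j $ m $ n) = (\<Sum>k\<in>UNIV. \<Sum>l\<in>UNIV. b i j k l * (\<Sum>m\<in>UNIV. f $ k $ l $ m * f $ j $ m $ n))" for j
      unfolding Y_def sum_distrib_right sum_distrib_left
      by (subst sum_rot3) (simp only: mult.assoc)
    moreover have "(\<Sum>m\<in>UNIV. f $ k $ l $ m * f $ j $ m $ n) = - kron k j * kron l n + kron k n * kron l j - \<psi> $ n $ j $ k $ l" for j k l
    proof -
      have "(\<Sum>m\<in>UNIV. f $ k $ l $ m * f $ j $ m $ n) = (\<Sum>m\<in>UNIV. - (f $ k $ l $ m * f $ j $ n $ m))"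
        by (intro sum.cong refl) (simp add: f_alt(2)[of j _ n])
      moreover have "\<psi> $ k $ l $ j $ n = - \<psi> $ n $ j $ k $ l"
        using psi_alt(3)[of k l j n] psi_alt(2)[of k n l j] psi_alt(1)[of k n l j]
          psi_alt(3)[of n k l j] psi_alt(2)[of n k j l] psi_alt(3)[of k l n j] psi_alt(2)[of n j k l] psi_alt(3)[of n k j l]
        by linarith
      ultimately show ?thesis unfolding sum_negf ff by simp
    qed
    ultimately have "(\<Sum>m\<in>UNIV. Y i j m * f $ j $ m $ n)
      = (\<Sum>k\<in>UNIV. \<Sum>l\<in>UNIV. b i j k l * (- kron k j * kron l n + kron k n * kron l j - \<psi> $ n $ j $ k $ l))" for j
      by simp
    also have "\<dots> j = - b i j j n + b i j n j - (\<Sum>k\<in>UNIV. \<Sum>l\<in>UNIV. b i j k l * \<psi> $ n $ j $ k $ l)" for j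
    proof -
      have "(\<Sum>l\<in>UNIV. b i j k l * (- kron k j * kron l n + kron k n * kron l j - \<psi> $ n $ j $ k $ l))
        = - (b i j k n * kron k j) + b i j k j * kron k n - (\<Sum>l\<in>UNIV. b i j k l * \<psi> $ n $ j $ k $ l)" for k
      proof -
        have "(\<Sum>l\<in>UNIV. b i j k l * (- kron k j * kron l n + kron k n * kron l j - \<psi> $ n $ j $ k $ l))
          = (\<Sum>l\<in>UNIV. - (b i j k l * kron k j * kron l n) + b i j k l * kron k n * kron l j - b i j k l * \<psi> $ n $ j $ k $ l)"
          by (intro sum.cong refl) algebra
        then show ?thesis by (simp only: sum.distrib sum_subtractf sum_negf sum_mult_kron)
      qed
      then show ?thesis by (simp only: sum.distrib sum_subtractf sum_negf sum_mult_kron)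
    qed
    finally have "(\<Sum>m\<in>UNIV. Y i j m * f $ j $ m $ n) = - (\<Sum>k\<in>UNIV. \<Sum>l\<in>UNIV. b i j k l * \<psi> $ n $ j $ k $ l)" for j
      by (simp add: b0)
    then show ?thesis using z[of i n] by (simp add: sum_negf)
  qed
  have Ysym: "Y i j m = Y i m j" for i j m
  proof -
    define \<alpha> where "\<alpha> j m = Y i j m - Y i m j" for j m
    have anti: "\<alpha> m j = - \<alpha> j m" for j m by (simp add: \<alpha>_def)
    have "(\<Sum>j\<in>UNIV. \<Sum>m\<in>UNIV. \<alpha> j m * f $ j $ m $ n) = 0" for n
    proof -
      have "(\<Sum>j\<in>UNIV. \<Sum>m\<in>UNIV. Y i m j * f $ j $ m $ n) = (\<Sum>j\<in>UNIV. \<Sum>m\<in>UNIV. - (Y i j m * f $ j $ m $ n))"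
      proof (subst sum.swap, intro sum.cong refl)
        fix m j
        show "Y i j m * f $ m $ j $ n = - (Y i j m * f $ j $ m $ n)" using f_alt(1)[of m j n] by simp
      qed
      then show ?thesis unfolding \<alpha>_def left_diff_distrib sum_subtractf using Yf[of i n] by (simp add: sum_negf)
    qed
    note d = Omega14_derivation[of \<alpha>, OF anti this]
    define s where "s j k l = (\<Sum>p\<in>UNIV. \<alpha> j p * f $ p $ k $ l)" for j k l
    have s: "s j k l + s k l j + s l j k = 0" for j k l unfolding s_def by (rule d)
    have bs: "(\<Sum>j\<in>UNIV. \<Sum>m\<in>UNIV. \<alpha> j m * Y i j m) = (\<Sum>j\<in>UNIV. \<Sum>k\<in>UNIV. \<Sum>l\<in>UNIV. b i j k l * s j k l)"
    proof (rule sum.cong[OF refl])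
      fix j
      have "(\<Sum>m\<in>UNIV. \<alpha> j m * Y i j m) = (\<Sum>m\<in>UNIV. \<Sum>k\<in>UNIV. \<Sum>l\<in>UNIV. b i j k l * (\<alpha> j m * f $ m $ k $ l))"
        unfolding Y_def sum_distrib_left
      proof (intro sum.cong refl)
        fix m k l
        show "\<alpha> j m * (b i j k l * f $ k $ l $ m) = b i j k l * (\<alpha> j m * f $ m $ k $ l)"
          unfolding f_cyc(2)[of m k l] by simp
      qed
      then show "(\<Sum>m\<in>UNIV. \<alpha> j m * Y i j m) = (\<Sum>k\<in>UNIV. \<Sum>l\<in>UNIV. b i j k l * s j k l)"
        unfolding s_def sum_distrib_left by (rule trans[OF _ sum_rot3])
    qed
    have bcyc: "b i k l j = b i j k l" "b i l j k = b i j k l" for j k l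
      using b2[of i j k l] b3[of i k j l] b3[of i j k l] b2[of i j l k] by linarith+
    have 1: "(\<Sum>j\<in>UNIV. \<Sum>k\<in>UNIV. \<Sum>l\<in>UNIV. b i j k l * s k l j) = (\<Sum>j\<in>UNIV. \<Sum>k\<in>UNIV. \<Sum>l\<in>UNIV. b i j k l * s j k l)"
      by (subst sum_rot3) (simp only: bcyc(2))
    have 2: "(\<Sum>j\<in>UNIV. \<Sum>k\<in>UNIV. \<Sum>l\<in>UNIV. b i j k l * s l j k) = (\<Sum>j\<in>UNIV. \<Sum>k\<in>UNIV. \<Sum>l\<in>UNIV. b i j k l * s j k l)"
      by (subst (2) sum_rot3) (simp only: bcyc(2))
    \<comment> \<open>b is invariant under cyclic rotation of its last three indices, so pairing it
      with the cyclic sum gives three times the pairing with one term.\<close>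
    have "(\<Sum>j\<in>UNIV. \<Sum>k\<in>UNIV. \<Sum>l\<in>UNIV. b i j k l * (s j k l + s k l j + s l j k)) = 0" unfolding s by simp
    then have "3 * (\<Sum>j\<in>UNIV. \<Sum>k\<in>UNIV. \<Sum>l\<in>UNIV. b i j k l * s j k l) = 0"
      by (simp only: distrib_left sum.distrib 1 2)
    then have aY: "(\<Sum>j\<in>UNIV. \<Sum>m\<in>UNIV. \<alpha> j m * Y i j m) = 0" unfolding bs by simp
    have aY': "(\<Sum>j\<in>UNIV. \<Sum>m\<in>UNIV. \<alpha> j m * Y i m j) = - (\<Sum>j\<in>UNIV. \<Sum>m\<in>UNIV. \<alpha> j m * Y i j m)"
    proof -
      have "(\<Sum>j\<in>UNIV. \<Sum>m\<in>UNIV. \<alpha> j m * Y i m j) = (\<Sum>j\<in>UNIV. \<Sum>m\<in>UNIV. \<alpha> m j * Y i j m)" by (rule sum.swap)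
      also have "\<dots> = (\<Sum>j\<in>UNIV. \<Sum>m\<in>UNIV. - (\<alpha> j m * Y i j m))"
        by (intro sum.cong refl) (simp add: \<alpha>_def algebra_simps)
      finally show ?thesis by (simp add: sum_negf)
    qed
    have "(\<Sum>j\<in>UNIV. \<Sum>m\<in>UNIV. \<alpha> j m * \<alpha> j m) = (\<Sum>j\<in>UNIV. \<Sum>m\<in>UNIV. \<alpha> j m * Y i j m - \<alpha> j m * Y i m j)"
      by (intro sum.cong refl) (simp add: \<alpha>_def right_diff_distrib)
    also have "\<dots> = 0" unfolding sum_subtractf aY' aY by simp
    finally have a0: "(\<Sum>j\<in>UNIV. \<Sum>m\<in>UNIV. \<alpha> j m * \<alpha> j m) = 0" .
    then have "\<forall>j\<in>UNIV. (\<Sum>m\<in>UNIV. \<alpha> j m * \<alpha> j m) = 0"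
      by (subst (asm) sum_nonneg_eq_0_iff) (auto intro!: sum_nonneg)
    then have "\<alpha> j m * \<alpha> j m = 0"
      by (subst (asm) sum_nonneg_eq_0_iff) (auto intro!: sum_nonneg)
    then show ?thesis by (simp add: \<alpha>_def)
  qed
  \<comment> \<open>A tensor antisymmetric in its first pair of indices and symmetric in its last
    pair is zero.\<close>
  have Y0: "Y i j m = 0" for i j m
    using Ysym[of i j m] Y1[of i m j] Ysym[of m i j] Y1[of m j i] Ysym[of j m i] Y1[of j i m] by linarith
  define zz where "zz i j k a c = (\<Sum>p\<in>UNIV. b i j k p * f $ p $ a $ c)" for i j k a c
  have zz0: "zz i j k a c = 0" for i j k a c
  proof (rule alternating_swap_zero[of zz])
    show "zz j i k a b = - zz i j k a b" for i j k a b unfolding zz_def by (simp add: b1[of j i] sum_negf)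
    show "zz i k j a b = - zz i j k a b" for i j k a b unfolding zz_def by (simp add: b2[of i k j] sum_negf)
    show "zz i j k b a = - zz i j k a b" for i j k a b unfolding zz_def by (simp add: f_alt(2)[of _ b a] sum_negf)
    show "zz i j k a c + zz i j a c k + zz i j c k a = 0" for i j k a c
      unfolding zz_def
    proof (rule Omega14_derivation)
      show "b i j l k = - b i j k l" for k l by (rule b3)
      show "(\<Sum>k\<in>UNIV. \<Sum>l\<in>UNIV. b i j k l * f $ k $ l $ m) = 0" for m using Y0[of i j m] by (simp add: Y_def)
    qed
  qed
  have "(\<Sum>a\<in>UNIV. \<Sum>c\<in>UNIV. zz i j k a c * f $ a $ c $ l) = (\<Sum>p\<in>UNIV. b i j k p * (\<Sum>a\<in>UNIV. \<Sum>c\<in>UNIV. f $ a $ c $ p * f $ a $ c $ l))"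
  proof -
    have "(\<Sum>a\<in>UNIV. \<Sum>c\<in>UNIV. zz i j k a c * f $ a $ c $ l) = (\<Sum>a\<in>UNIV. \<Sum>c\<in>UNIV. \<Sum>p\<in>UNIV. b i j k p * (f $ a $ c $ p * f $ a $ c $ l))"
      unfolding zz_def sum_distrib_right
    proof (intro sum.cong refl)
      fix a c p
      show "b i j k p * f $ p $ a $ c * f $ a $ c $ l = b i j k p * (f $ a $ c $ p * f $ a $ c $ l)"
        unfolding f_cyc(2)[of p a c] by simp
    qed
    then show ?thesis unfolding sum_distrib_left by (rule trans[OF _ sum_rot3[symmetric]])
  qed
  also have "\<dots> = 6 * b i j k l"
    unfolding ff2 by (simp only: mult.left_commute[of _ 6] sum_distrib_left[symmetric] sum_mult_kron)
  finally show ?thesis by (simp add: zz0)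
qed

end

section \<open>Block decomposition of the curvature operator\<close>

abbreviation (input) tr :: "real^'n^'m \<Rightarrow> real^'m^'n" where
  "tr \<equiv> Finite_Cartesian_Product.transpose"

lemma sum_UNIV_prod: "(\<Sum>\<kappa>\<in>(UNIV :: ('a::finite \<times> 'b::finite) set). h \<kappa>) = (\<Sum>i\<in>UNIV. \<Sum>j\<in>UNIV. h (i, j))"
  by (simp add: sum.cartesian_product)

lemma inner_matrix_mult_left:
  fixes A :: "real^'n^'m" and B :: "real^'p^'n" and C :: "real^'p^'m"
  shows "(A ** B) \<bullet> C = B \<bullet> (tr A ** C)"
proof -
  have "(A ** B) \<bullet> C = (\<Sum>i\<in>UNIV. \<Sum>k\<in>UNIV. \<Sum>j\<in>UNIV. A $ i $ j * B $ j $ k * C $ i $ k)"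
    by (simp add: inner_vec_def matrix_matrix_mult_def sum_distrib_right)
  also have "\<dots> = (\<Sum>i\<in>UNIV. \<Sum>j\<in>UNIV. \<Sum>k\<in>UNIV. A $ i $ j * B $ j $ k * C $ i $ k)"
    by (rule sum_swap3)
  also have "\<dots> = (\<Sum>j\<in>UNIV. \<Sum>k\<in>UNIV. \<Sum>i\<in>UNIV. A $ i $ j * B $ j $ k * C $ i $ k)"
    by (rule sum_rot3)
  also have "\<dots> = B \<bullet> (tr A ** C)"
    by (simp add: inner_vec_def matrix_matrix_mult_def Finite_Cartesian_Product.transpose_def sum_distrib_left mult_ac)
  finally show ?thesis .
qed

lemma inner_transpose: "tr A \<bullet> tr B = A \<bullet> (B :: real^'n^'m)"
  by (simp add: inner_vec_def Finite_Cartesian_Product.transpose_def) (rule sum.swap)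

lemma inner_matrix_mult_right:
  fixes A :: "real^'n^'m" and B :: "real^'p^'n" and C :: "real^'p^'m"
  shows "(A ** B) \<bullet> C = A \<bullet> (C ** tr B)"
proof -
  have "(A ** B) \<bullet> C = (tr B ** tr A) \<bullet> tr C" by (metis inner_transpose matrix_transpose_mul)
  also have "\<dots> = tr A \<bullet> (B ** tr C)" by (simp add: inner_matrix_mult_left)
  also have "\<dots> = A \<bullet> (C ** tr B)" by (metis inner_transpose matrix_transpose_mul transpose_transpose)
  finally show ?thesis .
qed

text \<open>The adjoint of B \<mapsto> L B R. With symmetric projections L and R it makes the
  passage to the blocks of an operator self-adjoint.\<close>

lemma inner_sandwich:
  fixes A :: "real^'n^'m" and B :: "real^'q^'p" and L :: "real^'p^'m" and R :: "real^'n^'q"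
  shows "A \<bullet> (L ** B ** R) = (tr L ** A ** tr R) \<bullet> B"
proof -
  have "A \<bullet> (L ** B ** R) = (L ** (B ** R)) \<bullet> A" by (simp only: inner_commute matrix_mul_assoc)
  also have "\<dots> = (B ** R) \<bullet> (tr L ** A)" by (rule inner_matrix_mult_left)
  also have "\<dots> = B \<bullet> (tr L ** A ** tr R)" by (rule inner_matrix_mult_right)
  finally show ?thesis by (simp only: inner_commute)
qed

lemma matrix_mult_diff:
  fixes A A' :: "real^'n^'m" and B B' :: "real^'p^'n"
  shows "(A - A') ** B = A ** B - A' ** B" "A ** (B - B') = A ** B - A ** B'"
  by (simp_all add: matrix_matrix_mult_def vec_eq_iff left_diff_distrib right_diff_distrib sum_subtractf)

lemma matrix_mult_add:
  fixes A A' :: "real^'n^'m" and B B' :: "real^'p^'n"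
  shows "(A + A') ** B = A ** B + A' ** B" "A ** (B + B') = A ** B + A ** B'"
  by (simp_all add: matrix_matrix_mult_def vec_eq_iff distrib_left distrib_right sum.distrib)

lemma matrix_mult_zero: "(0 :: real^'n^'m) ** (B :: real^'p^'n) = 0" "(A :: real^'n^'m) ** (0 :: real^'p^'n) = 0"
  by (simp_all add: matrix_matrix_mult_def vec_eq_iff)

lemma transpose_linear:
  fixes A B :: "real^'n^'m"
  shows "tr (A + B) = tr A + tr B" "tr (A - B) = tr A - tr B" "tr (r *\<^sub>R A) = r *\<^sub>R tr A"
  by (simp_all add: Finite_Cartesian_Product.transpose_def vec_eq_iff)

text \<open>A tensor with four indices is treated as a matrix whose rows and columns are indexed by pairs,
  so that composition of operators on 2-forms becomes a matrix product.\<close>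

definition mat4 :: "tensor4 \<Rightarrow> real^(7 \<times> 7)^(7 \<times> 7)" where
  "mat4 U = (\<chi> \<kappa> \<mu>. U $ fst \<kappa> $ snd \<kappa> $ fst \<mu> $ snd \<mu>)"

definition ten4 :: "real^(7 \<times> 7)^(7 \<times> 7) \<Rightarrow> tensor4" where
  "ten4 M = (\<chi> i j k l. M $ (i, j) $ (k, l))"

definition vec2 :: "tensor2 \<Rightarrow> real^(7 \<times> 7)" where
  "vec2 \<beta> = (\<chi> \<kappa>. \<beta> $ fst \<kappa> $ snd \<kappa>)"

definition ten2 :: "real^(7 \<times> 7) \<Rightarrow> tensor2" where
  "ten2 v = (\<chi> i j. v $ (i, j))"

lemma mat4_nth: "mat4 U $ (i, j) $ (k, l) = U $ i $ j $ k $ l"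
  and ten4_nth: "ten4 M $ i $ j $ k $ l = M $ (i, j) $ (k, l)"
  and vec2_nth: "vec2 \<beta> $ (i, j) = \<beta> $ i $ j"
  and ten2_nth: "ten2 v $ i $ j = v $ (i, j)"
  by (simp_all add: mat4_def ten4_def vec2_def ten2_def)

lemma mat4_ten4: "mat4 (ten4 M) = M" and ten4_mat4: "ten4 (mat4 U) = U"
  and vec2_ten2: "vec2 (ten2 v) = v" and ten2_vec2: "ten2 (vec2 \<beta>) = \<beta>"
  by (simp_all add: vec_eq_iff mat4_def ten4_def vec2_def ten2_def)

lemma mat4_linear: "mat4 (U + V) = mat4 U + mat4 V" "mat4 (U - V) = mat4 U - mat4 V" "mat4 (r *\<^sub>R U) = r *\<^sub>R mat4 U"
  and ten4_linear: "ten4 (M + M') = ten4 M + ten4 M'" "ten4 (M - M') = ten4 M - ten4 M'"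
  by (simp_all add: mat4_def ten4_def vec_eq_iff)

lemma mat4_eq_0: "mat4 U = 0 \<longleftrightarrow> U = 0"
  by (auto simp: mat4_def vec_eq_iff)

lemma mat4_inner: "mat4 U \<bullet> mat4 V = U \<bullet> V"
  by (simp add: inner_vec_def sum_UNIV_prod mat4_nth)

lemma vec2_inner: "vec2 \<alpha> \<bullet> vec2 \<beta> = \<alpha> \<bullet> \<beta>"
  by (simp add: inner_vec_def sum_UNIV_prod vec2_nth)

lemma vec2_curv_op: "vec2 (curv_op U \<beta>) = mat4 U *v vec2 \<beta>"
  by (simp add: vec_eq_iff vec2_def curv_op_def matrix_vector_mult_def sum_UNIV_prod mat4_def)

text \<open>The column type is left free so that \<open>Phi\<close> is covered too. For a matrix
  equal to its transpose, antisymmetry in the row pair gives antisymmetry in the column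
  pair.\<close>

definition row_anti :: "real^'n^(7 \<times> 7) \<Rightarrow> bool" where
  "row_anti M \<longleftrightarrow> (\<forall>i j \<mu>. M $ (j, i) $ \<mu> = - M $ (i, j) $ \<mu>)"

lemma row_antiD: "row_anti A \<Longrightarrow> A $ (j, i) $ \<mu> = - A $ (i, j) $ \<mu>"
  unfolding row_anti_def by blast

lemma row_antiI: "(\<And>i j \<mu>. A $ (j, i) $ \<mu> = - A $ (i, j) $ \<mu>) \<Longrightarrow> row_anti A"
  unfolding row_anti_def by blast

lemma row_anti_mult: "row_anti A \<Longrightarrow> row_anti (A ** B)"
proof (rule row_antiI)
  fix i j \<mu> assume A: "row_anti A"
  show "(A ** B) $ (j, i) $ \<mu> = - (A ** B) $ (i, j) $ \<mu>"
    unfolding matrix_matrix_mult_def vec_lambda_beta row_antiD[OF A, of j i] by (simp add: sum_negf)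
qed

lemma row_anti_linear: "row_anti A \<Longrightarrow> row_anti B \<Longrightarrow> row_anti (A + B)" "row_anti A \<Longrightarrow> row_anti B \<Longrightarrow> row_anti (A - B)"
  "row_anti A \<Longrightarrow> row_anti (r *\<^sub>R A)"
proof -
  assume A: "row_anti A"
  show "row_anti (r *\<^sub>R A)" by (rule row_antiI, simp only: vector_scaleR_component, subst row_antiD[OF A], simp)
  assume B: "row_anti B"
  show "row_anti (A + B)" by (rule row_antiI, simp only: vector_add_component, subst row_antiD[OF A], subst row_antiD[OF B], simp)
  show "row_anti (A - B)" by (rule row_antiI, simp only: vector_minus_component, subst row_antiD[OF A], subst row_antiD[OF B], simp)
qed

lemma curv_symD:
  assumes "U \<in> curv_sym"
  shows "U $ j $ i $ k $ l = - U $ i $ j $ k $ l" "U $ i $ j $ l $ k = - U $ i $ j $ k $ l" "U $ k $ l $ i $ j = U $ i $ j $ k $ l"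
proof -
  have U: "\<forall>i j k l. U $ i $ j $ k $ l = - U $ j $ i $ k $ l \<and> U $ i $ j $ k $ l = - U $ i $ j $ l $ k \<and> U $ i $ j $ k $ l = U $ k $ l $ i $ j"
    using assms unfolding curv_sym_def by blast
  show "U $ j $ i $ k $ l = - U $ i $ j $ k $ l" using U by blast
  show "U $ i $ j $ l $ k = - U $ i $ j $ k $ l" using U by blast
  show "U $ k $ l $ i $ j = U $ i $ j $ k $ l" using U by blast
qed

lemma pair_matrix_ext: "(\<And>i j k l. A $ (i, j) $ (k, l) = B $ (i, j) $ (k, l)) \<Longrightarrow> A = (B :: real^('a::finite \<times> 'b::finite)^('c::finite \<times> 'd::finite))"
  unfolding vec_eq_iff by auto

lemma transpose_nth: "tr A $ i $ j = A $ j $ i"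
  by (simp add: Finite_Cartesian_Product.transpose_def)

lemma curv_sym_mat4: "U \<in> curv_sym \<longleftrightarrow> row_anti (mat4 U) \<and> tr (mat4 U) = mat4 U"
proof
  assume U: "U \<in> curv_sym"
  have "mat4 U $ (j, i) $ \<mu> = - mat4 U $ (i, j) $ \<mu>" for i j \<mu>
    by (cases \<mu>) (simp only: mat4_nth, rule curv_symD(1)[OF U])
  moreover have "tr (mat4 U) = mat4 U"
    by (rule pair_matrix_ext) (simp only: transpose_nth mat4_nth, rule curv_symD(3)[OF U])
  ultimately show "row_anti (mat4 U) \<and> tr (mat4 U) = mat4 U" unfolding row_anti_def by blast
next
  assume a: "row_anti (mat4 U) \<and> tr (mat4 U) = mat4 U"
  have r: "U $ j $ i $ k $ l = - U $ i $ j $ k $ l" for i j k l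
  proof -
    have "mat4 U $ (j, i) $ (k, l) = - mat4 U $ (i, j) $ (k, l)" using a unfolding row_anti_def by blast
    then show ?thesis by (simp only: mat4_nth)
  qed
  have s: "U $ k $ l $ i $ j = U $ i $ j $ k $ l" for i j k l
  proof -
    have "tr (mat4 U) $ (i, j) $ (k, l) = mat4 U $ (i, j) $ (k, l)" using a by simp
    then show ?thesis by (simp only: mat4_nth transpose_nth)
  qed
  show "U \<in> curv_sym"
    unfolding curv_sym_def mem_Collect_eq
  proof (intro allI conjI)
    fix i j k l
    show "U $ i $ j $ k $ l = - U $ j $ i $ k $ l" by (rule r)
    show "U $ i $ j $ k $ l = - U $ i $ j $ l $ k"
      using s[of i j k l] r[of l k i j] s[of i j l k] by linarith
    show "U $ i $ j $ k $ l = U $ k $ l $ i $ j" by (rule s)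
  qed
qed

text \<open>Stated for matrices because it is also applied to one-sided products such as
  \<open>mat4 U ** Q\<close>, which lack the pair symmetry of a curvature tensor.\<close>

definition ricm :: "real^(7 \<times> 7)^(7 \<times> 7) \<Rightarrow> tensor2" where
  "ricm M = (\<chi> j k. \<Sum>l\<in>UNIV. M $ (l, j) $ (k, l))"

lemma ric_ten4: "ric (ten4 M) = ricm M" and ricm_mat4: "ricm (mat4 U) = ric U"
  by (simp_all add: ric_def ricm_def ten4_nth mat4_nth)

lemma ricm_linear: "ricm (A + B) = ricm A + ricm B" "ricm (A - B) = ricm A - ricm B" "ricm (r *\<^sub>R A) = r *\<^sub>R ricm A"
  by (simp_all add: ricm_def vec_eq_iff sum.distrib sum_subtractf sum_distrib_left)

definition trace2 :: "tensor2 \<Rightarrow> real" where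
  "trace2 h = (\<Sum>j\<in>UNIV. h $ j $ j)"

lemma ric_sym: "U \<in> curv_sym \<Longrightarrow> ric U $ k $ j = ric U $ j $ k"
proof -
  assume U: "U \<in> curv_sym"
  have "U $ l $ k $ j $ l = U $ l $ j $ k $ l" for l
    using curv_symD(3)[OF U, of j l l k] curv_symD(1)[OF U, of l j l k] curv_symD(2)[OF U, of l j k l] by linarith
  then show ?thesis by (simp add: ric_def)
qed

context g2_tensors
begin

definition Phi :: "real^7^(7 \<times> 7)" where
  "Phi = (\<chi> \<kappa> q. f $ fst \<kappa> $ snd \<kappa> $ q)"

definition Q :: "real^(7 \<times> 7)^(7 \<times> 7)" where
  "Q = (1 / 6) *\<^sub>R (Phi ** tr Phi)"

text \<open>As a matrix on all 2-tensors \<open>P\<close> also fixes the symmetric ones; on 2-forms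
  it is the projection to the 14-dimensional summand.\<close>

definition P :: "real^(7 \<times> 7)^(7 \<times> 7)" where
  "P = mat 1 - Q"

lemma Phi_nth: "Phi $ (i, j) $ q = f $ i $ j $ q" by (simp add: Phi_def)

lemma Phi_Phi: "tr Phi ** Phi = 6 *\<^sub>R mat 1"
  using ff2 by (simp add: vec_eq_iff matrix_matrix_mult_def Finite_Cartesian_Product.transpose_def sum_UNIV_prod Phi_nth mat_def)

lemma Q_Phi: "Q ** Phi = Phi"
  unfolding Q_def scaleR_matrix_mult matrix_mul_assoc[symmetric] Phi_Phi by (simp add: scaleR_matrix_mult)

lemma tr_Q: "tr Q = Q" by (simp add: Q_def transpose_linear matrix_transpose_mul)

lemma tr_P: "tr P = P" by (simp add: P_def transpose_linear tr_Q)

lemma Phi_Q: "tr Phi ** Q = tr Phi"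
  using Q_Phi tr_Q by (metis matrix_transpose_mul)

lemma QQ: "Q ** Q = Q"
proof -
  have "Q ** Q = Q ** ((1 / 6) *\<^sub>R (Phi ** tr Phi))" by (subst (2) Q_def) (rule refl)
  then have "Q ** Q = (1 / 6) *\<^sub>R (Q ** Phi ** tr Phi)" by (simp only: scaleR_matrix_mult matrix_mul_assoc)
  then show ?thesis unfolding Q_Phi by (simp only: Q_def)
qed

lemma PQ: "P ** Q = 0" "Q ** P = 0" "P ** P = P"
  by (simp_all add: P_def matrix_mult_diff QQ)

lemma P_Phi: "P ** Phi = 0" "tr Phi ** P = 0"
  by (simp_all add: P_def matrix_mult_diff Q_Phi Phi_Q)

lemma row_anti_Phi: "row_anti Phi"
  by (rule row_antiI, simp only: Phi_nth, rule f_alt(1))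

lemma row_anti_Q: "row_anti Q"
  unfolding Q_def by (intro row_anti_linear row_anti_mult row_anti_Phi)

lemma varpi_Phi: "varpi f U = tr Phi ** mat4 U ** Phi"
proof -
  have "varpi f U $ p $ q = (tr Phi ** (mat4 U ** Phi)) $ p $ q" for p q
    by (simp add: varpi_def matrix_matrix_mult_def Finite_Cartesian_Product.transpose_def sum_UNIV_prod Phi_nth mat4_nth
        sum_distrib_left mult_ac)
  then show ?thesis by (simp add: vec_eq_iff matrix_mul_assoc)
qed

lemma row_anti_P_mult: "row_anti A \<Longrightarrow> row_anti (P ** A)"
  unfolding P_def matrix_mult_diff by (simp add: row_anti_linear row_anti_mult row_anti_Q)

definition diag14 :: "tensor4 \<Rightarrow> tensor4" where "diag14 U = ten4 (P ** mat4 U ** P)"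
definition offdiag :: "tensor4 \<Rightarrow> tensor4" where "offdiag U = ten4 (P ** mat4 U ** Q + Q ** mat4 U ** P)"
definition diag7 :: "tensor4 \<Rightarrow> tensor4" where "diag7 U = ten4 (Q ** mat4 U ** Q)"

lemma decompose: "U = diag7 U + offdiag U + diag14 U"
proof -
  have "mat4 U = (Q + P) ** mat4 U ** (Q + P)" by (simp add: P_def)
  also have "\<dots> = Q ** mat4 U ** Q + (P ** mat4 U ** Q + Q ** mat4 U ** P) + P ** mat4 U ** P"
    by (simp only: matrix_mult_add) (simp add: ac_simps)
  finally have "ten4 (mat4 U) = ten4 (Q ** mat4 U ** Q + (P ** mat4 U ** Q + Q ** mat4 U ** P) + P ** mat4 U ** P)"
    by (rule arg_cong)
  then have "ten4 (mat4 U) = diag7 U + offdiag U + diag14 U" unfolding diag7_def offdiag_def diag14_def by (simp only: ten4_linear)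
  then show ?thesis by (simp add: ten4_mat4)
qed

lemma diag14_curv_sym: "U \<in> curv_sym \<Longrightarrow> diag14 U \<in> curv_sym"
  unfolding curv_sym_mat4 diag14_def mat4_ten4
  by (simp add: matrix_transpose_mul tr_P row_anti_P_mult row_anti_mult matrix_mul_assoc)

lemma offdiag_curv_sym: "U \<in> curv_sym \<Longrightarrow> offdiag U \<in> curv_sym"
  unfolding curv_sym_mat4 offdiag_def mat4_ten4
  by (simp add: matrix_transpose_mul transpose_linear tr_P tr_Q row_anti_P_mult row_anti_Q row_anti_mult row_anti_linear matrix_mul_assoc add.commute)

lemma inner_diag14: "U \<bullet> diag14 V = diag14 U \<bullet> V"
  unfolding mat4_inner[symmetric] diag14_def mat4_ten4
  by (simp only: inner_sandwich tr_P)

lemma diag14_diag14: "diag14 (diag14 U) = diag14 U"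
  unfolding diag14_def mat4_ten4 by (metis PQ(3) matrix_mul_assoc)

lemma inner_offdiag: "U \<bullet> offdiag V = offdiag U \<bullet> V"
  unfolding mat4_inner[symmetric] offdiag_def mat4_ten4 inner_add_left inner_add_right
  by (simp only: inner_sandwich tr_P tr_Q)

lemma offdiag_offdiag: "offdiag (offdiag U) = offdiag U"
proof -
  have "P ** (P ** A ** Q + Q ** A ** P) ** Q = P ** A ** Q" "Q ** (P ** A ** Q + Q ** A ** P) ** P = Q ** A ** P" for A
    unfolding matrix_mult_add by (simp_all add: matrix_mul_assoc PQ QQ matrix_mult_zero) (simp_all add: matrix_mul_assoc[symmetric] PQ QQ matrix_mult_zero)
  then show ?thesis unfolding offdiag_def mat4_ten4 by simp
qed

lemma varpi_offdiag: "varpi f (offdiag U) = 0"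
  unfolding varpi_Phi offdiag_def mat4_ten4 matrix_mult_add
  by (simp add: matrix_mul_assoc P_Phi matrix_mult_zero) (simp add: matrix_mul_assoc[symmetric] P_Phi matrix_mult_zero)

lemma diag14_offdiag: "diag14 (offdiag U) = 0"
  unfolding offdiag_def diag14_def mat4_ten4 matrix_mult_add
  by (simp add: matrix_mul_assoc PQ matrix_mult_zero) (simp add: matrix_mul_assoc[symmetric] PQ matrix_mult_zero ten4_def vec_eq_iff)

text \<open>\<open>Phi\<close> is injective with the same range as \<open>Q\<close>, so the block on
  the 7-dimensional summand and the 7 by 7 matrix \<open>varpi f U\<close> determine each
  other.\<close>

lemma diag7_eq_0: "diag7 U = 0 \<longleftrightarrow> varpi f U = 0"
proof
  assume "diag7 U = 0"
  then have "Q ** mat4 U ** Q = 0" by (metis diag7_def mat4_eq_0 mat4_ten4)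
  then have "tr Phi ** (Q ** mat4 U ** Q) ** Phi = 0" by (simp add: matrix_mult_zero)
  then show "varpi f U = 0" unfolding varpi_Phi by (metis Phi_Q Q_Phi matrix_mul_assoc)
next
  assume "varpi f U = 0"
  then have "Phi ** (tr Phi ** mat4 U ** Phi) ** tr Phi = 0" unfolding varpi_Phi by (simp add: matrix_mult_zero)
  then have "Q ** mat4 U ** Q = 0" unfolding Q_def scaleR_matrix_mult by (simp add: matrix_mul_assoc)
  then show "diag7 U = 0" by (simp add: diag7_def ten4_def vec_eq_iff)
qed

end

section \<open>Ricci contractions of the blocks\<close>

definition bianchi :: "tensor4 \<Rightarrow> bool" where
  "bianchi U \<longleftrightarrow> (\<forall>i j k l. U $ i $ j $ k $ l + U $ j $ k $ i $ l + U $ k $ i $ j $ l = 0)"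

lemma bianchiD: "bianchi U \<Longrightarrow> U $ i $ j $ k $ l + U $ j $ k $ i $ l + U $ k $ i $ j $ l = 0"
  by (simp only: bianchi_def)

lemma weyl_tensors_iff: "U \<in> weyl_tensors \<longleftrightarrow> U \<in> curv_sym \<and> bianchi U \<and> ric U = 0"
  unfolding weyl_tensors_def bianchi_def by blast

lemma ric_linear: "ric (U + V) = ric U + ric V" "ric (U - V) = ric U - ric V" "ric (r *\<^sub>R U) = r *\<^sub>R ric U"
  unfolding ricm_mat4[symmetric] mat4_linear ricm_linear by (rule refl)+

lemma trace2_linear: "trace2 (A + B) = trace2 A + trace2 B" "trace2 (A - B) = trace2 A - trace2 B" "trace2 (r *\<^sub>R A) = r * trace2 A"
  "trace2 0 = 0" "trace2 (mat 1) = 7"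
  by (simp_all add: trace2_def sum.distrib sum_subtractf sum_distrib_left mat_def)

lemma scal_trace: "scal U = trace2 (ric U)"
  by (simp add: scal_def trace2_def)

lemma trace_ric0: "trace2 (ric0 U) = 0"
  by (simp add: ric0_def trace2_linear scal_trace)

text \<open>The product with the metric, signed so that its Ricci contraction is 5 h plus the trace
  of h times the metric; this is the source of the factor 1/5 in the Weyl tensor.\<close>

definition kulkarni_nomizu :: "tensor2 \<Rightarrow> tensor4" where
  "kulkarni_nomizu h = (\<chi> i j k l. kron i l * h $ j $ k + kron j k * h $ i $ l - kron i k * h $ j $ l - kron j l * h $ i $ k)"

lemma kulkarni_nomizu_nth: "kulkarni_nomizu h $ i $ j $ k $ l = kron i l * h $ j $ k + kron j k * h $ i $ l - kron i k * h $ j $ l - kron j l * h $ i $ k"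
  by (simp add: kulkarni_nomizu_def)

text \<open>1/84 is half of 1/42, since each product of Kronecker symbols occurs twice in the
  \<open>kulkarni_nomizu\<close> of the identity.\<close>

lemma weyl_kulkarni_nomizu: "weyl R = R - kulkarni_nomizu ((1 / 5) *\<^sub>R ric0 R + (scal R / 84) *\<^sub>R mat 1)"
proof -
  have "weyl R $ i $ j $ k $ l = (R - kulkarni_nomizu ((1 / 5) *\<^sub>R ric0 R + (scal R / 84) *\<^sub>R mat 1)) $ i $ j $ k $ l" for i j k l
  proof -
    have m: "(mat 1 :: tensor2) $ a $ b = kron a b" for a b by (simp add: mat_def)
    show ?thesis
      unfolding vector_minus_component kulkarni_nomizu_nth vector_add_component vector_scaleR_component m weyl_def vec_lambda_beta real_scaleR_def
      by (simp add: field_simps)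
  qed
  then show ?thesis by (simp add: vec_eq_iff)
qed

lemma inner_tensor4: "U \<bullet> V = (\<Sum>i\<in>UNIV. \<Sum>j\<in>UNIV. \<Sum>k\<in>UNIV. \<Sum>l\<in>UNIV. U $ i $ j $ k $ l * (V :: tensor4) $ i $ j $ k $ l)"
  by (simp add: inner_vec_def)

text \<open>Each of the four terms contracts V to a Ricci contraction. Consequently R and its Weyl
  tensor have the same inner product with every Ricci-flat V, as used in
  \<open>inner_W\<close>.\<close>

lemma inner_kulkarni_nomizu:
  assumes V: "V \<in> curv_sym" and r: "ric V = 0"
  shows "V \<bullet> kulkarni_nomizu h = 0"
proof -
  have r1: "(\<Sum>l\<in>UNIV. V $ l $ j $ k $ l) = 0" for j k
  proof -
    have "ric V $ j $ k = 0" using r by simp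
    then show ?thesis by (simp add: ric_def)
  qed
  have r2: "(\<Sum>l\<in>UNIV. V $ j $ l $ l $ k) = 0" for j k
  proof -
    have "V $ j $ l $ l $ k = V $ l $ j $ k $ l" for l using curv_symD(1)[OF V, of l j l k] curv_symD(2)[OF V, of l j k l] by linarith
    then show ?thesis using r1 by simp
  qed
  have r3: "(\<Sum>l\<in>UNIV. V $ l $ j $ l $ k) = 0" for j k
  proof -
    have "V $ l $ j $ l $ k = - V $ l $ j $ k $ l" for l by (rule curv_symD(2)[OF V])
    then show ?thesis using r1[of j k] by (simp add: sum_negf)
  qed
  have r4: "(\<Sum>l\<in>UNIV. V $ j $ l $ k $ l) = 0" for j k
  proof -
    have "V $ j $ l $ k $ l = - V $ l $ j $ k $ l" for l by (rule curv_symD(1)[OF V])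
    then show ?thesis using r1[of j k] by (simp add: sum_negf)
  qed
  have "V \<bullet> kulkarni_nomizu h = (\<Sum>i\<in>UNIV. \<Sum>j\<in>UNIV. \<Sum>k\<in>UNIV. \<Sum>l\<in>UNIV. V $ i $ j $ k $ l * h $ j $ k * kron i l)
     + (\<Sum>i\<in>UNIV. \<Sum>j\<in>UNIV. \<Sum>k\<in>UNIV. \<Sum>l\<in>UNIV. V $ i $ j $ k $ l * h $ i $ l * kron j k)
     - (\<Sum>i\<in>UNIV. \<Sum>j\<in>UNIV. \<Sum>k\<in>UNIV. \<Sum>l\<in>UNIV. V $ i $ j $ k $ l * h $ j $ l * kron i k)
     - (\<Sum>i\<in>UNIV. \<Sum>j\<in>UNIV. \<Sum>k\<in>UNIV. \<Sum>l\<in>UNIV. V $ i $ j $ k $ l * h $ i $ k * kron j l)"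
  proof -
    have "V $ i $ j $ k $ l * kulkarni_nomizu h $ i $ j $ k $ l = V $ i $ j $ k $ l * h $ j $ k * kron i l + V $ i $ j $ k $ l * h $ i $ l * kron j k
      - V $ i $ j $ k $ l * h $ j $ l * kron i k - V $ i $ j $ k $ l * h $ i $ k * kron j l" for i j k l
      unfolding kulkarni_nomizu_nth by algebra
    then show ?thesis unfolding inner_tensor4 by (simp only: sum.distrib sum_subtractf)
  qed
  also have "(\<Sum>i\<in>UNIV. \<Sum>j\<in>UNIV. \<Sum>k\<in>UNIV. \<Sum>l\<in>UNIV. V $ i $ j $ k $ l * h $ j $ k * kron i l) = 0"
  proof -
    have "(\<Sum>i\<in>UNIV. \<Sum>j\<in>UNIV. \<Sum>k\<in>UNIV. \<Sum>l\<in>UNIV. V $ i $ j $ k $ l * h $ j $ k * kron i l)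
      = (\<Sum>i\<in>UNIV. \<Sum>j\<in>UNIV. \<Sum>k\<in>UNIV. V $ i $ j $ k $ i * h $ j $ k)" by (simp only: sum_mult_kron)
    also have "\<dots> = (\<Sum>j\<in>UNIV. \<Sum>k\<in>UNIV. (\<Sum>i\<in>UNIV. V $ i $ j $ k $ i) * h $ j $ k)"
      unfolding sum_distrib_right by (rule sum_rot3)
    finally show ?thesis by (simp add: r1)
  qed
  also have "(\<Sum>i\<in>UNIV. \<Sum>j\<in>UNIV. \<Sum>k\<in>UNIV. \<Sum>l\<in>UNIV. V $ i $ j $ k $ l * h $ i $ l * kron j k) = 0"
  proof -
    have "(\<Sum>k\<in>UNIV. \<Sum>l\<in>UNIV. V $ i $ j $ k $ l * h $ i $ l * kron j k) = (\<Sum>l\<in>UNIV. V $ i $ j $ j $ l * h $ i $ l)" for i j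
      by (subst sum.swap) (simp only: sum_mult_kron)
    moreover have "(\<Sum>j\<in>UNIV. \<Sum>l\<in>UNIV. V $ i $ j $ j $ l * h $ i $ l) = (\<Sum>l\<in>UNIV. (\<Sum>j\<in>UNIV. V $ i $ j $ j $ l) * h $ i $ l)" for i
      unfolding sum_distrib_right by (rule sum.swap)
    ultimately show ?thesis by (simp add: r2)
  qed
  also have "(\<Sum>i\<in>UNIV. \<Sum>j\<in>UNIV. \<Sum>k\<in>UNIV. \<Sum>l\<in>UNIV. V $ i $ j $ k $ l * h $ j $ l * kron i k) = 0"
  proof -
    have "(\<Sum>k\<in>UNIV. \<Sum>l\<in>UNIV. V $ i $ j $ k $ l * h $ j $ l * kron i k) = (\<Sum>l\<in>UNIV. V $ i $ j $ i $ l * h $ j $ l)" for i j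
      by (subst sum.swap) (simp only: sum_mult_kron)
    moreover have "(\<Sum>i\<in>UNIV. \<Sum>j\<in>UNIV. \<Sum>l\<in>UNIV. V $ i $ j $ i $ l * h $ j $ l) = (\<Sum>j\<in>UNIV. \<Sum>l\<in>UNIV. (\<Sum>i\<in>UNIV. V $ i $ j $ i $ l) * h $ j $ l)"
      unfolding sum_distrib_right by (rule sum_rot3)
    ultimately show ?thesis by (simp add: r3)
  qed
  also have "(\<Sum>i\<in>UNIV. \<Sum>j\<in>UNIV. \<Sum>k\<in>UNIV. \<Sum>l\<in>UNIV. V $ i $ j $ k $ l * h $ i $ k * kron j l) = 0"
  proof -
    have "(\<Sum>i\<in>UNIV. \<Sum>j\<in>UNIV. \<Sum>k\<in>UNIV. \<Sum>l\<in>UNIV. V $ i $ j $ k $ l * h $ i $ k * kron j l)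
      = (\<Sum>i\<in>UNIV. \<Sum>j\<in>UNIV. \<Sum>k\<in>UNIV. V $ i $ j $ k $ j * h $ i $ k)" by (simp only: sum_mult_kron)
    also have "\<dots> = (\<Sum>i\<in>UNIV. \<Sum>k\<in>UNIV. (\<Sum>j\<in>UNIV. V $ i $ j $ k $ j) * h $ i $ k)"
      unfolding sum_distrib_right by (rule sum_swap3)
    finally show ?thesis by (simp add: r4)
  qed
  finally show ?thesis by simp
qed

lemma ric0_sym: "R \<in> curv_sym \<Longrightarrow> ric0 R $ j $ i = ric0 R $ i $ j"
  by (simp add: ric0_def ric_sym[of R j i] mat_def)

context g2_tensors
begin

lemma varpi_linear: "varpi f (U + V) = varpi f U + varpi f V" "varpi f (U - V) = varpi f U - varpi f V" "varpi f (r *\<^sub>R U) = r *\<^sub>R varpi f U"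
  unfolding varpi_Phi mat4_linear matrix_mult_add matrix_mult_diff scaleR_matrix_mult by (rule refl)+

lemma varpi_sym: "U \<in> curv_sym \<Longrightarrow> varpi f U $ q $ p = varpi f U $ p $ q"
proof -
  assume "U \<in> curv_sym"
  then have "tr (varpi f U) = varpi f U"
    unfolding curv_sym_mat4 varpi_Phi by (simp add: matrix_transpose_mul matrix_mul_assoc)
  then have "tr (varpi f U) $ p $ q = varpi f U $ p $ q" by simp
  then show ?thesis by (simp only: transpose_nth)
qed

lemma mat4_Phi_nth: "(mat4 U ** Phi) $ (i, j) $ q = (\<Sum>k\<in>UNIV. \<Sum>l\<in>UNIV. U $ i $ j $ k $ l * f $ k $ l $ q)"
  by (simp add: matrix_matrix_mult_def sum_UNIV_prod mat4_nth Phi_nth)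

text \<open>The sum over q is the contraction identity: its two metric terms each give the Ricci
  tensor and its last term the contraction with \<psi>. The same contraction governs
  \<open>ricm (mat4 U ** Q)\<close> and the trace of \<open>varpi f U\<close>.\<close>

lemma contract_Phi:
  assumes U: "U \<in> curv_sym"
  shows "(\<Sum>l\<in>UNIV. \<Sum>q\<in>UNIV. (mat4 U ** Phi) $ (l, j) $ q * f $ k $ l $ q)
    = 2 * ric U $ j $ k - (\<Sum>l\<in>UNIV. \<Sum>m\<in>UNIV. \<Sum>n\<in>UNIV. U $ l $ j $ m $ n * \<psi> $ m $ n $ k $ l)"
proof -
  have "(\<Sum>q\<in>UNIV. (mat4 U ** Phi) $ (l, j) $ q * f $ k $ l $ q)
    = U $ l $ j $ k $ l - U $ l $ j $ l $ k - (\<Sum>m\<in>UNIV. \<Sum>n\<in>UNIV. U $ l $ j $ m $ n * \<psi> $ m $ n $ k $ l)" for l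
  proof -
    have "(\<Sum>q\<in>UNIV. (mat4 U ** Phi) $ (l, j) $ q * f $ k $ l $ q)
      = (\<Sum>q\<in>UNIV. \<Sum>m\<in>UNIV. \<Sum>n\<in>UNIV. U $ l $ j $ m $ n * (f $ m $ n $ q * f $ k $ l $ q))"
      unfolding mat4_Phi_nth by (simp only: sum_distrib_right mult.assoc)
    also have "\<dots> = (\<Sum>m\<in>UNIV. \<Sum>n\<in>UNIV. \<Sum>q\<in>UNIV. U $ l $ j $ m $ n * (f $ m $ n $ q * f $ k $ l $ q))"
      by (rule sum_rot3)
    also have "\<dots> = (\<Sum>m\<in>UNIV. \<Sum>n\<in>UNIV. U $ l $ j $ m $ n * (kron m k * kron n l - kron m l * kron n k - \<psi> $ m $ n $ k $ l))"
      by (simp only: sum_distrib_left[symmetric] ff)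
    also have "\<dots> = (\<Sum>m\<in>UNIV. \<Sum>n\<in>UNIV. U $ l $ j $ m $ n * kron m k * kron n l - U $ l $ j $ m $ n * kron m l * kron n k
        - U $ l $ j $ m $ n * \<psi> $ m $ n $ k $ l)"
      by (simp only: right_diff_distrib mult.assoc)
    also have "\<dots> = U $ l $ j $ k $ l - U $ l $ j $ l $ k - (\<Sum>m\<in>UNIV. \<Sum>n\<in>UNIV. U $ l $ j $ m $ n * \<psi> $ m $ n $ k $ l)"
      by (simp only: sum_subtractf sum_mult_kron)
    finally show ?thesis .
  qed
  moreover have "U $ l $ j $ l $ k = - U $ l $ j $ k $ l" for l by (rule curv_symD(2)[OF U])
  ultimately show ?thesis by (simp add: sum.distrib sum_subtractf ric_def sum_distrib_left)
qed

text \<open>\<psi> is invariant under cyclic rotation of the summed indices l, m, n, so only the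
  cyclic sum of U enters, and that is zero by the Bianchi identity.\<close>

lemma bianchi_psi:
  assumes U: "U \<in> curv_sym" and B: "bianchi U"
  shows "(\<Sum>l\<in>UNIV. \<Sum>m\<in>UNIV. \<Sum>n\<in>UNIV. U $ l $ j $ m $ n * \<psi> $ m $ n $ k $ l) = 0"
proof -
  define h where "h l m n = U $ l $ j $ m $ n * \<psi> $ m $ n $ k $ l" for l m n
  have "h l m n + h m n l + h n l m = 0" for l m n
  proof -
    have p: "\<psi> $ n $ l $ k $ m = \<psi> $ m $ n $ k $ l" "\<psi> $ l $ m $ k $ n = \<psi> $ m $ n $ k $ l"
      using psi_alt(1)[of n m k l] psi_alt(2)[of n m k l] psi_alt(3)[of n k m l]  psi_alt(2)[of n k l m] psi_alt(3)[of n l k m]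
        psi_alt(3)[of n k l m] psi_alt(2)[of n l k m]
        psi_alt(1)[of l m k n] psi_alt(2)[of m l k n] psi_alt(3)[of m k l n] psi_alt(2)[of m k n l] psi_alt(3)[of m n k l]
        psi_alt(3)[of m k n l] psi_alt(2)[of m n k l]
      by linarith+
    have "U $ l $ j $ m $ n + U $ m $ j $ n $ l + U $ n $ j $ l $ m = 0"
      using bianchiD[OF B, of n m l j] curv_symD(3)[OF U, of n m l j] curv_symD(3)[OF U, of m l n j] curv_symD(3)[OF U, of l n m j]
        curv_symD(2)[OF U, of l j m n] curv_symD(2)[OF U, of n j l m] curv_symD(2)[OF U, of m j n l]
      by linarith
    then show ?thesis unfolding h_def p by algebra
  qed
  then have "(\<Sum>l\<in>UNIV. \<Sum>m\<in>UNIV. \<Sum>n\<in>UNIV. h l m n + h m n l + h n l m) = 0" by simp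
  moreover have "(\<Sum>l\<in>UNIV. \<Sum>m\<in>UNIV. \<Sum>n\<in>UNIV. h m n l) = (\<Sum>l\<in>UNIV. \<Sum>m\<in>UNIV. \<Sum>n\<in>UNIV. h l m n)" by (rule sum_rot3)
  moreover have "(\<Sum>l\<in>UNIV. \<Sum>m\<in>UNIV. \<Sum>n\<in>UNIV. h n l m) = (\<Sum>l\<in>UNIV. \<Sum>m\<in>UNIV. \<Sum>n\<in>UNIV. h l m n)" by (rule sum_rot3[symmetric])
  ultimately show ?thesis unfolding h_def[symmetric] by (simp add: sum.distrib)
qed

lemma mult_Q_nth: "(M ** Q) $ (l, j) $ (k, n) = (\<Sum>q\<in>UNIV. (M ** Phi) $ (l, j) $ q * f $ k $ n $ q) / 6"
proof -
  have "M ** Q = (1 / 6) *\<^sub>R ((M ** Phi) ** tr Phi)"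
    unfolding Q_def by (simp only: scaleR_matrix_mult matrix_mul_assoc)
  then show ?thesis by (simp add: matrix_matrix_mult_def[of _ "tr Phi"] transpose_nth Phi_nth)
qed

lemma ricm_mult_Q:
  assumes "U \<in> curv_sym"
  shows "ricm (mat4 U ** Q) $ j $ k = (2 * ric U $ j $ k - (\<Sum>l\<in>UNIV. \<Sum>m\<in>UNIV. \<Sum>n\<in>UNIV. U $ l $ j $ m $ n * \<psi> $ m $ n $ k $ l)) / 6"
  unfolding contract_Phi[OF assms, symmetric] ricm_def vec_lambda_beta mult_Q_nth by (simp add: sum_divide_distrib)

lemma ricm_mQ:
  assumes "U \<in> curv_sym" "bianchi U"
  shows "ricm (mat4 U ** Q) = (1 / 3) *\<^sub>R ric U"
  using ricm_mult_Q[OF assms(1)] bianchi_psi[OF assms] by (simp add: vec_eq_iff)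

lemma ricm_Qm:
  assumes U: "U \<in> curv_sym" "bianchi U"
  shows "ricm (Q ** mat4 U) = (1 / 3) *\<^sub>R ric U"
proof -
  have m: "row_anti (mat4 U)" "tr (mat4 U) = mat4 U" using U(1) by (simp_all add: curv_sym_mat4)
  have t: "tr (mat4 U ** Q) = Q ** mat4 U" by (simp add: matrix_transpose_mul tr_Q m)
  have "(Q ** mat4 U) $ (l, j) $ (k, l) = (mat4 U ** Q) $ (l, k) $ (j, l)" for j k l
  proof -
    have "(Q ** mat4 U) $ (l, j) $ (k, l) = - (Q ** mat4 U) $ (j, l) $ (k, l)"
      by (rule row_antiD[OF row_anti_mult[OF row_anti_Q]])
    also have "(Q ** mat4 U) $ (j, l) $ (k, l) = (mat4 U ** Q) $ (k, l) $ (j, l)" unfolding t[symmetric] transpose_nth by (rule refl)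
    also have "(mat4 U ** Q) $ (k, l) $ (j, l) = - (mat4 U ** Q) $ (l, k) $ (j, l)"
      by (rule row_antiD[OF row_anti_mult[OF m(1)]])
    finally show ?thesis by simp
  qed
  then have "ricm (Q ** mat4 U) $ j $ k = ricm (mat4 U ** Q) $ k $ j" for j k by (simp add: ricm_def)
  then show ?thesis unfolding ricm_mQ[OF U] by (simp add: vec_eq_iff ric_sym[OF U(1)])
qed

text \<open>The block is \<open>Phi ** varpi f U ** tr Phi\<close> divided by 36. Contracting one
  index of the two 3-forms gives metric terms and a \<psi> term; the latter cancels against the
  symmetric matrix \<open>varpi f U\<close>.\<close>

lemma ricm_QmQ:
  assumes U: "U \<in> curv_sym"
  shows "ricm (Q ** mat4 U ** Q) = (1 / 36) *\<^sub>R (varpi f U - trace2 (varpi f U) *\<^sub>R mat 1)"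
proof -
  let ?N = "varpi f U"
  have "Q ** mat4 U ** Q = (1 / 36) *\<^sub>R (Phi ** ?N ** tr Phi)"
    unfolding Q_def varpi_Phi scaleR_matrix_mult by (simp add: matrix_mul_assoc)
  moreover have "(Phi ** ?N ** tr Phi) $ (l, j) $ (k, l) = (\<Sum>q\<in>UNIV. \<Sum>p\<in>UNIV. ?N $ p $ q * (f $ l $ j $ p * f $ k $ l $ q))" for l j k
    by (simp add: matrix_matrix_mult_def transpose_nth Phi_nth sum_distrib_left sum_distrib_right mult_ac)
  ultimately have "(Q ** mat4 U ** Q) $ (l, j) $ (k, l) = (\<Sum>q\<in>UNIV. \<Sum>p\<in>UNIV. ?N $ p $ q * (f $ l $ j $ p * f $ k $ l $ q)) / 36" for l j k
    by (simp only: vector_scaleR_component) simp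
  then have "ricm (Q ** mat4 U ** Q) $ j $ k = (\<Sum>l\<in>UNIV. \<Sum>q\<in>UNIV. \<Sum>p\<in>UNIV. ?N $ p $ q * (f $ l $ j $ p * f $ k $ l $ q)) / 36" for j k
    by (simp add: ricm_def sum_divide_distrib)
  moreover have "(\<Sum>l\<in>UNIV. \<Sum>q\<in>UNIV. \<Sum>p\<in>UNIV. ?N $ p $ q * (f $ l $ j $ p * f $ k $ l $ q)) = ?N $ j $ k - trace2 ?N * kron j k" for j k
  proof -
    have "(\<Sum>l\<in>UNIV. \<Sum>q\<in>UNIV. \<Sum>p\<in>UNIV. ?N $ p $ q * (f $ l $ j $ p * f $ k $ l $ q))
      = (\<Sum>q\<in>UNIV. \<Sum>p\<in>UNIV. ?N $ p $ q * (\<Sum>l\<in>UNIV. f $ l $ j $ p * f $ k $ l $ q))"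
      unfolding sum_distrib_left by (rule sum_rot3)
    also have "\<dots> = (\<Sum>q\<in>UNIV. \<Sum>p\<in>UNIV. ?N $ p $ q * kron j q * kron p k - ?N $ p $ q * kron j k * kron p q + ?N $ p $ q * \<psi> $ j $ p $ k $ q)"
    proof (intro sum.cong refl)
      fix p q
      have "(\<Sum>l\<in>UNIV. f $ l $ j $ p * f $ k $ l $ q) = - (\<Sum>l\<in>UNIV. f $ l $ j $ p * f $ l $ k $ q)"
        unfolding sum_negf[symmetric]
      proof (intro sum.cong refl)
        fix l show "f $ l $ j $ p * f $ k $ l $ q = - (f $ l $ j $ p * f $ l $ k $ q)" using f_alt(1)[of k l q] by simp
      qed
      note e = this[unfolded ff']
      show "?N $ p $ q * (\<Sum>l\<in>UNIV. f $ l $ j $ p * f $ k $ l $ q) = ?N $ p $ q * kron j q * kron p k - ?N $ p $ q * kron j k * kron p q + ?N $ p $ q * \<psi> $ j $ p $ k $ q"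
        unfolding e by algebra
    qed
    also have "\<dots> = ?N $ k $ j - trace2 ?N * kron j k + (\<Sum>q\<in>UNIV. \<Sum>p\<in>UNIV. ?N $ p $ q * \<psi> $ j $ p $ k $ q)"
    proof -
      have "(\<Sum>q\<in>UNIV. \<Sum>p\<in>UNIV. ?N $ p $ q * kron j q * kron p k) = ?N $ k $ j" by (simp only: sum_mult_kron)
      moreover have "(\<Sum>q\<in>UNIV. \<Sum>p\<in>UNIV. ?N $ p $ q * kron j k * kron p q) = trace2 ?N * kron j k"
        by (simp only: sum_mult_kron trace2_def sum_distrib_right)
      ultimately show ?thesis by (simp only: sum.distrib sum_subtractf)
    qed
    also have "(\<Sum>q\<in>UNIV. \<Sum>p\<in>UNIV. ?N $ p $ q * \<psi> $ j $ p $ k $ q) = 0"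
    proof -
      have "(\<Sum>q\<in>UNIV. \<Sum>p\<in>UNIV. ?N $ p $ q * \<psi> $ j $ p $ k $ q) = (\<Sum>q\<in>UNIV. \<Sum>p\<in>UNIV. - (?N $ p $ q * \<psi> $ j $ p $ k $ q))"
      proof (subst sum.swap, intro sum.cong refl)
        fix p q
        have "\<psi> $ j $ q $ k $ p = - \<psi> $ j $ p $ k $ q"
          using psi_alt(2)[of j q k p] psi_alt(3)[of j k q p] psi_alt(2)[of j k p q] by linarith
        then show "?N $ q $ p * \<psi> $ j $ q $ k $ p = - (?N $ p $ q * \<psi> $ j $ p $ k $ q)" using varpi_sym[OF U, of p q] by simp
      qed
      then show ?thesis by (simp add: sum_negf)
    qed
    also have "?N $ k $ j = ?N $ j $ k" by (rule varpi_sym[OF U])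
    finally show ?thesis by simp
  qed
  ultimately show ?thesis by (simp add: vec_eq_iff mat_def)
qed

text \<open>With P = 1 - Q the coefficient of the Ricci tensor is 1 - 1/3 - 1/3.\<close>

lemma ric_diag14:
  assumes U: "U \<in> curv_sym" "bianchi U"
  shows "ric (diag14 U) = (1 / 3) *\<^sub>R ric U + (1 / 36) *\<^sub>R (varpi f U - trace2 (varpi f U) *\<^sub>R mat 1)"
proof -
  have "P ** mat4 U ** P = mat4 U - Q ** mat4 U - mat4 U ** Q + Q ** mat4 U ** Q"
    by (simp add: P_def matrix_mult_diff)
  then show ?thesis
    unfolding diag14_def ric_ten4 by (simp add: ricm_linear ricm_mat4 ricm_mQ[OF U] ricm_Qm[OF U] ricm_QmQ[OF U(1)])
     (simp add: vec_eq_iff)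
qed

text \<open>The two one-sided products contribute 1/3 each, and the block on the 7-dimensional
  summand is subtracted twice.\<close>

lemma ric_offdiag:
  assumes U: "U \<in> curv_sym" "bianchi U"
  shows "ric (offdiag U) = (2 / 3) *\<^sub>R ric U - (1 / 18) *\<^sub>R (varpi f U - trace2 (varpi f U) *\<^sub>R mat 1)"
proof -
  have "P ** mat4 U ** Q + Q ** mat4 U ** P = mat4 U ** Q + Q ** mat4 U - 2 *\<^sub>R (Q ** mat4 U ** Q)"
    by (simp add: P_def matrix_mult_diff scaleR_2)
  then show ?thesis
    unfolding offdiag_def ric_ten4 by (simp add: ricm_linear ricm_mat4 ricm_mQ[OF U] ricm_Qm[OF U] ricm_QmQ[OF U(1)])
qed

text \<open>This is \<open>contract_Phi\<close> with its free indices set equal and summed;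
  exchanging two indices of f gives the sign, and the \<psi> term is removed by
  \<open>bianchi_psi\<close>.\<close>

lemma trace_varpi:
  assumes U: "U \<in> curv_sym" "bianchi U"
  shows "trace2 (varpi f U) = - 2 * scal U"
proof -
  have "trace2 (varpi f U) = (\<Sum>q\<in>UNIV. \<Sum>l\<in>UNIV. \<Sum>j\<in>UNIV. f $ l $ j $ q * (mat4 U ** Phi) $ (l, j) $ q)"
    unfolding varpi_Phi trace2_def matrix_mul_assoc[symmetric]
    by (simp add: matrix_matrix_mult_def[of "tr Phi"] transpose_nth sum_UNIV_prod Phi_nth)
  also have "\<dots> = (\<Sum>l\<in>UNIV. \<Sum>j\<in>UNIV. \<Sum>q\<in>UNIV. f $ l $ j $ q * (mat4 U ** Phi) $ (l, j) $ q)" by (rule sum_rot3)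
  also have "\<dots> = (\<Sum>j\<in>UNIV. \<Sum>l\<in>UNIV. \<Sum>q\<in>UNIV. f $ l $ j $ q * (mat4 U ** Phi) $ (l, j) $ q)" by (rule sum.swap)
  also have "\<dots> = (\<Sum>j\<in>UNIV. \<Sum>l\<in>UNIV. \<Sum>q\<in>UNIV. - ((mat4 U ** Phi) $ (l, j) $ q * f $ j $ l $ q))"
  proof (intro sum.cong refl)
    fix j l q show "f $ l $ j $ q * (mat4 U ** Phi) $ (l, j) $ q = - ((mat4 U ** Phi) $ (l, j) $ q * f $ j $ l $ q)"
      using f_alt(1)[of l j q] by simp
  qed
  also have "\<dots> = - (\<Sum>j\<in>UNIV. 2 * ric U $ j $ j)"
    unfolding sum_negf contract_Phi[OF U(1)] bianchi_psi[OF U] by simp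
  finally show ?thesis by (simp add: scal_def sum_distrib_left sum_negf)
qed

text \<open>The difference between \<open>varpi\<close> of R and of its Weyl tensor. One side is
  contracted at a time, and the \<psi> term cancels because h is symmetric.\<close>

lemma varpi_kulkarni_nomizu:
  assumes h: "\<And>i j. h $ j $ i = h $ i $ j"
  shows "varpi f (kulkarni_nomizu h) = 4 *\<^sub>R h - (4 * trace2 h) *\<^sub>R mat 1"
proof -
  have T: "(mat4 (kulkarni_nomizu h) ** Phi) $ (i, j) $ q = 2 * (\<Sum>k\<in>UNIV. h $ j $ k * f $ k $ i $ q) - 2 * (\<Sum>k\<in>UNIV. h $ i $ k * f $ k $ j $ q)" for i j q
  proof -
    have "(mat4 (kulkarni_nomizu h) ** Phi) $ (i, j) $ q
      = (\<Sum>k\<in>UNIV. \<Sum>l\<in>UNIV. h $ j $ k * f $ k $ l $ q * kron i l) + (\<Sum>l\<in>UNIV. \<Sum>k\<in>UNIV. h $ i $ l * f $ k $ l $ q * kron j k)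
      - (\<Sum>l\<in>UNIV. \<Sum>k\<in>UNIV. h $ j $ l * f $ k $ l $ q * kron i k) - (\<Sum>k\<in>UNIV. \<Sum>l\<in>UNIV. h $ i $ k * f $ k $ l $ q * kron j l)"
    proof -
      have "kulkarni_nomizu h $ i $ j $ k $ l * f $ k $ l $ q = h $ j $ k * f $ k $ l $ q * kron i l + h $ i $ l * f $ k $ l $ q * kron j k
        - h $ j $ l * f $ k $ l $ q * kron i k - h $ i $ k * f $ k $ l $ q * kron j l" for k l
        unfolding kulkarni_nomizu_nth by algebra
      then show ?thesis unfolding mat4_Phi_nth
        by (simp only: sum.distrib sum_subtractf sum.swap[of "\<lambda>k l. h $ i $ l * f $ k $ l $ q * kron j k"]
          sum.swap[of "\<lambda>k l. h $ j $ l * f $ k $ l $ q * kron i k"])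
    qed
    also have "\<dots> = (\<Sum>k\<in>UNIV. h $ j $ k * f $ k $ i $ q) + (\<Sum>l\<in>UNIV. h $ i $ l * f $ j $ l $ q)
      - (\<Sum>l\<in>UNIV. h $ j $ l * f $ i $ l $ q) - (\<Sum>k\<in>UNIV. h $ i $ k * f $ k $ j $ q)"
      by (simp only: sum_mult_kron)
    also have "(\<Sum>l\<in>UNIV. h $ i $ l * f $ j $ l $ q) = - (\<Sum>l\<in>UNIV. h $ i $ l * f $ l $ j $ q)"
      unfolding sum_negf[symmetric]
    proof (intro sum.cong refl)
      fix l show "h $ i $ l * f $ j $ l $ q = - (h $ i $ l * f $ l $ j $ q)" using f_alt(1)[of j l q] by simp
    qed
    also have "(\<Sum>l\<in>UNIV. h $ j $ l * f $ i $ l $ q) = - (\<Sum>l\<in>UNIV. h $ j $ l * f $ l $ i $ q)"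
      unfolding sum_negf[symmetric]
    proof (intro sum.cong refl)
      fix l show "h $ j $ l * f $ i $ l $ q = - (h $ j $ l * f $ l $ i $ q)" using f_alt(1)[of i l q] by simp
    qed
    finally show ?thesis by simp
  qed
  have "varpi f (kulkarni_nomizu h) $ p $ q = 4 * h $ p $ q - 4 * trace2 h * kron p q" for p q
  proof -
    let ?A = "\<Sum>i\<in>UNIV. \<Sum>j\<in>UNIV. \<Sum>k\<in>UNIV. h $ j $ k * (f $ i $ j $ p * f $ k $ i $ q)"
    have "varpi f (kulkarni_nomizu h) $ p $ q = (\<Sum>i\<in>UNIV. \<Sum>j\<in>UNIV. f $ i $ j $ p * (mat4 (kulkarni_nomizu h) ** Phi) $ (i, j) $ q)"
      unfolding varpi_Phi matrix_mul_assoc[symmetric]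
      by (simp add: matrix_matrix_mult_def[of "tr Phi"] transpose_nth sum_UNIV_prod Phi_nth)
    also have "\<dots> = (\<Sum>i\<in>UNIV. \<Sum>j\<in>UNIV. 2 * (\<Sum>k\<in>UNIV. h $ j $ k * (f $ i $ j $ p * f $ k $ i $ q))
       + 2 * (\<Sum>k\<in>UNIV. h $ i $ k * (f $ j $ i $ p * f $ k $ j $ q)))"
    proof (intro sum.cong refl)
      fix i j
      have "f $ i $ j $ p * (h $ i $ k * f $ k $ j $ q) = - (h $ i $ k * (f $ j $ i $ p * f $ k $ j $ q))" for k
        using f_alt(1)[of j i p] by simp
      moreover have "f $ i $ j $ p * (h $ j $ k * f $ k $ i $ q) = h $ j $ k * (f $ i $ j $ p * f $ k $ i $ q)" for k by simp
      ultimately show "f $ i $ j $ p * (mat4 (kulkarni_nomizu h) ** Phi) $ (i, j) $ q = 2 * (\<Sum>k\<in>UNIV. h $ j $ k * (f $ i $ j $ p * f $ k $ i $ q))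
       + 2 * (\<Sum>k\<in>UNIV. h $ i $ k * (f $ j $ i $ p * f $ k $ j $ q))"
        unfolding T right_diff_distrib mult.left_commute[of "f $ i $ j $ p" 2] sum_distrib_left[of "f $ i $ j $ p"] by (simp only: sum_negf)
    qed
    also have "\<dots> = 2 * ?A + 2 * ?A"
    proof -
      have "(\<Sum>i\<in>UNIV. \<Sum>j\<in>UNIV. \<Sum>k\<in>UNIV. h $ i $ k * (f $ j $ i $ p * f $ k $ j $ q)) = ?A" by (rule sum.swap)
      then show ?thesis by (simp only: sum.distrib sum_distrib_left[symmetric])
    qed
    also have "?A = (\<Sum>j\<in>UNIV. \<Sum>k\<in>UNIV. h $ j $ k * (\<Sum>i\<in>UNIV. f $ i $ j $ p * f $ k $ i $ q))"
      unfolding sum_distrib_left by (rule sum_rot3)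
    also have "\<dots> = (\<Sum>j\<in>UNIV. \<Sum>k\<in>UNIV. h $ j $ k * kron j q * kron p k - h $ j $ k * kron p q * kron j k + h $ j $ k * \<psi> $ j $ p $ k $ q)"
    proof (intro sum.cong refl)
      fix j k
      have "(\<Sum>l\<in>UNIV. f $ l $ j $ p * f $ k $ l $ q) = - (\<Sum>l\<in>UNIV. f $ l $ j $ p * f $ l $ k $ q)"
        unfolding sum_negf[symmetric]
      proof (intro sum.cong refl)
        fix l show "f $ l $ j $ p * f $ k $ l $ q = - (f $ l $ j $ p * f $ l $ k $ q)" using f_alt(1)[of k l q] by simp
      qed
      note e = this[unfolded ff']
      show "h $ j $ k * (\<Sum>i\<in>UNIV. f $ i $ j $ p * f $ k $ i $ q) = h $ j $ k * kron j q * kron p k - h $ j $ k * kron p q * kron j k + h $ j $ k * \<psi> $ j $ p $ k $ q"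
        unfolding e by algebra
    qed
    also have "\<dots> = h $ q $ p - trace2 h * kron p q + (\<Sum>j\<in>UNIV. \<Sum>k\<in>UNIV. h $ j $ k * \<psi> $ j $ p $ k $ q)"
    proof -
      have "(\<Sum>j\<in>UNIV. \<Sum>k\<in>UNIV. h $ j $ k * kron j q * kron p k) = h $ q $ p" by (simp only: sum_mult_kron)
      moreover have "(\<Sum>j\<in>UNIV. \<Sum>k\<in>UNIV. h $ j $ k * kron p q * kron j k) = trace2 h * kron p q"
        by (simp only: sum_mult_kron trace2_def sum_distrib_right)
      ultimately show ?thesis by (simp only: sum.distrib sum_subtractf)
    qed
    also have "(\<Sum>j\<in>UNIV. \<Sum>k\<in>UNIV. h $ j $ k * \<psi> $ j $ p $ k $ q) = 0"
    proof -
      have "(\<Sum>j\<in>UNIV. \<Sum>k\<in>UNIV. h $ j $ k * \<psi> $ j $ p $ k $ q) = (\<Sum>j\<in>UNIV. \<Sum>k\<in>UNIV. - (h $ j $ k * \<psi> $ j $ p $ k $ q))"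
      proof (subst sum.swap, intro sum.cong refl)
        fix j k
        have "\<psi> $ k $ p $ j $ q = - \<psi> $ j $ p $ k $ q"
          using psi_alt(1)[of k p j q] psi_alt(2)[of p k j q] psi_alt(1)[of p j k q] by linarith
        then show "h $ k $ j * \<psi> $ k $ p $ j $ q = - (h $ j $ k * \<psi> $ j $ p $ k $ q)" using h[of j k] by simp
      qed
      then show ?thesis by (simp add: sum_negf)
    qed
    also have "h $ q $ p = h $ p $ q" by (rule h)
    finally show ?thesis by simp
  qed
  then show ?thesis by (simp add: vec_eq_iff mat_def)
qed

end

section \<open>The summands of the space of Weyl tensors\<close>

lemma orth_proj_eqI:
  assumes V: "subspace V" and y: "y \<in> V" "x - y \<in> V\<^sup>\<bottom>"
  shows "orth_proj V x = y"
  unfolding orth_proj_def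
proof (rule the_equality)
  show "y \<in> V \<and> x - y \<in> V\<^sup>\<bottom>" using y by blast
  fix z assume z: "z \<in> V \<and> x - z \<in> V\<^sup>\<bottom>"
  have "y - z \<in> V" using V y z by (simp add: subspace_diff)
  moreover have "y - z \<in> V\<^sup>\<bottom>"
    using subspace_diff[OF subspace_orthogonal_comp, of "x - z" V "x - y"] y z by simp
  ultimately have "(y - z) \<bullet> (y - z) = 0" unfolding orthogonal_comp_def orthogonal_def by blast
  then show "z = y" by simp
qed

lemma orth_decomp:
  assumes V: "subspace (V :: 'b::euclidean_space set)"
  obtains y where "y \<in> V" "x - y \<in> V\<^sup>\<bottom>"
proof -
  obtain y z where "y \<in> span V" "\<And>w. w \<in> span V \<Longrightarrow> orthogonal z w" "x = y + z"
    using orthogonal_subspace_decomp_exists[of V x] by metis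
  moreover have "span V = V" using V by simp
  ultimately show thesis
    using that[of y] by (simp add: orthogonal_comp_def orthogonal_commute)
qed

text \<open>Vanishing of a Weyl component is used only as orthogonality to the summand, so no
  projection has to be computed.\<close>

lemma orth_proj_eq_0_iff:
  assumes V: "subspace (V :: 'b::euclidean_space set)"
  shows "orth_proj V x = 0 \<longleftrightarrow> (\<forall>y\<in>V. y \<bullet> x = 0)"
proof
  assume 0: "orth_proj V x = 0"
  obtain y where y: "y \<in> V" "x - y \<in> V\<^sup>\<bottom>" using orth_decomp[OF V] by metis
  then have "y = 0" using orth_proj_eqI[OF V y] 0 by simp
  then show "\<forall>y\<in>V. y \<bullet> x = 0" using y by (simp add: orthogonal_comp_def orthogonal_def)
next
  assume "\<forall>y\<in>V. y \<bullet> x = 0"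
  then show "orth_proj V x = 0"
    by (intro orth_proj_eqI[OF V]) (simp_all add: subspace_0[OF V] orthogonal_comp_def orthogonal_def)
qed

lemma subspace_curv_sym: "subspace curv_sym"
proof (rule subspaceI)
  have t0: "tr (0 :: real^'n^'m) = 0" by (simp add: vec_eq_iff transpose_nth)
  have m0: "mat4 0 = 0" by (simp add: mat4_eq_0)
  show "0 \<in> curv_sym" unfolding curv_sym_mat4 m0 t0 by (simp add: row_anti_def)
  show "x + y \<in> curv_sym" if "x \<in> curv_sym" "y \<in> curv_sym" for x y
    using that unfolding curv_sym_mat4 mat4_linear transpose_linear by (simp add: row_anti_linear)
  show "c *\<^sub>R x \<in> curv_sym" if "x \<in> curv_sym" for x c
    using that unfolding curv_sym_mat4 mat4_linear transpose_linear by (simp add: row_anti_linear)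
qed

lemma bianchi_linear: "bianchi 0" "bianchi U \<Longrightarrow> bianchi V \<Longrightarrow> bianchi (U + V)" "bianchi U \<Longrightarrow> bianchi V \<Longrightarrow> bianchi (U - V)" "bianchi U \<Longrightarrow> bianchi (c *\<^sub>R U)"
proof -
  show "bianchi 0" by (simp add: bianchi_def)
  assume U: "bianchi U"
  show "bianchi (c *\<^sub>R U)" unfolding bianchi_def vector_scaleR_component real_scaleR_def distrib_left[symmetric]
    using bianchiD[OF U] by simp
  assume V: "bianchi V"
  show "bianchi (U + V)" unfolding bianchi_def vector_add_component
    using bianchiD[OF U] bianchiD[OF V] by (intro allI) (smt (verit))
  show "bianchi (U - V)" unfolding bianchi_def vector_minus_component
    using bianchiD[OF U] bianchiD[OF V] by (intro allI) (smt (verit))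
qed

lemma ric_zero: "ric 0 = 0" by (simp add: ric_def vec_eq_iff)

lemma subspace_weyl_tensors: "subspace weyl_tensors"
proof (rule subspaceI)
  show "0 \<in> weyl_tensors" using subspace_0[OF subspace_curv_sym] by (simp add: weyl_tensors_iff bianchi_linear ric_zero)
  show "x + y \<in> weyl_tensors" if "x \<in> weyl_tensors" "y \<in> weyl_tensors" for x y
    using that by (simp add: weyl_tensors_iff bianchi_linear ric_linear subspace_add[OF subspace_curv_sym])
  show "c *\<^sub>R x \<in> weyl_tensors" if "x \<in> weyl_tensors" for x c
    using that by (simp add: weyl_tensors_iff bianchi_linear ric_linear subspace_scale[OF subspace_curv_sym])
qed

lemma two_formsD: "\<beta> \<in> two_forms \<Longrightarrow> \<beta> $ j $ i = - \<beta> $ i $ j"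
  unfolding two_forms_def by blast

lemma two_formsI: "(\<And>i j. \<beta> $ j $ i = - \<beta> $ i $ j) \<Longrightarrow> \<beta> \<in> two_forms"
  unfolding two_forms_def by blast

lemma curv_op_two_forms: "U \<in> curv_sym \<Longrightarrow> curv_op U \<beta> \<in> two_forms"
proof (rule two_formsI)
  fix i j assume U: "U \<in> curv_sym"
  show "curv_op U \<beta> $ j $ i = - curv_op U \<beta> $ i $ j"
    unfolding curv_op_def vec_lambda_beta curv_symD(1)[OF U, of j i] by (simp add: sum_negf)
qed

lemma vec2_linear: "vec2 (\<alpha> + \<beta>) = vec2 \<alpha> + vec2 \<beta>" "vec2 (\<alpha> - \<beta>) = vec2 \<alpha> - vec2 \<beta>" "vec2 (c *\<^sub>R \<alpha>) = c *\<^sub>R vec2 \<alpha>" "vec2 0 = 0"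
  by (simp_all add: vec2_def vec_eq_iff)

lemma vec2_inject: "vec2 \<alpha> = vec2 \<beta> \<longleftrightarrow> \<alpha> = \<beta>"
  by (metis ten2_vec2)

text \<open>The elementary 2-forms suffice as tests: on such a form a matrix with antisymmetric
  column pairs returns twice one of its columns.\<close>

lemma vanish_on_two_forms:
  assumes A: "row_anti (tr A)"
  shows "(\<forall>\<beta>\<in>two_forms. A *v vec2 \<beta> = 0) \<longleftrightarrow> A = (0 :: real^(7 \<times> 7)^(7 \<times> 7))"
proof
  assume z: "\<forall>\<beta>\<in>two_forms. A *v vec2 \<beta> = 0"
  have "A $ \<kappa> $ (k, l) = 0" for \<kappa> k l
  proof -
    define \<beta> :: tensor2 where "\<beta> = (\<chi> i j. kron i k * kron j l - kron i l * kron j k)"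
    have "\<beta> \<in> two_forms" by (rule two_formsI) (simp add: \<beta>_def)
    then have "(A *v vec2 \<beta>) $ \<kappa> = 0" using z by simp
    moreover have "(A *v vec2 \<beta>) $ \<kappa> = (\<Sum>i\<in>UNIV. \<Sum>j\<in>UNIV. A $ \<kappa> $ (i, j) * kron i k * kron j l - A $ \<kappa> $ (i, j) * kron i l * kron j k)"
      by (simp only: matrix_vector_mult_def vec_lambda_beta sum_UNIV_prod vec2_nth \<beta>_def right_diff_distrib mult.assoc)
    moreover have "\<dots> = A $ \<kappa> $ (k, l) - A $ \<kappa> $ (l, k)" by (simp only: sum_subtractf sum_mult_kron)
    moreover have "A $ \<kappa> $ (l, k) = - A $ \<kappa> $ (k, l)" using row_antiD[OF A, of l k \<kappa>] by (simp only: transpose_nth)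
    ultimately show ?thesis by simp
  qed
  then show "A = 0" by (simp add: vec_eq_iff)
qed simp

context g2_tensors
begin

text \<open>For an off-diagonal block, \<open>ricm\<close> of its product with \<open>Q\<close> is
  half its Ricci tensor. When that is zero, \<open>ricm_mult_Q\<close> makes the contraction with
  \<psi> vanish as well. The curvature symmetries make the Bianchi sum b a 4-form, each of its three
  terms has this contraction with \<psi>, and \<open>four_form_zero\<close> applies.\<close>

lemma offdiag_bianchi:
  assumes R: "R \<in> curv_sym" "bianchi R" and r: "ric (offdiag R) = 0"
  shows "bianchi (offdiag R)"
proof -
  let ?X = "offdiag R"
  have X: "?X \<in> curv_sym" by (rule offdiag_curv_sym[OF R(1)])
  note X1 = curv_symD(1)[OF X] and X2 = curv_symD(2)[OF X] and X3 = curv_symD(3)[OF X]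
  have rm: "ricm (mat4 ?X ** Q) = 0"
  proof -
    have "mat4 ?X ** Q = P ** mat4 R ** Q"
      unfolding offdiag_def mat4_ten4 matrix_mult_add by (simp add: matrix_mul_assoc[symmetric] QQ PQ matrix_mult_zero)
    also have "\<dots> = mat4 R ** Q - Q ** mat4 R ** Q" by (simp add: P_def matrix_mult_diff)
    finally have eq: "mat4 ?X ** Q = mat4 R ** Q - Q ** mat4 R ** Q" .
    have "ricm (mat4 ?X ** Q) = (1 / 2) *\<^sub>R ric ?X"
      unfolding ric_offdiag[OF R] eq by (simp add: ricm_linear ricm_mQ[OF R] ricm_QmQ[OF R(1)] vec_eq_iff field_simps)
    then show ?thesis using r by simp
  qed
  have S: "(\<Sum>l\<in>UNIV. \<Sum>m\<in>UNIV. \<Sum>n\<in>UNIV. ?X $ i $ l $ m $ n * \<psi> $ j $ l $ m $ n) = 0" for i j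
  proof -
    have "(\<Sum>l\<in>UNIV. \<Sum>m\<in>UNIV. \<Sum>n\<in>UNIV. ?X $ l $ i $ m $ n * \<psi> $ m $ n $ j $ l) = 0"
      using ricm_mult_Q[OF X, of i j] r rm by simp
    moreover have "?X $ l $ i $ m $ n * \<psi> $ m $ n $ j $ l = - (?X $ i $ l $ m $ n * \<psi> $ j $ l $ m $ n)" for l m n
    proof -
      have "\<psi> $ m $ n $ j $ l = \<psi> $ j $ l $ m $ n"
        using psi_alt(2)[of m n j l] psi_alt(1)[of m j n l] psi_alt(3)[of j m n l] psi_alt(2)[of j m l n] by linarith
      then show ?thesis using X1[of l i m n] by simp
    qed
    ultimately show ?thesis by (simp add: sum_negf)
  qed
  define b where "b i j k l = ?X $ i $ j $ k $ l + ?X $ j $ k $ i $ l + ?X $ k $ i $ j $ l" for i j k l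
  have "b i j k l = 0" for i j k l
  proof (rule four_form_zero[of b])
    fix i j k l
    show "b j i k l = - b i j k l" unfolding b_def using X1[of j i k l] X1[of i k j l] X1[of k j i l] by linarith
    show "b i k j l = - b i j k l" unfolding b_def using X1[of j i k l] X1[of i k j l] X1[of k j i l] by linarith
    show "b i j l k = - b i j k l" unfolding b_def
      using X2[of i j l k] X3[of i k j l] X1[of i k j l] X3[of l i j k] X1[of j k l i] X2[of j k l i] X3[of j l i k] by linarith
  next
    fix i m
    have p: "\<psi> $ m $ j $ k $ l = \<psi> $ m $ l $ j $ k" "\<psi> $ m $ j $ k $ l = \<psi> $ m $ k $ l $ j" for j k l
      using psi_alt(2)[of m j k l] psi_alt(3)[of m k j l] psi_alt(3)[of m j k l] psi_alt(2)[of m j l k]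
       psi_alt(2)[of m l j k] psi_alt(3)[of m j l k] psi_alt(3)[of m l j k] psi_alt(2)[of m k l j] psi_alt(3)[of m k l j] psi_alt(2)[of m k j l]
      by linarith+
    have 1: "(\<Sum>j\<in>UNIV. \<Sum>k\<in>UNIV. \<Sum>l\<in>UNIV. ?X $ j $ k $ i $ l * \<psi> $ m $ j $ k $ l) = 0"
    proof -
      have "?X $ j $ k $ i $ l * \<psi> $ m $ j $ k $ l = ?X $ i $ l $ j $ k * \<psi> $ m $ l $ j $ k" for j k l
        using X3[of i l j k] p(1)[of j k l] by simp
      then have "(\<Sum>j\<in>UNIV. \<Sum>k\<in>UNIV. \<Sum>l\<in>UNIV. ?X $ j $ k $ i $ l * \<psi> $ m $ j $ k $ l)
        = (\<Sum>j\<in>UNIV. \<Sum>k\<in>UNIV. \<Sum>l\<in>UNIV. ?X $ i $ l $ j $ k * \<psi> $ m $ l $ j $ k)" by simp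
      also have "\<dots> = (\<Sum>l\<in>UNIV. \<Sum>j\<in>UNIV. \<Sum>k\<in>UNIV. ?X $ i $ l $ j $ k * \<psi> $ m $ l $ j $ k)" by (rule sum_rot3[symmetric])
      finally show ?thesis using S by simp
    qed
    have 2: "(\<Sum>j\<in>UNIV. \<Sum>k\<in>UNIV. \<Sum>l\<in>UNIV. ?X $ k $ i $ j $ l * \<psi> $ m $ j $ k $ l) = 0"
    proof -
      have "?X $ k $ i $ j $ l * \<psi> $ m $ j $ k $ l = ?X $ i $ k $ l $ j * \<psi> $ m $ k $ l $ j" for j k l
        using X1[of k i j l] X2[of i k l j] p(2)[of j k l] by simp
      then have "(\<Sum>j\<in>UNIV. \<Sum>k\<in>UNIV. \<Sum>l\<in>UNIV. ?X $ k $ i $ j $ l * \<psi> $ m $ j $ k $ l)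
        = (\<Sum>j\<in>UNIV. \<Sum>k\<in>UNIV. \<Sum>l\<in>UNIV. ?X $ i $ k $ l $ j * \<psi> $ m $ k $ l $ j)" by simp
      also have "\<dots> = (\<Sum>k\<in>UNIV. \<Sum>l\<in>UNIV. \<Sum>j\<in>UNIV. ?X $ i $ k $ l $ j * \<psi> $ m $ k $ l $ j)" by (rule sum_rot3)
      finally show ?thesis using S by simp
    qed
    show "(\<Sum>j\<in>UNIV. \<Sum>k\<in>UNIV. \<Sum>l\<in>UNIV. b i j k l * \<psi> $ m $ j $ k $ l) = 0"
      unfolding b_def distrib_right sum.distrib 1 2 S by simp
  qed
  then show ?thesis unfolding bianchi_def b_def by blast
qed

lemma weyl77_iff: "U \<in> weyl77 f \<longleftrightarrow> U \<in> curv_sym \<and> mat4 U ** Phi = 0 \<and> ric U = 0"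
proof -
  have "(mat4 U ** Phi = 0) \<longleftrightarrow> (\<forall>i j m. (\<Sum>k\<in>UNIV. \<Sum>l\<in>UNIV. U $ i $ j $ k $ l * f $ k $ l $ m) = 0)"
    unfolding mat4_Phi_nth[symmetric] by (auto simp: vec_eq_iff)
  moreover have "ric U = 0 \<longleftrightarrow> (\<forall>j k. (\<Sum>l\<in>UNIV. U $ l $ j $ k $ l) = 0)"
    by (simp add: ric_def vec_eq_iff)
  ultimately show ?thesis unfolding weyl77_def by blast
qed

lemma subspace_weyl77: "subspace (weyl77 f)"
proof (rule subspaceI)
  have m0: "mat4 0 = 0" by (simp add: mat4_eq_0)
  show "0 \<in> weyl77 f" using subspace_0[OF subspace_curv_sym] by (simp add: weyl77_iff m0 matrix_mult_zero ric_zero)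
  show "x + y \<in> weyl77 f" if "x \<in> weyl77 f" "y \<in> weyl77 f" for x y
    using that by (simp add: weyl77_iff mat4_linear matrix_mult_add ric_linear subspace_add[OF subspace_curv_sym])
  show "c *\<^sub>R x \<in> weyl77 f" if "x \<in> weyl77 f" for x c
    using that by (simp add: weyl77_iff mat4_linear scaleR_matrix_mult ric_linear subspace_scale[OF subspace_curv_sym])
qed

lemma weyl77_diag14: "V \<in> weyl77 f \<Longrightarrow> diag14 V = V"
proof -
  assume V: "V \<in> weyl77 f"
  then have m: "mat4 V ** Phi = 0" "tr (mat4 V) = mat4 V" by (simp_all add: weyl77_iff curv_sym_mat4)
  have "mat4 V ** Q = 0"
    unfolding Q_def scaleR_matrix_mult matrix_mul_assoc m by (simp add: matrix_mult_zero)
  moreover have "Q ** mat4 V = 0"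
  proof -
    have "Q ** mat4 V = tr (mat4 V ** Q)" by (simp add: matrix_transpose_mul tr_Q m)
    then show ?thesis using \<open>mat4 V ** Q = 0\<close> by (simp add: vec_eq_iff transpose_nth)
  qed
  ultimately show ?thesis by (simp add: diag14_def P_def matrix_mult_diff ten4_mat4)
qed

lemma diag14_weyl77:
  assumes "U \<in> curv_sym" "ric (diag14 U) = 0"
  shows "diag14 U \<in> weyl77 f"
proof -
  have "mat4 (diag14 U) ** Phi = 0"
    unfolding diag14_def mat4_ten4 by (simp add: matrix_mul_assoc[symmetric] P_Phi matrix_mult_zero)
  then show ?thesis using assms by (simp add: weyl77_iff diag14_curv_sym)
qed

lemma subspace_ker: "subspace {U \<in> weyl_tensors. varpi f U = 0}"
proof (rule subspaceI)
  have m0: "mat4 0 = 0" by (simp add: mat4_eq_0)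
  have v0: "varpi f 0 = 0" by (simp add: varpi_Phi m0 matrix_mult_zero)
  show "0 \<in> {U \<in> weyl_tensors. varpi f U = 0}" using subspace_0[OF subspace_weyl_tensors] v0 by simp
  show "x + y \<in> {U \<in> weyl_tensors. varpi f U = 0}" if "x \<in> {U \<in> weyl_tensors. varpi f U = 0}" "y \<in> {U \<in> weyl_tensors. varpi f U = 0}" for x y
    using that by (simp add: varpi_linear subspace_add[OF subspace_weyl_tensors])
  show "c *\<^sub>R x \<in> {U \<in> weyl_tensors. varpi f U = 0}" if "x \<in> {U \<in> weyl_tensors. varpi f U = 0}" for x c
    using that by (simp add: varpi_linear subspace_scale[OF subspace_weyl_tensors])
qed

text \<open>Orthogonality to the 27-dimensional summand amounts to \<open>varpi f V = 0\<close>: the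
  part of V orthogonal to the kernel of \<open>varpi\<close> lies in that summand, hence is
  orthogonal to V and so to itself.\<close>

lemma weyl64_iff:
  "V \<in> weyl64 f \<longleftrightarrow> V \<in> weyl_tensors \<and> varpi f V = 0 \<and> (\<forall>Z\<in>weyl77 f. Z \<bullet> V = 0)"
proof
  assume V: "V \<in> weyl64 f"
  then have w: "V \<in> weyl_tensors" and V': "V \<in> (weyl27 f \<union> weyl77 f)\<^sup>\<bottom>" unfolding weyl64_def by blast+
  have o: "Z \<bullet> V = 0" if "Z \<in> weyl27 f \<union> weyl77 f" for Z
    using V' that unfolding orthogonal_comp_def orthogonal_def by blast
  obtain k where k: "k \<in> {U \<in> weyl_tensors. varpi f U = 0}" "V - k \<in> {U \<in> weyl_tensors. varpi f U = 0}\<^sup>\<bottom>"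
    using orth_decomp[OF subspace_ker] by blast
  have "V - k \<in> weyl_tensors" using k(1) by (intro subspace_diff[OF subspace_weyl_tensors w]) blast
  then have "V - k \<in> weyl27 f" using k(2) unfolding weyl27_def by blast
  then have 1: "(V - k) \<bullet> V = 0" using o by blast
  have 2: "k \<bullet> (V - k) = 0" using k unfolding orthogonal_comp_def orthogonal_def by blast
  have "(V - k) \<bullet> (V - k) = (V - k) \<bullet> V - k \<bullet> (V - k)" by (simp only: inner_diff_right inner_commute)
  then have "V = k" using 1 2 by simp
  then show "V \<in> weyl_tensors \<and> varpi f V = 0 \<and> (\<forall>Z\<in>weyl77 f. Z \<bullet> V = 0)" using k(1) o by blast
next
  assume V: "V \<in> weyl_tensors \<and> varpi f V = 0 \<and> (\<forall>Z\<in>weyl77 f. Z \<bullet> V = 0)"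
  have "Z \<bullet> V = 0" if "Z \<in> weyl27 f" for Z
  proof -
    have "V \<bullet> Z = 0" using that V unfolding weyl27_def orthogonal_comp_def orthogonal_def by blast
    then show ?thesis by (simp only: inner_commute)
  qed
  then show "V \<in> weyl64 f" using V unfolding weyl64_def orthogonal_comp_def orthogonal_def by blast
qed

lemma subspace_weyl64: "subspace (weyl64 f)"
  unfolding weyl64_def by (intro subspace_inter subspace_weyl_tensors subspace_orthogonal_comp)

end

section \<open>The vanishing of each block in terms of Ricci and Weyl curvature\<close>

locale g2_curvature = g2_tensors +
  fixes R :: tensor4
  assumes R: "R \<in> curv_sym" "bianchi R"
begin

definition W :: tensor4 where "W = weyl R"
definition h :: tensor2 where "h = (1 / 5) *\<^sub>R ric0 R + (scal R / 84) *\<^sub>R mat 1"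
definition \<omega> :: tensor2 where "\<omega> = varpi f W"

lemma W_eq: "W = R - kulkarni_nomizu h" unfolding W_def h_def by (rule weyl_kulkarni_nomizu)

lemma h_sym: "h $ j $ i = h $ i $ j"
  by (simp add: h_def ric0_sym[OF R(1), of j i] mat_def)

lemma ric_R: "ric R = ric0 R + (scal R / 7) *\<^sub>R mat 1" by (simp add: ric0_def)

lemma trace_h: "trace2 h = scal R / 12"
  by (simp add: h_def trace2_linear trace_ric0)

text \<open>4/5 is 4 times 1/5, and -2/7 is 4/84 - 4/12, where the trace of h is one twelfth of the
  scalar curvature.\<close>

lemma varpi_R: "varpi f R = \<omega> + (4 / 5) *\<^sub>R ric0 R - (2 * scal R / 7) *\<^sub>R mat 1"
proof -
  have "\<omega> = varpi f R - (4 *\<^sub>R h - (4 * trace2 h) *\<^sub>R mat 1)"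
    unfolding \<omega>_def W_eq varpi_linear varpi_kulkarni_nomizu[OF h_sym] by (rule refl)
  then show ?thesis unfolding trace_h unfolding h_def by (simp add: vec_eq_iff algebra_simps)
qed

lemma trace_R: "trace2 (varpi f R) = - 2 * scal R"
  by (rule trace_varpi[OF R])

lemma ric_diag14_R: "ric (diag14 R) = (1 / 180) *\<^sub>R (64 *\<^sub>R ric0 R + 5 *\<^sub>R \<omega>) + (2 * scal R / 21) *\<^sub>R mat 1"
  unfolding ric_diag14[OF R] trace_R unfolding varpi_R ric_R by (simp add: vec_eq_iff field_simps)

text \<open>The multiples of the metric cancel, so the off-diagonal part puts no condition on the
  scalar curvature.\<close>

lemma ric_offdiag_R: "ric (offdiag R) = (1 / 90) *\<^sub>R (56 *\<^sub>R ric0 R - 5 *\<^sub>R \<omega>)"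
  unfolding ric_offdiag[OF R] trace_R unfolding varpi_R ric_R by (simp add: vec_eq_iff field_simps)

lemma trace_\<omega>: "trace2 \<omega> = 0"
  using trace_R unfolding varpi_R trace2_linear by (simp add: trace_ric0)

lemma inner_W: "V \<in> curv_sym \<Longrightarrow> ric V = 0 \<Longrightarrow> V \<bullet> W = V \<bullet> R"
  unfolding W_eq inner_diff_right by (simp add: inner_kulkarni_nomizu)

lemma diag7_R_eq_0_iff: "diag7 R = 0 \<longleftrightarrow> scal R = 0 \<and> 4 *\<^sub>R ric0 R + 5 *\<^sub>R \<omega> = 0"
proof -
  have "varpi f R = 0 \<longleftrightarrow> scal R = 0 \<and> 4 *\<^sub>R ric0 R + 5 *\<^sub>R \<omega> = 0"
  proof
    assume v: "varpi f R = 0"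
    then have s: "scal R = 0" using trace_R by (simp add: trace2_linear)
    have "5 *\<^sub>R varpi f R = 4 *\<^sub>R ric0 R + 5 *\<^sub>R \<omega>" unfolding varpi_R s by (simp add: vec_eq_iff)
    then show "scal R = 0 \<and> 4 *\<^sub>R ric0 R + 5 *\<^sub>R \<omega> = 0" using s v by simp
  next
    assume a: "scal R = 0 \<and> 4 *\<^sub>R ric0 R + 5 *\<^sub>R \<omega> = 0"
    have "varpi f R = (1 / 5) *\<^sub>R (4 *\<^sub>R ric0 R + 5 *\<^sub>R \<omega>) - (2 * scal R / 7) *\<^sub>R mat 1" unfolding varpi_R by (simp add: vec_eq_iff)
    then show "varpi f R = 0" using a by simp
  qed
  then show ?thesis by (simp only: diag7_eq_0)
qed

lemma diag14_R_eq_0_iff: "diag14 R = 0 \<longleftrightarrow> scal R = 0 \<and> 64 *\<^sub>R ric0 R + 5 *\<^sub>R \<omega> = 0 \<and> orth_proj (weyl77 f) W = 0"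
proof
  assume S: "diag14 R = 0"
  have r: "(1 / 180) *\<^sub>R (64 *\<^sub>R ric0 R + 5 *\<^sub>R \<omega>) + (2 * scal R / 21) *\<^sub>R mat 1 = (0 :: tensor2)"
    unfolding ric_diag14_R[symmetric] S by (rule ric_zero)
  then have "trace2 ((1 / 180) *\<^sub>R (64 *\<^sub>R ric0 R + 5 *\<^sub>R \<omega>) + (2 * scal R / 21) *\<^sub>R mat 1) = 0" by (simp add: trace2_linear)
  \<comment> \<open>\<open>ric0 R\<close> and \<omega> are traceless, so the trace isolates the
    scalar curvature.\<close>
  then have s: "scal R = 0" unfolding trace2_linear trace_ric0 trace_\<omega> by simp
  have "V \<bullet> W = 0" if V: "V \<in> weyl77 f" for V
  proof -
    have "V \<bullet> W = V \<bullet> R" using V by (intro inner_W) (simp_all add: weyl77_iff)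
    also have "\<dots> = diag14 V \<bullet> R" by (simp add: weyl77_diag14[OF V])
    also have "\<dots> = 0" unfolding inner_diag14[symmetric] S by simp
    finally show ?thesis .
  qed
  then show "scal R = 0 \<and> 64 *\<^sub>R ric0 R + 5 *\<^sub>R \<omega> = 0 \<and> orth_proj (weyl77 f) W = 0"
    using r s by (simp add: orth_proj_eq_0_iff[OF subspace_weyl77])
next
  assume a: "scal R = 0 \<and> 64 *\<^sub>R ric0 R + 5 *\<^sub>R \<omega> = 0 \<and> orth_proj (weyl77 f) W = 0"
  have r: "ric (diag14 R) = 0" unfolding ric_diag14_R using a by simp
  have S: "diag14 R \<in> weyl77 f" by (rule diag14_weyl77[OF R(1) r])
  have "diag14 R \<bullet> W = 0" using a S by (simp add: orth_proj_eq_0_iff[OF subspace_weyl77])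
  then have "diag14 R \<bullet> R = 0" using inner_W[OF diag14_curv_sym[OF R(1)] r] by simp
  moreover have "diag14 R \<bullet> diag14 R = diag14 R \<bullet> R" unfolding inner_diag14[of "diag14 R"] diag14_diag14 by (rule refl)
  ultimately show "diag14 R = 0" by simp
qed

lemma offdiag_R_eq_0_iff: "offdiag R = 0 \<longleftrightarrow> 56 *\<^sub>R ric0 R - 5 *\<^sub>R \<omega> = 0 \<and> orth_proj (weyl64 f) W = 0"
proof
  assume X: "offdiag R = 0"
  have r: "(1 / 90) *\<^sub>R (56 *\<^sub>R ric0 R - 5 *\<^sub>R \<omega>) = (0 :: tensor2)"
    unfolding ric_offdiag_R[symmetric] X by (rule ric_zero)
  have "V \<bullet> W = 0" if V: "V \<in> weyl64 f" for V
  proof -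
    have v: "V \<in> curv_sym" "bianchi V" "ric V = 0" "varpi f V = 0" "\<And>Z. Z \<in> weyl77 f \<Longrightarrow> Z \<bullet> V = 0"
      using V by (auto simp: weyl64_iff weyl_tensors_iff)
    \<comment> \<open>The block of V on the 14-dimensional summand is Ricci-flat, hence in
      \<open>weyl77 f\<close> and orthogonal to V; its inner product with V is its own squared norm,
      so it vanishes. With \<open>varpi f V = 0\<close>, V is purely off-diagonal.\<close>
    have "ric (diag14 V) = 0" unfolding ric_diag14[OF v(1,2)] v(3,4) by (simp add: trace2_linear)
    then have "diag14 V \<bullet> V = 0" using diag14_weyl77[OF v(1)] v(5) by blast
    moreover have "diag14 V \<bullet> diag14 V = diag14 V \<bullet> V" unfolding inner_diag14[of "diag14 V"] diag14_diag14 by (rule refl)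
    ultimately have S: "diag14 V = 0" by simp
    have "diag7 V = 0" using v(4) by (simp add: diag7_eq_0)
    then have "V = offdiag V" using decompose[of V] S by simp
    then have "V \<bullet> R = offdiag V \<bullet> R" by simp
    also have "\<dots> = 0" unfolding inner_offdiag[symmetric] X by simp
    finally show ?thesis using inner_W[OF v(1,3)] by simp
  qed
  then show "56 *\<^sub>R ric0 R - 5 *\<^sub>R \<omega> = 0 \<and> orth_proj (weyl64 f) W = 0"
    using r by (simp add: orth_proj_eq_0_iff[OF subspace_weyl64])
next
  assume a: "56 *\<^sub>R ric0 R - 5 *\<^sub>R \<omega> = 0 \<and> orth_proj (weyl64 f) W = 0"
  have r: "ric (offdiag R) = 0" unfolding ric_offdiag_R using a by simp
  have "Z \<bullet> offdiag R = 0" if Z: "Z \<in> weyl77 f" for Z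
    using weyl77_diag14[OF Z] diag14_offdiag[of R] inner_diag14[of Z "offdiag R"] by simp
  then have "offdiag R \<in> weyl64 f"
    unfolding weyl64_iff weyl_tensors_iff using offdiag_curv_sym[OF R(1)] offdiag_bianchi[OF R r] r varpi_offdiag by blast
  then have "offdiag R \<bullet> W = 0" using a by (simp add: orth_proj_eq_0_iff[OF subspace_weyl64])
  then have "offdiag R \<bullet> R = 0" using inner_W[OF offdiag_curv_sym[OF R(1)] r] by simp
  moreover have "offdiag R \<bullet> offdiag R = offdiag R \<bullet> R" unfolding inner_offdiag[of "offdiag R"] offdiag_offdiag by (rule refl)
  ultimately show "offdiag R = 0" by simp
qed

end

section \<open>The blocks as maps on 2-forms\<close>

context g2_tensors
begin

lemma Q_vec2_nth: "(Q *v vec2 \<beta>) $ (a, b) = (\<Sum>k\<in>UNIV. (\<Sum>i\<in>UNIV. \<Sum>j\<in>UNIV. \<beta> $ i $ j * f $ i $ j $ k) * f $ a $ b $ k) / 6"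
proof -
  have "Q *v vec2 \<beta> = (1 / 6) *\<^sub>R (Phi *v (tr Phi *v vec2 \<beta>))"
    unfolding Q_def scaleR_matrix_vector_assoc[symmetric] matrix_vector_mul_assoc by (rule refl)
  moreover have "(Phi *v (tr Phi *v vec2 \<beta>)) $ (a, b) = (\<Sum>k\<in>UNIV. (\<Sum>i\<in>UNIV. \<Sum>j\<in>UNIV. \<beta> $ i $ j * f $ i $ j $ k) * f $ a $ b $ k)"
    by (simp add: matrix_vector_mult_def transpose_nth Phi_nth sum_UNIV_prod vec2_nth mult.commute)
  ultimately show ?thesis by simp
qed

text \<open>The eigenvalues are thus 2 - 6 = -4 on the range of \<open>Q\<close> and 2 on the
  2-forms in its kernel.\<close>

lemma P_op_eq: "\<beta> \<in> two_forms \<Longrightarrow> vec2 (P_op \<psi> \<beta>) = 2 *\<^sub>R vec2 \<beta> - 6 *\<^sub>R (Q *v vec2 \<beta>)"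
proof -
  assume b: "\<beta> \<in> two_forms"
  have "vec2 (P_op \<psi> \<beta>) $ (i, j) = (2 *\<^sub>R vec2 \<beta> - 6 *\<^sub>R (Q *v vec2 \<beta>)) $ (i, j)" for i j
    unfolding vector_minus_component vector_scaleR_component vec2_nth Q_vec2_nth
    using psi_contract2[of "\<lambda>i j. \<beta> $ i $ j" i j, OF two_formsD[OF b]] by (simp add: P_op_def)
  then show ?thesis by (simp add: vec_eq_iff)
qed

lemma Omega7_iff: "\<beta> \<in> Omega7 \<psi> \<longleftrightarrow> \<beta> \<in> two_forms \<and> Q *v vec2 \<beta> = vec2 \<beta>"
proof -
  have "P_op \<psi> \<beta> = (- 4) *\<^sub>R \<beta> \<longleftrightarrow> Q *v vec2 \<beta> = vec2 \<beta>" if "\<beta> \<in> two_forms"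
    unfolding vec2_inject[symmetric] P_op_eq[OF that] vec2_linear by (auto simp: vec_eq_iff)
  then show ?thesis unfolding Omega7_def by blast
qed

lemma Omega14_iff: "\<beta> \<in> Omega14 \<psi> \<longleftrightarrow> \<beta> \<in> two_forms \<and> Q *v vec2 \<beta> = 0"
proof -
  have "P_op \<psi> \<beta> = 2 *\<^sub>R \<beta> \<longleftrightarrow> Q *v vec2 \<beta> = 0" if "\<beta> \<in> two_forms"
    unfolding vec2_inject[symmetric] P_op_eq[OF that] vec2_linear by simp
  then show ?thesis unfolding Omega14_def by blast
qed

lemma subspace_two_forms: "subspace two_forms"
proof (rule subspaceI)
  show "0 \<in> two_forms" by (rule two_formsI) simp
  show "x + y \<in> two_forms" if "x \<in> two_forms" "y \<in> two_forms" for x y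
  proof (rule two_formsI)
    fix i j show "(x + y) $ j $ i = - (x + y) $ i $ j"
      using two_formsD[OF that(1), of j i] two_formsD[OF that(2), of j i] by simp
  qed
  show "c *\<^sub>R x \<in> two_forms" if "x \<in> two_forms" for x c
  proof (rule two_formsI)
    fix i j show "(c *\<^sub>R x) $ j $ i = - (c *\<^sub>R x) $ i $ j"
      using two_formsD[OF that, of j i] by simp
  qed
qed

lemma subspace_Omega: "subspace (Omega7 \<psi>)" "subspace (Omega14 \<psi>)"
proof -
  have l: "Q *v (x + y) = Q *v x + Q *v y" "Q *v (c *\<^sub>R x) = c *\<^sub>R (Q *v x)" "Q *v 0 = 0" for x y c
    by (simp_all add: matrix_vector_right_distrib matrix_vector_mult_scaleR)
  show "subspace (Omega7 \<psi>)"
  proof (rule subspaceI)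
    show "0 \<in> Omega7 \<psi>" by (simp add: Omega7_iff vec2_linear l subspace_0[OF subspace_two_forms])
    show "x + y \<in> Omega7 \<psi>" if "x \<in> Omega7 \<psi>" "y \<in> Omega7 \<psi>" for x y
      using that by (simp add: Omega7_iff vec2_linear l subspace_add[OF subspace_two_forms])
    show "c *\<^sub>R x \<in> Omega7 \<psi>" if "x \<in> Omega7 \<psi>" for x c
      using that by (simp add: Omega7_iff vec2_linear l subspace_scale[OF subspace_two_forms])
  qed
  show "subspace (Omega14 \<psi>)"
  proof (rule subspaceI)
    show "0 \<in> Omega14 \<psi>" by (simp add: Omega14_iff vec2_linear l subspace_0[OF subspace_two_forms])
    show "x + y \<in> Omega14 \<psi>" if "x \<in> Omega14 \<psi>" "y \<in> Omega14 \<psi>" for x y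
      using that by (simp add: Omega14_iff vec2_linear l subspace_add[OF subspace_two_forms])
    show "c *\<^sub>R x \<in> Omega14 \<psi>" if "x \<in> Omega14 \<psi>" for x c
      using that by (simp add: Omega14_iff vec2_linear l subspace_scale[OF subspace_two_forms])
  qed
qed

lemma two_forms_ten2_Q: "ten2 (Q *v v) \<in> two_forms"
proof (rule two_formsI)
  fix i j show "ten2 (Q *v v) $ j $ i = - ten2 (Q *v v) $ i $ j"
    unfolding ten2_nth matrix_vector_mult_def vec_lambda_beta row_antiD[OF row_anti_Q, of j i] by (simp add: sum_negf)
qed

lemma Q_inner: "(Q *v x) \<bullet> y = x \<bullet> (Q *v y)"
  using dot_lmul_matrix[of x Q y] tr_Q by (metis dot_lmul_matrix inner_commute transpose_matrix_vector)

lemma orth_proj_Omega7: "vec2 (orth_proj (Omega7 \<psi>) \<beta>) = Q *v vec2 \<beta>"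
proof -
  have "orth_proj (Omega7 \<psi>) \<beta> = ten2 (Q *v vec2 \<beta>)"
  proof (rule orth_proj_eqI[OF subspace_Omega(1)])
    show "ten2 (Q *v vec2 \<beta>) \<in> Omega7 \<psi>"
      unfolding Omega7_iff vec2_ten2 using two_forms_ten2_Q by (simp add: matrix_vector_mul_assoc QQ)
    have "y \<bullet> (\<beta> - ten2 (Q *v vec2 \<beta>)) = 0" if "y \<in> Omega7 \<psi>" for y
    proof -
      have "y \<bullet> (\<beta> - ten2 (Q *v vec2 \<beta>)) = (Q *v vec2 y) \<bullet> (vec2 \<beta> - Q *v vec2 \<beta>)"
        using that unfolding Omega7_iff vec2_inner[symmetric] vec2_linear vec2_ten2 by simp
      also have "\<dots> = 0" unfolding Q_inner by (simp add: matrix_vector_mult_diff_distrib matrix_vector_mul_assoc QQ)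
      finally show ?thesis .
    qed
    then show "\<beta> - ten2 (Q *v vec2 \<beta>) \<in> (Omega7 \<psi>)\<^sup>\<bottom>" by (simp add: orthogonal_comp_def orthogonal_def)
  qed
  then show ?thesis by (simp add: vec2_ten2)
qed

text \<open>The restriction to 2-forms reflects that \<open>P\<close> fixes symmetric tensors, which
  the orthogonal projection to \<open>Omega14\<close> sends to zero.\<close>

lemma orth_proj_Omega14: "\<beta> \<in> two_forms \<Longrightarrow> vec2 (orth_proj (Omega14 \<psi>) \<beta>) = P *v vec2 \<beta>"
proof -
  assume b: "\<beta> \<in> two_forms"
  have "orth_proj (Omega14 \<psi>) \<beta> = \<beta> - ten2 (Q *v vec2 \<beta>)"
  proof (rule orth_proj_eqI[OF subspace_Omega(2)])
    show "\<beta> - ten2 (Q *v vec2 \<beta>) \<in> Omega14 \<psi>"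
      unfolding Omega14_iff vec2_linear vec2_ten2
      using subspace_diff[OF subspace_two_forms b two_forms_ten2_Q] by (simp add: matrix_vector_mult_diff_distrib matrix_vector_mul_assoc QQ)
    have "y \<bullet> (\<beta> - (\<beta> - ten2 (Q *v vec2 \<beta>))) = 0" if "y \<in> Omega14 \<psi>" for y
    proof -
      have "y \<bullet> (\<beta> - (\<beta> - ten2 (Q *v vec2 \<beta>))) = vec2 y \<bullet> (Q *v vec2 \<beta>)"
        unfolding vec2_inner[symmetric] vec2_linear vec2_ten2 by simp
      also have "\<dots> = 0" using that unfolding Q_inner[symmetric] Omega14_iff by simp
      finally show ?thesis .
    qed
    then show "\<beta> - (\<beta> - ten2 (Q *v vec2 \<beta>)) \<in> (Omega14 \<psi>)\<^sup>\<bottom>" by (simp only: orthogonal_comp_def orthogonal_def mem_Collect_eq) blast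
  qed
  then show ?thesis by (simp add: vec2_ten2 vec2_linear P_def matrix_vector_mult_diff_rdistrib)
qed

lemma Omega7_block:
  assumes U: "U \<in> curv_sym"
  shows "vec2 (block (Omega7 \<psi>) (Omega7 \<psi>) U \<beta>) = (Q ** mat4 U ** Q) *v vec2 \<beta>"
    and "vec2 (block (Omega7 \<psi>) (Omega14 \<psi>) U \<beta>) = (P ** mat4 U ** Q) *v vec2 \<beta>"
  unfolding block_def orth_proj_Omega7 orth_proj_Omega14[OF curv_op_two_forms[OF U]] vec2_curv_op
  by (simp_all add: matrix_vector_mul_assoc matrix_mul_assoc)

lemma Omega14_block:
  assumes U: "U \<in> curv_sym" and b: "\<beta> \<in> two_forms"
  shows "vec2 (block (Omega14 \<psi>) (Omega14 \<psi>) U \<beta>) = (P ** mat4 U ** P) *v vec2 \<beta>"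
    and "vec2 (block (Omega14 \<psi>) (Omega7 \<psi>) U \<beta>) = (Q ** mat4 U ** P) *v vec2 \<beta>"
  unfolding block_def orth_proj_Omega7 orth_proj_Omega14[OF b] orth_proj_Omega14[OF curv_op_two_forms[OF U]] vec2_curv_op
  by (simp_all add: matrix_vector_mul_assoc matrix_mul_assoc)

lemma vec2_eq_0: "vec2 \<beta> = 0 \<longleftrightarrow> \<beta> = 0"
  by (metis vec2_inject vec2_linear(4))

lemma ten4_eq_0: "ten4 M = 0 \<longleftrightarrow> M = 0"
  by (metis mat4_eq_0 mat4_ten4)

lemma vanish_on_two_forms_sym:
  assumes "ten4 M \<in> curv_sym"
  shows "(\<forall>\<beta>\<in>two_forms. M *v vec2 \<beta> = 0) \<longleftrightarrow> ten4 M = 0"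
proof -
  have "row_anti (tr M)" using assms unfolding curv_sym_mat4 mat4_ten4 by simp
  then show ?thesis by (simp only: vanish_on_two_forms ten4_eq_0)
qed

lemma diag7_curv_sym: "U \<in> curv_sym \<Longrightarrow> diag7 U \<in> curv_sym"
  unfolding curv_sym_mat4 diag7_def mat4_ten4
  by (simp add: matrix_transpose_mul tr_Q row_anti_Q row_anti_mult matrix_mul_assoc)

lemma block_7_7_iff:
  assumes U: "U \<in> curv_sym"
  shows "(\<forall>\<beta>\<in>two_forms. block (Omega7 \<psi>) (Omega7 \<psi>) U \<beta> = 0) \<longleftrightarrow> diag7 U = 0"
  using vanish_on_two_forms_sym[of "Q ** mat4 U ** Q"] diag7_curv_sym[OF U]
  unfolding diag7_def vec2_eq_0[symmetric] Omega7_block[OF U] by blast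

lemma block_14_14_iff:
  assumes U: "U \<in> curv_sym"
  shows "(\<forall>\<beta>\<in>two_forms. block (Omega14 \<psi>) (Omega14 \<psi>) U \<beta> = 0) \<longleftrightarrow> diag14 U = 0"
  using vanish_on_two_forms_sym[of "P ** mat4 U ** P"] diag14_curv_sym[OF U]
  unfolding diag14_def vec2_eq_0[symmetric] by (simp add: Omega14_block[OF U])

lemma block_off_iff:
  assumes U: "U \<in> curv_sym"
  shows "(\<forall>\<beta>\<in>two_forms. block (Omega7 \<psi>) (Omega14 \<psi>) U \<beta> + block (Omega14 \<psi>) (Omega7 \<psi>) U \<beta> = 0) \<longleftrightarrow> offdiag U = 0"
proof -
  have "vec2 (block (Omega7 \<psi>) (Omega14 \<psi>) U \<beta> + block (Omega14 \<psi>) (Omega7 \<psi>) U \<beta>)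
    = (P ** mat4 U ** Q + Q ** mat4 U ** P) *v vec2 \<beta>" if "\<beta> \<in> two_forms" for \<beta>
    unfolding vec2_linear Omega7_block[OF U] Omega14_block[OF U that] by (simp only: matrix_vector_mult_add_rdistrib)
  then show ?thesis
    using vanish_on_two_forms_sym[of "P ** mat4 U ** Q + Q ** mat4 U ** P"] offdiag_curv_sym[OF U]
    unfolding offdiag_def vec2_eq_0[symmetric] by simp
qed

lemma Omega_iff_blocks:
  assumes b: "\<beta> \<in> two_forms"
  shows "\<beta> \<in> Omega7 \<psi> \<longleftrightarrow> P *v vec2 \<beta> = 0" and "\<beta> \<in> Omega14 \<psi> \<longleftrightarrow> Q *v vec2 \<beta> = 0"
    and "\<beta> \<in> Omega14 \<psi> \<longleftrightarrow> P *v vec2 \<beta> = vec2 \<beta>"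
  unfolding Omega7_iff Omega14_iff P_def matrix_vector_mult_diff_rdistrib using b by auto

lemma curv_op_Omega:
  assumes U: "U \<in> curv_sym"
  shows "curv_op U ` Omega7 \<psi> \<subseteq> Omega7 \<psi> \<longleftrightarrow> (\<forall>\<beta>\<in>two_forms. (P ** mat4 U ** Q) *v vec2 \<beta> = 0)" (is "?a")
    and "curv_op U ` Omega7 \<psi> \<subseteq> Omega14 \<psi> \<longleftrightarrow> (\<forall>\<beta>\<in>two_forms. (Q ** mat4 U ** Q) *v vec2 \<beta> = 0)" (is "?b")
    and "curv_op U ` Omega14 \<psi> \<subseteq> Omega7 \<psi> \<longleftrightarrow> (\<forall>\<beta>\<in>two_forms. (P ** mat4 U ** P) *v vec2 \<beta> = 0)" (is "?c")
    and "curv_op U ` Omega14 \<psi> \<subseteq> Omega14 \<psi> \<longleftrightarrow> (\<forall>\<beta>\<in>two_forms. (Q ** mat4 U ** P) *v vec2 \<beta> = 0)" (is "?d")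
proof -
  \<comment> \<open>\<open>Q\<close> maps 2-forms into \<open>Omega7\<close> and fixes its elements,
    so a condition on \<open>Omega7\<close> becomes one on all 2-forms after composition with
    \<open>Q\<close>; 14 is the analogue for \<open>P\<close>.\<close>
  have 7: "(\<forall>\<beta>\<in>Omega7 \<psi>. (M ** mat4 U) *v vec2 \<beta> = 0) \<longleftrightarrow> (\<forall>\<beta>\<in>two_forms. (M ** mat4 U ** Q) *v vec2 \<beta> = 0)" for M :: "real^(7 \<times> 7)^(7 \<times> 7)"
  proof (intro iffI ballI)
    fix \<beta> assume a: "\<forall>\<beta>\<in>Omega7 \<psi>. (M ** mat4 U) *v vec2 \<beta> = 0"
    have "ten2 (Q *v vec2 \<beta>) \<in> Omega7 \<psi>"
      unfolding Omega7_iff vec2_ten2 using two_forms_ten2_Q by (simp add: matrix_vector_mul_assoc QQ)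
    then have "(M ** mat4 U) *v vec2 (ten2 (Q *v vec2 \<beta>)) = 0" using a by blast
    then show "(M ** mat4 U ** Q) *v vec2 \<beta> = 0" unfolding vec2_ten2 by (simp add: matrix_vector_mul_assoc)
  next
    fix \<beta> assume a: "\<forall>\<beta>\<in>two_forms. (M ** mat4 U ** Q) *v vec2 \<beta> = 0" and b: "\<beta> \<in> Omega7 \<psi>"
    then have t: "\<beta> \<in> two_forms" and q: "Q *v vec2 \<beta> = vec2 \<beta>" by (simp_all only: Omega7_iff)
    have "(M ** mat4 U ** Q) *v vec2 \<beta> = 0" using a t by blast
    then have "(M ** mat4 U) *v (Q *v vec2 \<beta>) = 0" by (simp only: matrix_vector_mul_assoc)
    then show "(M ** mat4 U) *v vec2 \<beta> = 0" by (simp only: q)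
  qed
  have 14: "(\<forall>\<beta>\<in>Omega14 \<psi>. (M ** mat4 U) *v vec2 \<beta> = 0) \<longleftrightarrow> (\<forall>\<beta>\<in>two_forms. (M ** mat4 U ** P) *v vec2 \<beta> = 0)" for M :: "real^(7 \<times> 7)^(7 \<times> 7)"
  proof (intro iffI ballI)
    fix \<beta> assume a: "\<forall>\<beta>\<in>Omega14 \<psi>. (M ** mat4 U) *v vec2 \<beta> = 0" and b: "\<beta> \<in> two_forms"
    have v: "vec2 (\<beta> - ten2 (Q *v vec2 \<beta>)) = P *v vec2 \<beta>"
      by (simp add: vec2_linear vec2_ten2 P_def matrix_vector_mult_diff_rdistrib)
    have "\<beta> - ten2 (Q *v vec2 \<beta>) \<in> Omega14 \<psi>"
      unfolding Omega14_iff v using subspace_diff[OF subspace_two_forms b two_forms_ten2_Q] by (simp add: matrix_vector_mul_assoc PQ)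
    then have "(M ** mat4 U) *v (P *v vec2 \<beta>) = 0" using a unfolding v[symmetric] by blast
    then show "(M ** mat4 U ** P) *v vec2 \<beta> = 0" by (simp add: matrix_vector_mul_assoc)
  next
    fix \<beta> assume a: "\<forall>\<beta>\<in>two_forms. (M ** mat4 U ** P) *v vec2 \<beta> = 0" and b: "\<beta> \<in> Omega14 \<psi>"
    then have t: "\<beta> \<in> two_forms" by (simp add: Omega14_iff)
    have "P *v vec2 \<beta> = vec2 \<beta>" using Omega_iff_blocks(3)[OF t] b by blast
    moreover have "(M ** mat4 U) *v (P *v vec2 \<beta>) = 0" using a t by (simp only: matrix_vector_mul_assoc)
    ultimately show "(M ** mat4 U) *v vec2 \<beta> = 0" by simp
  qed
  note two = curv_op_two_forms[OF U]
  show ?a unfolding 7[symmetric] image_subset_iff Omega_iff_blocks(1)[OF two] vec2_curv_op by (simp only: matrix_vector_mul_assoc)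
  show ?b unfolding 7[symmetric] image_subset_iff Omega_iff_blocks(2)[OF two] vec2_curv_op by (simp only: matrix_vector_mul_assoc)
  show ?c unfolding 14[symmetric] image_subset_iff Omega_iff_blocks(1)[OF two] vec2_curv_op by (simp only: matrix_vector_mul_assoc)
  show ?d unfolding 14[symmetric] image_subset_iff Omega_iff_blocks(2)[OF two] vec2_curv_op by (simp only: matrix_vector_mul_assoc)
qed

lemma reverses_iff:
  assumes U: "U \<in> curv_sym"
  shows "curv_op U ` Omega7 \<psi> \<subseteq> Omega14 \<psi> \<and> curv_op U ` Omega14 \<psi> \<subseteq> Omega7 \<psi> \<longleftrightarrow> diag7 U = 0 \<and> diag14 U = 0"
  using vanish_on_two_forms_sym[of "Q ** mat4 U ** Q"] diag7_curv_sym[OF U] vanish_on_two_forms_sym[of "P ** mat4 U ** P"] diag14_curv_sym[OF U]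
  unfolding curv_op_Omega[OF U] diag7_def diag14_def by blast

lemma preserves_iff:
  assumes U: "U \<in> curv_sym"
  shows "curv_op U ` Omega7 \<psi> \<subseteq> Omega7 \<psi> \<and> curv_op U ` Omega14 \<psi> \<subseteq> Omega14 \<psi> \<longleftrightarrow> offdiag U = 0"
proof -
  let ?X = "P ** mat4 U ** Q + Q ** mat4 U ** P"
  have "(\<forall>\<beta>\<in>two_forms. (P ** mat4 U ** Q) *v vec2 \<beta> = 0) \<and> (\<forall>\<beta>\<in>two_forms. (Q ** mat4 U ** P) *v vec2 \<beta> = 0)
    \<longleftrightarrow> (\<forall>\<beta>\<in>two_forms. ?X *v vec2 \<beta> = 0)" (is "?l \<longleftrightarrow> ?r")
  proof
    assume ?l then show ?r by (simp add: matrix_vector_mult_add_rdistrib)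
  next
    assume r: ?r
    \<comment> \<open>Multiplication by \<open>P\<close> or \<open>Q\<close> on the left recovers
      either half of the off-diagonal part from the sum.\<close>
    have "P ** mat4 U ** Q = P ** ?X" "Q ** mat4 U ** P = Q ** ?X"
      by (simp_all add: matrix_mult_add matrix_mul_assoc PQ QQ matrix_mult_zero)
    then have "(P ** mat4 U ** Q) *v v = P *v (?X *v v)" "(Q ** mat4 U ** P) *v v = Q *v (?X *v v)" for v
      by (simp_all only: matrix_vector_mul_assoc)
    then show ?l using r by simp
  qed
  then show ?thesis
    using vanish_on_two_forms_sym[of ?X] offdiag_curv_sym[OF U] unfolding curv_op_Omega[OF U] offdiag_def by blast
qed

end

lemma frame_equivalences:
  fixes \<phi> g \<nu> F
  assumes G2: "G2_structure X A \<phi> g \<nu>" and F: "F \<in> frames A g S"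
  defines "f \<equiv> phi_comp \<phi> F" and "\<psi> \<equiv> psi_comp \<phi> \<nu> F" and "R \<equiv> riem_comp g F"
  shows "(\<forall>\<beta>\<in>two_forms. block (Omega7 \<psi>) (Omega7 \<psi>) R \<beta> = 0)
      \<longleftrightarrow> scal R = 0 \<and> 4 *\<^sub>R ric0 R + 5 *\<^sub>R varpi f (weyl R) = 0"
    and "(\<forall>\<beta>\<in>two_forms. block (Omega14 \<psi>) (Omega14 \<psi>) R \<beta> = 0)
      \<longleftrightarrow> scal R = 0 \<and> 64 *\<^sub>R ric0 R + 5 *\<^sub>R varpi f (weyl R) = 0 \<and> orth_proj (weyl77 f) (weyl R) = 0"
    and "(\<forall>\<beta>\<in>two_forms. block (Omega7 \<psi>) (Omega14 \<psi>) R \<beta> + block (Omega14 \<psi>) (Omega7 \<psi>) R \<beta> = 0)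
      \<longleftrightarrow> 56 *\<^sub>R ric0 R - 5 *\<^sub>R varpi f (weyl R) = 0 \<and> orth_proj (weyl64 f) (weyl R) = 0"
    and "curv_op R ` Omega7 \<psi> \<subseteq> Omega7 \<psi> \<and> curv_op R ` Omega14 \<psi> \<subseteq> Omega14 \<psi>
      \<longleftrightarrow> orth_proj (weyl64 f) (weyl R) = 0 \<and> varpi f (weyl R) = (56 / 5) *\<^sub>R ric0 R"
    and "curv_op R ` Omega7 \<psi> \<subseteq> Omega14 \<psi> \<and> curv_op R ` Omega14 \<psi> \<subseteq> Omega7 \<psi>
      \<longleftrightarrow> ric R = 0 \<and> varpi f (weyl R) = 0 \<and> orth_proj (weyl77 f) (weyl R) = 0"
proof -
  obtain c p e where F': "F = (c, p, e)" by (cases F)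
  note fr = F[unfolded F']
  interpret g2_curvature f \<psi> R
    unfolding g2_curvature_def g2_curvature_axioms_def bianchi_def f_def \<psi>_def R_def F'
    using G2_structure_tensors[OF G2 fr] riem_comp_curvature[OF G2 fr] by blast
  note parts = diag7_R_eq_0_iff[unfolded \<omega>_def W_def] diag14_R_eq_0_iff[unfolded \<omega>_def W_def] offdiag_R_eq_0_iff[unfolded \<omega>_def W_def]
  let ?\<omega> = "varpi f (weyl R)"
  show "(\<forall>\<beta>\<in>two_forms. block (Omega7 \<psi>) (Omega7 \<psi>) R \<beta> = 0) \<longleftrightarrow> scal R = 0 \<and> 4 *\<^sub>R ric0 R + 5 *\<^sub>R ?\<omega> = 0"
    unfolding block_7_7_iff[OF R(1)] by (rule parts)
  show "(\<forall>\<beta>\<in>two_forms. block (Omega14 \<psi>) (Omega14 \<psi>) R \<beta> = 0)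
      \<longleftrightarrow> scal R = 0 \<and> 64 *\<^sub>R ric0 R + 5 *\<^sub>R ?\<omega> = 0 \<and> orth_proj (weyl77 f) (weyl R) = 0"
    unfolding block_14_14_iff[OF R(1)] by (rule parts)
  show "(\<forall>\<beta>\<in>two_forms. block (Omega7 \<psi>) (Omega14 \<psi>) R \<beta> + block (Omega14 \<psi>) (Omega7 \<psi>) R \<beta> = 0)
      \<longleftrightarrow> 56 *\<^sub>R ric0 R - 5 *\<^sub>R ?\<omega> = 0 \<and> orth_proj (weyl64 f) (weyl R) = 0"
    unfolding block_off_iff[OF R(1)] by (rule parts)
  have "56 *\<^sub>R ric0 R - 5 *\<^sub>R ?\<omega> = 0 \<longleftrightarrow> ?\<omega> = (56 / 5) *\<^sub>R ric0 R"
    by (auto simp: vec_eq_iff field_simps)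
  then show "curv_op R ` Omega7 \<psi> \<subseteq> Omega7 \<psi> \<and> curv_op R ` Omega14 \<psi> \<subseteq> Omega14 \<psi>
      \<longleftrightarrow> orth_proj (weyl64 f) (weyl R) = 0 \<and> ?\<omega> = (56 / 5) *\<^sub>R ric0 R"
    unfolding preserves_iff[OF R(1)] parts(3) by blast
  have "scal R = 0 \<and> 4 *\<^sub>R ric0 R + 5 *\<^sub>R ?\<omega> = 0 \<and> 64 *\<^sub>R ric0 R + 5 *\<^sub>R ?\<omega> = 0 \<longleftrightarrow> ric R = 0 \<and> ?\<omega> = 0"
  proof
    assume a: "scal R = 0 \<and> 4 *\<^sub>R ric0 R + 5 *\<^sub>R ?\<omega> = 0 \<and> 64 *\<^sub>R ric0 R + 5 *\<^sub>R ?\<omega> = 0"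
    \<comment> \<open>Subtracting the two relations eliminates \<open>varpi\<close> and leaves 64 -
      4 = 60.\<close>
    have "60 *\<^sub>R ric0 R = (64 *\<^sub>R ric0 R + 5 *\<^sub>R ?\<omega>) - (4 *\<^sub>R ric0 R + 5 *\<^sub>R ?\<omega>)" by (simp add: vec_eq_iff)
    then have "ric0 R = 0" using a by simp
    then show "ric R = 0 \<and> ?\<omega> = 0" using a by (simp add: ric_R)
  next
    assume a: "ric R = 0 \<and> ?\<omega> = 0"
    then have "scal R = 0" by (simp add: scal_def)
    moreover from this have "ric0 R = 0" using a by (simp add: ric0_def)
    ultimately show "scal R = 0 \<and> 4 *\<^sub>R ric0 R + 5 *\<^sub>R ?\<omega> = 0 \<and> 64 *\<^sub>R ric0 R + 5 *\<^sub>R ?\<omega> = 0" using a by simp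
  qed
  then show "curv_op R ` Omega7 \<psi> \<subseteq> Omega14 \<psi> \<and> curv_op R ` Omega14 \<psi> \<subseteq> Omega7 \<psi>
      \<longleftrightarrow> ric R = 0 \<and> ?\<omega> = 0 \<and> orth_proj (weyl77 f) (weyl R) = 0"
    unfolding reverses_iff[OF R(1)] parts(1,2) by blast
qed

theorem theorem5p53:
  fixes X :: "'a topology" and A :: "'a chart set"
    and \<phi> :: "'a threeform_field" and g :: "'a metric_field" and \<nu> :: "'a volume_field"
    and S :: "'a set"
  assumes "G2_structure X A \<phi> g \<nu>"
    and "S \<subseteq> topspace X"
  shows
    "((\<forall>F\<in>frames A g S. \<forall>\<beta>\<in>two_forms.
         block (Omega7 (psi_comp \<phi> \<nu> F)) (Omega7 (psi_comp \<phi> \<nu> F)) (riem_comp g F) \<beta> = 0)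
      \<longleftrightarrow>
      (\<forall>F\<in>frames A g S. scal (riem_comp g F) = 0) \<and>
      (\<forall>F\<in>frames A g S.
         4 *\<^sub>R ric0 (riem_comp g F) + 5 *\<^sub>R varpi (phi_comp \<phi> F) (weyl (riem_comp g F)) = 0))
   \<and>
     ((\<forall>F\<in>frames A g S. \<forall>\<beta>\<in>two_forms.
         block (Omega14 (psi_comp \<phi> \<nu> F)) (Omega14 (psi_comp \<phi> \<nu> F)) (riem_comp g F) \<beta> = 0)
      \<longleftrightarrow>
      (\<forall>F\<in>frames A g S. scal (riem_comp g F) = 0) \<and>
      (\<forall>F\<in>frames A g S.
         64 *\<^sub>R ric0 (riem_comp g F) + 5 *\<^sub>R varpi (phi_comp \<phi> F) (weyl (riem_comp g F)) = 0) \<and>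
      (\<forall>F\<in>frames A g S. orth_proj (weyl77 (phi_comp \<phi> F)) (weyl (riem_comp g F)) = 0))
   \<and>
     ((\<forall>F\<in>frames A g S. \<forall>\<beta>\<in>two_forms.
         block (Omega7 (psi_comp \<phi> \<nu> F)) (Omega14 (psi_comp \<phi> \<nu> F)) (riem_comp g F) \<beta>
       + block (Omega14 (psi_comp \<phi> \<nu> F)) (Omega7 (psi_comp \<phi> \<nu> F)) (riem_comp g F) \<beta> = 0)
      \<longleftrightarrow>
      (\<forall>F\<in>frames A g S.
         56 *\<^sub>R ric0 (riem_comp g F) - 5 *\<^sub>R varpi (phi_comp \<phi> F) (weyl (riem_comp g F)) = 0) \<and>
      (\<forall>F\<in>frames A g S. orth_proj (weyl64 (phi_comp \<phi> F)) (weyl (riem_comp g F)) = 0))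
   \<and>
     ((\<forall>F\<in>frames A g S.
         curv_op (riem_comp g F) ` Omega7 (psi_comp \<phi> \<nu> F) \<subseteq> Omega7 (psi_comp \<phi> \<nu> F) \<and>
         curv_op (riem_comp g F) ` Omega14 (psi_comp \<phi> \<nu> F) \<subseteq> Omega14 (psi_comp \<phi> \<nu> F))
      \<longleftrightarrow>
      (\<forall>F\<in>frames A g S. orth_proj (weyl64 (phi_comp \<phi> F)) (weyl (riem_comp g F)) = 0) \<and>
      (\<forall>F\<in>frames A g S.
         varpi (phi_comp \<phi> F) (weyl (riem_comp g F)) = (56 / 5) *\<^sub>R ric0 (riem_comp g F)))
   \<and>
     ((\<forall>F\<in>frames A g S.
         curv_op (riem_comp g F) ` Omega7 (psi_comp \<phi> \<nu> F) \<subseteq> Omega14 (psi_comp \<phi> \<nu> F) \<and>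
         curv_op (riem_comp g F) ` Omega14 (psi_comp \<phi> \<nu> F) \<subseteq> Omega7 (psi_comp \<phi> \<nu> F))
      \<longleftrightarrow>
      (\<forall>F\<in>frames A g S. ric (riem_comp g F) = 0) \<and>
      (\<forall>F\<in>frames A g S. varpi (phi_comp \<phi> F) (weyl (riem_comp g F)) = 0) \<and>
      (\<forall>F\<in>frames A g S. orth_proj (weyl77 (phi_comp \<phi> F)) (weyl (riem_comp g F)) = 0))"
proof -
  \<comment> \<open>All conditions quantify over the same frames, so the equivalences in a single
    frame suffice.\<close>
  note e = frame_equivalences[OF assms(1), where S = S]
  show ?thesis
    unfolding ball_conj_distrib[symmetric]
    by (intro conjI ball_cong refl e)
qed

end
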